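(* Let $k$ be a field of characteristic zero and $R=k[x_1,x_2,x_3,x_4]$. Let $a\ge 3$ be an integer, let $X\subset\mathbb P^3$ be an $a\times a$ grid, let $d$ be a positive integer, and let $I\subset R$ be the ideal generated by the powers $\ell^d$ for all linear forms $\ell$ with $\ell^{\vee}\in X$. Then $R/I$ has the Weak Lefschetz Property if and only if either $d\le a-1$ or $a-1$ divides $d$.
   Context: $R$ has the standard grading; $[M]_t$ denotes the degree $t$ component of a graded module $M$. An $a\times b$ grid is a set of $ab$ points in $\mathbb P^3$ lying on a smooth quadric surface $\mathcal Q$ and given as the intersection points of $a$ distinct lines in one ruling of $\mathcal Q$ with $b$ distinct lines in the other ruling. For a nonzero linear form $\ell=\sum\alpha_i x_i$, the dual point is $\ell^{\vee}=[\alpha_1:\dots:\alpha_4]\in\mathbb P^3$ (and $\ell$ is called the linear form dual to that point; it is defined up to scalar). An artinian graded $k$-algebra $A=R/I$ has the Weak Lefschetz Property (WLP) if for a general linear form $\ell$ the multiplication map $\times\ell:[A]_{t-1}\to[A]_t$ has maximal rank (is injective or surjective) for all $t$. *)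

theory Defs
  imports "HOL-Analysis.Cartesian_Space" "HOL-Library.Poly_Mapping"
begin

text \<open>
  \<open>k[x\<^sub>1, \<dots>, x\<^sub>4]\<close> is the monoid algebra of the exponent vectors
  \<^typ>\<open>4 \<Rightarrow>\<^sub>0 nat\<close>; the four variables are indexed by the elements of
  the type \<^typ>\<open>4\<close>.
\<close>

type_synonym 'k poly4 = "(4 \<Rightarrow>\<^sub>0 nat) \<Rightarrow>\<^sub>0 'k"

definition poly_eval :: "'k::comm_ring_1 poly4 \<Rightarrow> 'k ^ 4 \<Rightarrow> 'k" where
  "poly_eval p v = (\<Sum>m\<in>Poly_Mapping.keys p. Poly_Mapping.lookup p m * (\<Prod>i\<in>UNIV. v $ i ^ Poly_Mapping.lookup m i))"

definition partial_deriv :: "4 \<Rightarrow> 'k::comm_ring_1 poly4 \<Rightarrow> 'k poly4" where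
  "partial_deriv i p =
     (\<Sum>m\<in>Poly_Mapping.keys p. Poly_Mapping.single (m - Poly_Mapping.single i 1)
                     (of_nat (Poly_Mapping.lookup m i) * Poly_Mapping.lookup p m))"

text \<open>The graded component \<open>[R]\<^sub>t\<close> (including \<open>0\<close>).\<close>

definition forms :: "nat \<Rightarrow> 'k::comm_ring_1 poly4 set" where
  "forms t = {p. \<forall>m\<in>Poly_Mapping.keys p. (\<Sum>i\<in>UNIV. Poly_Mapping.lookup m i) = t}"

definition linear_form :: "'k::comm_ring_1 ^ 4 \<Rightarrow> 'k poly4" where
  "linear_form \<alpha> = (\<Sum>i\<in>UNIV. Poly_Mapping.single (Poly_Mapping.single i 1) (\<alpha> $ i))"


text \<open>
  The ideals of a commutative ring are its submodules as a module over itself.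
\<close>

interpretation self_module: module "(*) :: 'a::comm_ring_1 \<Rightarrow> 'a \<Rightarrow> 'a"
  by standard (simp_all add: algebra_simps)

definition is_ideal :: "'a::comm_ring_1 set \<Rightarrow> bool" where
  "is_ideal I \<longleftrightarrow> self_module.subspace I"

definition ideal_generated :: "'a::comm_ring_1 set \<Rightarrow> 'a set" where
  "ideal_generated S = self_module.span S"

text \<open>
  The quotient \<open>A = R/I\<close> by an ideal \<open>I\<close> consists of the residue classes modulo \<open>I\<close>.
  Its ideals correspond to the ideals of \<open>R\<close> containing \<open>I\<close>, so that \<open>A\<close> is artinian
  iff these satisfy the descending chain condition.
\<close>

definition residue_class :: "'a::comm_ring_1 set \<Rightarrow> 'a \<Rightarrow> 'a set" where
  "residue_class I f = {g. g - f \<in> I}"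

definition quot_mult :: "'a::comm_ring_1 set \<Rightarrow> 'a \<Rightarrow> 'a set \<Rightarrow> 'a set" where
  "quot_mult I l C = (\<Union>f\<in>C. residue_class I (l * f))"

lemma quot_mult_residue_class:
  assumes "is_ideal I"
  shows "quot_mult I l (residue_class I f) = residue_class I (l * f)"
proof (intro equalityI subsetI)
  fix h assume "h \<in> quot_mult I l (residue_class I f)"
  then obtain g where g: "g - f \<in> I" and h: "h - l * g \<in> I"
    by (auto simp: quot_mult_def residue_class_def)
  have "(h - l * g) + l * (g - f) \<in> I"
    using assms g h unfolding is_ideal_def
    by (intro self_module.subspace_add self_module.subspace_scale) auto
  then show "h \<in> residue_class I (l * f)"
    by (simp add: residue_class_def algebra_simps)
next
  fix h assume "h \<in> residue_class I (l * f)"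
  moreover have "f \<in> residue_class I f"
    using assms by (simp add: residue_class_def is_ideal_def self_module.subspace_0)
  ultimately show "h \<in> quot_mult I l (residue_class I f)"
    by (auto simp: quot_mult_def)
qed

definition artinian_quotient :: "'a::comm_ring_1 set \<Rightarrow> bool" where
  "artinian_quotient I \<longleftrightarrow>
     \<not> (\<exists>J :: nat \<Rightarrow> 'a set. \<forall>n. is_ideal (J n) \<and> I \<subseteq> J n \<and> J (Suc n) \<subset> J n)"

text \<open>\<open>[R/I]\<^sub>t\<close>, as the image of \<open>[R]\<^sub>t\<close>.\<close>

definition quot_component :: "'k::comm_ring_1 poly4 set \<Rightarrow> nat \<Rightarrow> 'k poly4 set set" where
  "quot_component I t = residue_class I ` forms t"


definition zariski_closed :: "('k::field ^ 4) set \<Rightarrow> bool" where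
  "zariski_closed Z \<longleftrightarrow> (\<exists>S. Z = {v. \<forall>F\<in>S. poly_eval F v = 0})"

text \<open>
  A property holds for a general linear form if it holds on a nonempty Zariski open set of
  coefficient vectors. Over an infinite field the vector \<open>0\<close> may be removed from
  such a set without making it empty.
\<close>

definition general_linear_form :: "('k::field poly4 \<Rightarrow> bool) \<Rightarrow> bool" where
  "general_linear_form P \<longleftrightarrow>
     (\<exists>U. zariski_closed (- U) \<and> U \<noteq> {} \<and> (\<forall>\<alpha>\<in>U. \<alpha> \<noteq> 0 \<longrightarrow> P (linear_form \<alpha>)))"

text \<open>
  Below, \<open>[A]\<^sub>t \<rightarrow> [A]\<^sub>t\<^sub>+\<^sub>1\<close> is considered for \<open>t \<ge> 0\<close>; the map out of \<open>[A]\<^sub>-\<^sub>1 = 0\<close> is injective.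
\<close>

definition weak_lefschetz :: "'k::field poly4 set \<Rightarrow> bool" where
  "weak_lefschetz I \<longleftrightarrow>
     artinian_quotient I \<and>
     general_linear_form (\<lambda>l. \<forall>t.
       inj_on (quot_mult I l) (quot_component I t) \<or>
       quot_mult I l ` quot_component I t = quot_component I (Suc t))"


text \<open>
  Points of \<open>\<P>\<^sup>3\<close> are the lines through the origin of \<open>k\<^sup>4\<close>; subsets of \<open>\<P>\<^sup>3\<close> are
  represented by their sets of \<open>k\<close>-rational points.
\<close>

definition proj_point :: "'k::field ^ 4 \<Rightarrow> ('k ^ 4) set" where
  "proj_point v = vec.span {v}"

definition proj_space :: "('k::field ^ 4) set set" where
  "proj_space = {proj_point v | v. v \<noteq> 0}"

definition proj_line :: "('k::field ^ 4) set set \<Rightarrow> bool" where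
  "proj_line L \<longleftrightarrow>
     (\<exists>W. vec.subspace W \<and> vec.dim W = 2 \<and> L = {p \<in> proj_space. p \<subseteq> W})"

text \<open>
  Smoothness is the Jacobian criterion. The partial derivatives are linear forms over \<open>k\<close>,
  and in characteristic zero their common zeros lie on the quadric, so a singular point over
  the algebraic closure exists only if there is one over \<open>k\<close>.
\<close>

definition smooth_quadric :: "('k::field ^ 4) set set \<Rightarrow> bool" where
  "smooth_quadric Q \<longleftrightarrow>
     (\<exists>q \<in> forms 2.
        (\<forall>v. v \<noteq> 0 \<and> poly_eval q v = 0 \<longrightarrow> (\<exists>i. poly_eval (partial_deriv i q) v \<noteq> 0)) \<and>
        Q = {proj_point v | v. v \<noteq> 0 \<and> poly_eval q v = 0})"

text \<open>
  A ruling of \<open>Q\<close> is a family of lines on \<open>Q\<close> with exactly one member through each point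
  of \<open>Q\<close>. A smooth quadric containing a line has exactly two rulings, and two lines from
  different rulings meet in exactly one point; hence an \<open>a \<times> b\<close> grid has \<open>a b\<close> points.
\<close>

definition ruling :: "('k::field ^ 4) set set \<Rightarrow> ('k ^ 4) set set set \<Rightarrow> bool" where
  "ruling Q \<R> \<longleftrightarrow>
     (\<forall>L\<in>\<R>. proj_line L \<and> L \<subseteq> Q) \<and> (\<forall>p\<in>Q. \<exists>!L. L \<in> \<R> \<and> p \<in> L)"

definition is_grid :: "nat \<Rightarrow> nat \<Rightarrow> ('k::field ^ 4) set set \<Rightarrow> bool" where
  "is_grid a b X \<longleftrightarrow>
     (\<exists>Q \<R>\<^sub>1 \<R>\<^sub>2 \<A> \<B>.
        smooth_quadric Q \<and> ruling Q \<R>\<^sub>1 \<and> ruling Q \<R>\<^sub>2 \<and> \<R>\<^sub>1 \<noteq> \<R>\<^sub>2 \<and>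
        \<A> \<subseteq> \<R>\<^sub>1 \<and> finite \<A> \<and> card \<A> = a \<and>
        \<B> \<subseteq> \<R>\<^sub>2 \<and> finite \<B> \<and> card \<B> = b \<and>
        X = {p. \<exists>L\<in>\<A>. \<exists>M\<in>\<B>. p \<in> L \<and> p \<in> M})"

text \<open>
  The ideal generated by \<open>\<ell>\<^sup>d\<close> for all nonzero linear forms \<open>\<ell> = \<Sum> \<alpha>\<^sub>i x\<^sub>i\<close> whose dual point
  \<open>[\<alpha>\<^sub>1 : \<dots> : \<alpha>\<^sub>4]\<close> lies in \<open>X\<close>.
\<close>

definition power_ideal :: "nat \<Rightarrow> ('k::field ^ 4) set set \<Rightarrow> 'k poly4 set" where
  "power_ideal d X =
     ideal_generated {linear_form \<alpha> ^ d | \<alpha>. \<alpha> \<noteq> 0 \<and> proj_point \<alpha> \<in> X}"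

end

theory Submission
  imports Defs "HOL-Computational_Algebra.Polynomial"
begin

text \<open>
  In suitable coordinates a grid and a general linear form \<open>\<ell>\<close> become \<open>{(1, r\<^sub>i) \<otimes> (1, s\<^sub>j)}\<close>
  in \<open>k\<^sup>2 \<otimes> k\<^sup>2\<close> and the antisymmetric tensor. Modulo \<open>\<ell>\<close> the form \<open>L(x, y)\<close> dual to
  \<open>(1, x) \<otimes> (1, y)\<close> is then symmetric in \<open>x\<close> and \<open>y\<close>. Write \<open>t = d + m - 1\<close> for the target degree.

  \<^item> If \<open>t < a m\<close>, multiplication by \<open>\<ell>\<close> is surjective: a functional \<open>\<Phi>\<close> of degree \<open>t\<close> that kills
    \<open>I + (\<ell>)\<close> gives the symmetric polynomial \<open>\<Phi>(L(x, y)\<^sup>t)\<close> of bidegree at most \<open>(t, t)\<close>. Along each line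
    \<open>y = s\<^sub>j\<close> it vanishes to order \<open>m\<close> at the \<open>a\<close> points \<open>r\<^sub>i\<close>, so that line divides it; symmetry and
    induction on the order of vanishing show that it is \<open>0\<close>.
  \<^item> If \<open>t \<ge> a m\<close>, it is not surjective: a product of \<open>t\<close> derivations that kill \<open>\<ell>\<close>, at least \<open>m\<close>
    of which kill \<open>L(r\<^sub>i, s\<^sub>j)\<close> for each \<open>i\<close> and \<open>j\<close>, kills \<open>I + (\<ell>)\<close> but not \<open>R\<^sub>t\<close>.
  \<^item> If \<open>(a - 1) (m + 1) \<le> d\<close>, it is injective: the powers \<open>L(r\<^sub>i, s\<^sub>j)\<^sup>d\<close> admit no relation modulo \<open>\<ell>\<close>
    with coefficients of degree \<open>m - 1\<close>, by induction on \<open>m\<close>, applying products of \<open>a\<close> derivations.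
  \<^item> If \<open>a m \<le> t \<le> a m + a - 3\<close>, it is not injective: Lagrange interpolation shows that
    \<open>\<Omega> = \<Sum> w\<^sub>j\<^sub>k L(s\<^sub>j, s\<^sub>k)\<^sup>t\<close>, with explicit antisymmetric weights \<open>w\<^sub>j\<^sub>k\<close>, lies in \<open>I\<close>. It is a multiple
    of \<open>\<ell>\<close>, and the quotient is not in \<open>I\<close>.

  So maximal rank fails exactly if \<open>(a - 1) m < d < (a - 1) (m + 1)\<close> for some \<open>m \<ge> 1\<close>.
\<close>

\<comment> \<open>As a simp rule it loops with \<open>mult.assoc\<close>.\<close>
declare self_module.scale_scale [simp del]

text \<open>Geometrically, passing to \<open>R/(ell)\<close> projects the quadric from the point
  dual to \<open>ell\<close> onto a plane. This is a double cover branched along a conic, and the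
  lines of both rulings go to tangents of that conic: the grid becomes the set of intersections of
  the tangents with parameters r_i with those with parameters s_j. A derivation that kills
  \<open>ell\<close> is a linear form on this plane, \<open>fn u u\<close> being the tangent with
  parameter u. By apolarity, a form of degree t = d + m - 1 on the plane kills the degree t part of
  I exactly if it vanishes to order m at the projected points. The a tangents r_i, each taken m
  times, form such a curve of degree a m; hence the threshold. In terms of d, the conditions a m
  \<le> t and t \<le> a m + a - 3 read (a - 1) m < d and d < (a - 1) (m + 1). The weights are
  residues: for fixed k they express that the residues of p / (g^m h) add up to 0, where p(x) = (x -
  s_k) \<Phi>(L(x, s_k)^t), g and h have the roots r_i and s_j, and g^m divides p. The factor x -
  s_k makes the weights antisymmetric in j and k.\<close>

section \<open>Constants, variables and induction over polynomials\<close>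

definition cst :: "'k::comm_ring_1 \<Rightarrow> 'k poly4" where
  "cst c = Poly_Mapping.single 0 c"

definition var :: "4 \<Rightarrow> 'k::comm_ring_1 poly4" where
  "var i = Poly_Mapping.single (Poly_Mapping.single i 1) 1"

lemma cst_0 [simp]: "cst 0 = 0"
  and cst_1 [simp]: "cst 1 = 1"
  and cst_add: "cst (x + y) = cst x + cst y"
  and cst_minus: "cst (- x) = - cst x"
  and cst_diff: "cst (x - y) = cst x - cst y"
  and cst_mult: "cst (x * y) = cst x * cst y"
  by (simp_all add: cst_def single_add single_uminus single_diff mult_single)

lemma cst_of_nat: "cst (of_nat n) = of_nat n"
  by (simp add: cst_def)

lemma cst_power: "cst (x ^ n) = cst x ^ n"
  by (induction n) (simp_all add: cst_mult)

lemma cst_sum: "cst (sum f A) = (\<Sum>x\<in>A. cst (f x))"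
  by (induction A rule: infinite_finite_induct) (simp_all add: cst_add)

lemma cst_mult_single: "cst c * Poly_Mapping.single m x = Poly_Mapping.single m (c * x)"
  by (simp add: cst_def mult_single)

lemma cst_inverse_cancel: "c \<noteq> 0 \<Longrightarrow> cst (inverse c) * (cst c * p) = p" for c :: "'k::field"
  by (simp add: mult.assoc[symmetric] cst_mult[symmetric])

lemma poly4_sum_singles:
  fixes p :: "'k::comm_ring_1 poly4"
  shows "p = (\<Sum>m\<in>Poly_Mapping.keys p. Poly_Mapping.single m (Poly_Mapping.lookup p m))"
proof (rule poly_mapping_eqI)
  fix m
  show "Poly_Mapping.lookup p m = Poly_Mapping.lookup
      (\<Sum>m\<in>Poly_Mapping.keys p. Poly_Mapping.single m (Poly_Mapping.lookup p m)) m"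
    by (cases "m \<in> Poly_Mapping.keys p")
      (auto simp: lookup_sum lookup_single when_def sum.delta in_keys_iff)
qed

lemma poly4_induct [case_names single add]:
  fixes p :: "'k::comm_ring_1 poly4"
  assumes "\<And>m c. P (Poly_Mapping.single m c)" and "\<And>p q. P p \<Longrightarrow> P q \<Longrightarrow> P (p + q)"
  shows "P p"
proof -
  have "P (\<Sum>m\<in>A. Poly_Mapping.single m (Poly_Mapping.lookup p m))" if "finite A" for A
    using that by (induction A rule: finite_induct) (use assms assms(1)[of 0 0] in auto)
  from this[of "Poly_Mapping.keys p"] show ?thesis
    using poly4_sum_singles[of p] by simp
qed

subsection \<open>Evaluation\<close>

lemma poly_eval_superset:
  assumes "finite A" and "Poly_Mapping.keys p \<subseteq> A"
  shows "poly_eval p v = (\<Sum>m\<in>A. Poly_Mapping.lookup p m * (\<Prod>i\<in>UNIV. v $ i ^ Poly_Mapping.lookup m i))"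
  unfolding poly_eval_def
  by (rule sum.mono_neutral_left) (use assms in \<open>auto simp: in_keys_iff\<close>)

lemma poly_eval_add: "poly_eval (p + q) v = poly_eval p v + poly_eval q v"
proof -
  let ?A = "Poly_Mapping.keys p \<union> Poly_Mapping.keys q"
  have "Poly_Mapping.keys (p + q) \<subseteq> ?A"
    by (rule keys_add)
  then show ?thesis
    by (simp add: poly_eval_superset[of ?A] lookup_add distrib_right sum.distrib)
qed

lemma poly_eval_single:
  "poly_eval (Poly_Mapping.single m c) v = c * (\<Prod>i\<in>UNIV. v $ i ^ Poly_Mapping.lookup m i)"
  by (simp add: poly_eval_def)

lemma poly_eval_mult: "poly_eval (p * q) v = poly_eval p v * poly_eval q v"
proof (induction p rule: poly4_induct)
  case (single m c)
  show ?case
  proof (induction q rule: poly4_induct)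
    case (single n d)
    have "(\<Prod>i\<in>UNIV. v $ i ^ Poly_Mapping.lookup (m + n) i)
        = (\<Prod>i\<in>UNIV. v $ i ^ Poly_Mapping.lookup m i) * (\<Prod>i\<in>UNIV. v $ i ^ Poly_Mapping.lookup n i)"
      unfolding lookup_add power_add by (rule prod.distrib)
    then show ?case
      unfolding mult_single poly_eval_single by (simp only: mult_ac)
  next
    case (add p q)
    then show ?case
      unfolding distrib_left poly_eval_add by (simp only: )
  qed
next
  case (add p q)
  then show ?case
    unfolding distrib_right poly_eval_add by (simp only: )
qed

lemma poly_eval_cst [simp]: "poly_eval (cst c) v = c"
  by (simp add: cst_def poly_eval_single)

lemma poly_eval_0 [simp]: "poly_eval 0 v = 0"
  and poly_eval_1 [simp]: "poly_eval 1 v = 1"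
  using poly_eval_cst[of 0 v] poly_eval_cst[of 1 v] by simp_all

lemma poly_eval_var [simp]: "poly_eval (var i) v = v $ i"
proof -
  have "(\<Prod>j\<in>UNIV. v $ j ^ Poly_Mapping.lookup (Poly_Mapping.single i (Suc 0)) j)
      = (\<Prod>j\<in>UNIV. if j = i then v $ j else 1)"
    by (rule prod.cong) (auto simp: lookup_single)
  then show ?thesis
    by (simp add: var_def poly_eval_single prod.delta)
qed

lemma poly_eval_minus: "poly_eval (- p) v = - poly_eval p v"
  using poly_eval_add[of p "- p" v] by (simp add: add_eq_0_iff)

lemma poly_eval_diff: "poly_eval (p - q) v = poly_eval p v - poly_eval q v"
  using poly_eval_add[of p "- q" v] by (simp add: poly_eval_minus)

lemma poly_eval_sum: "poly_eval (sum f A) v = (\<Sum>x\<in>A. poly_eval (f x) v)"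
  by (induction A rule: infinite_finite_induct) (simp_all add: poly_eval_add)

lemma poly_eval_prod: "poly_eval (prod f A) v = (\<Prod>x\<in>A. poly_eval (f x) v)"
  by (induction A rule: infinite_finite_induct) (simp_all add: poly_eval_mult)

lemma poly_eval_power: "poly_eval (p ^ n) v = poly_eval p v ^ n"
  by (induction n) (simp_all add: poly_eval_mult)

lemma poly_eval_line: "\<exists>q. \<forall>c. poly_eval p (v + c *s w) = poly q c"
proof (induction p rule: poly4_induct)
  case (single m a)
  have "poly_eval (Poly_Mapping.single m a) (v + c *s w)
      = poly (smult a (\<Prod>i\<in>UNIV. [:v $ i, w $ i:] ^ Poly_Mapping.lookup m i)) c" for c
    by (simp add: poly_eval_single poly_prod poly_power)
  then show ?case
    by blast
next
  case (add p q)
  then obtain f g where "\<forall>c. poly_eval p (v + c *s w) = poly f c" "\<forall>c. poly_eval q (v + c *s w) = poly g c"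
    by blast
  then have "\<forall>c. poly_eval (p + q) (v + c *s w) = poly (f + g) c"
    by (simp add: poly_eval_add)
  then show ?case
    by blast
qed

text \<open>On the line through \<open>v\<close> and \<open>w\<close> both polynomials restrict to
  nonzero univariate polynomials, whose finitely many roots cannot cover an infinite field. So any
  two nonempty Zariski open sets meet.\<close>

lemma exists_common_nonzero:
  fixes p q :: "'k::field_char_0 poly4"
  assumes "poly_eval p v \<noteq> 0" and "poly_eval q w \<noteq> 0"
  shows "\<exists>u. poly_eval p u \<noteq> 0 \<and> poly_eval q u \<noteq> 0"
proof -
  obtain f where f: "\<And>c. poly_eval p (v + c *s (w - v)) = poly f c"
    using poly_eval_line by blast
  obtain g where g: "\<And>c. poly_eval q (v + c *s (w - v)) = poly g c"
    using poly_eval_line by blast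
  have "f \<noteq> 0" "g \<noteq> 0"
    using f[of 0] g[of 1] assms by auto
  then have "finite {c. poly f c = 0}" "finite {c. poly g c = 0}"
    by (simp_all add: poly_roots_finite)
  then obtain c where "poly f c \<noteq> 0" "poly g c \<noteq> 0"
    using ex_new_if_finite[OF infinite_UNIV_char_0, of "{c. poly f c = 0} \<union> {c. poly g c = 0}"]
    by blast
  with f g show ?thesis
    by metis
qed

lemma exists_prod_nonzero:
  fixes p :: "'a \<Rightarrow> 'k::field_char_0 poly4"
  assumes "finite A" and "\<And>x. x \<in> A \<Longrightarrow> \<exists>v. poly_eval (p x) v \<noteq> 0"
  shows "\<exists>v. poly_eval (prod p A) v \<noteq> 0"
  using assms
proof (induction A rule: finite_induct)
  case (insert x A)
  then obtain v w where "poly_eval (p x) v \<noteq> 0" "poly_eval (prod p A) w \<noteq> 0"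
    by (metis insert_iff)
  then show ?case
    using exists_common_nonzero insert.hyps by (fastforce simp: poly_eval_mult)
qed simp

subsection \<open>Forms\<close>

lemma forms_0 [simp]: "0 \<in> forms t"
  by (simp add: forms_def)

lemma forms_add: "p \<in> forms t \<Longrightarrow> q \<in> forms t \<Longrightarrow> p + q \<in> forms t"
  using keys_add[of p q] by (auto simp: forms_def)

lemma forms_mult:
  assumes "p \<in> forms s" and "q \<in> forms t"
  shows "p * q \<in> forms (s + t)"
  unfolding forms_def
proof (intro CollectI ballI)
  fix m assume "m \<in> Poly_Mapping.keys (p * q)"
  then obtain m1 m2 where "m = m1 + m2" "m1 \<in> Poly_Mapping.keys p" "m2 \<in> Poly_Mapping.keys q"
    using keys_mult by blast
  with assms show "(\<Sum>i\<in>UNIV. Poly_Mapping.lookup m i) = s + t"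
    by (simp add: forms_def lookup_add sum.distrib)
qed

lemma forms_cst [simp]: "cst c \<in> forms 0"
  by (auto simp: forms_def cst_def)

lemma forms_1 [simp]: "1 \<in> forms 0"
  using forms_cst[of 1] by simp

lemma forms_var [simp]: "var i \<in> forms 1"
proof -
  have "(\<Sum>j\<in>UNIV. Poly_Mapping.lookup (Poly_Mapping.single i (1::nat)) j)
      = (\<Sum>j\<in>UNIV. if j = i then 1 else 0)"
    by (rule sum.cong) (auto simp: lookup_single)
  then show ?thesis
    by (simp add: forms_def var_def)
qed

lemma forms_cst_mult: "p \<in> forms t \<Longrightarrow> cst c * p \<in> forms t"
  using forms_mult[of "cst c" 0 p t] by simp

lemma forms_minus: "p \<in> forms t \<Longrightarrow> - p \<in> forms t"
  using forms_cst_mult[of p t "- 1"] by (simp add: cst_minus)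

lemma forms_diff: "p \<in> forms t \<Longrightarrow> q \<in> forms t \<Longrightarrow> p - q \<in> forms t"
  using forms_add[of p t "- q"] by (simp add: forms_minus)

lemma forms_sum: "(\<And>x. x \<in> A \<Longrightarrow> f x \<in> forms t) \<Longrightarrow> sum f A \<in> forms t"
  by (induction A rule: infinite_finite_induct) (auto intro: forms_add)

lemma forms_power: "p \<in> forms t \<Longrightarrow> p ^ n \<in> forms (n * t)"
  by (induction n) (auto intro: forms_mult)

lemma forms_0_cst: "p \<in> forms 0 \<Longrightarrow> \<exists>c. p = cst c"
proof -
  assume p: "p \<in> forms 0"
  have "m = 0" if "m \<in> Poly_Mapping.keys p" for m
    using p that by (intro poly_mapping_eqI) (auto simp: forms_def)
  then have "Poly_Mapping.keys p \<subseteq> {0}"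
    by blast
  then have "p = cst (Poly_Mapping.lookup p 0)"
    by (intro poly_mapping_eqI) (auto simp: cst_def lookup_single when_def in_keys_iff)
  then show ?thesis
    by blast
qed

lemma single_in_forms:
  "c = 0 \<or> (\<Sum>i\<in>UNIV. Poly_Mapping.lookup m i) = t \<Longrightarrow> Poly_Mapping.single m c \<in> forms t"
  by (auto simp: forms_def)

text \<open>Every monomial of positive degree is divisible by a variable. Induction on the degree of
  a form rests on this.\<close>

lemma forms_Suc_decompose:
  assumes "p \<in> forms (Suc t)"
  shows "\<exists>g. (\<forall>i. g i \<in> forms t) \<and> p = (\<Sum>i\<in>UNIV. var i * g i)"
proof -
  have *: "\<exists>g. (\<forall>i. g i \<in> forms t) \<and> Poly_Mapping.single m c = (\<Sum>i\<in>UNIV. var i * g i)"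
    if m: "(\<Sum>i\<in>UNIV. Poly_Mapping.lookup m i) = Suc t" for m :: "4 \<Rightarrow>\<^sub>0 nat" and c :: 'a
  proof -
    from m obtain i where i: "Poly_Mapping.lookup m i \<noteq> 0"
      by (metis Zero_not_Suc sum.neutral)
    define n where "n = m - Poly_Mapping.single i 1"
    have mn: "m = Poly_Mapping.single i 1 + n"
      using i by (intro poly_mapping_eqI) (auto simp: n_def lookup_add lookup_minus lookup_single when_def)
    have "(\<Sum>j\<in>UNIV. Poly_Mapping.lookup m j)
      = (\<Sum>j\<in>UNIV. (if j = i then 1 else 0) + Poly_Mapping.lookup n j)"
      by (rule sum.cong) (auto simp: mn lookup_add lookup_single)
    then have "(\<Sum>i\<in>UNIV. Poly_Mapping.lookup n i) = t"
      using m by (simp add: sum.distrib)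
    then have 1: "Poly_Mapping.single n c \<in> forms t"
      by (simp add: single_in_forms)
    have 2: "Poly_Mapping.single m c = var i * Poly_Mapping.single n c"
      by (simp add: mn var_def mult_single)
    have "var j * (if j = i then Poly_Mapping.single n c else 0)
        = (if j = i then var j * Poly_Mapping.single n c else 0)" for j
      by simp
    then have "Poly_Mapping.single m c = (\<Sum>j\<in>UNIV. var j * (if j = i then Poly_Mapping.single n c else 0))"
      using 2 by (simp only: sum.delta finite_UNIV) simp
    with 1 show ?thesis
      by (intro exI[of _ "\<lambda>j. if j = i then Poly_Mapping.single n c else 0"]) auto
  qed
  have "\<exists>g. (\<forall>i. g i \<in> forms t) \<and>
      (\<Sum>m\<in>A. Poly_Mapping.single m (Poly_Mapping.lookup p m)) = (\<Sum>i\<in>UNIV. var i * g i)"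
    if "finite A" "A \<subseteq> Poly_Mapping.keys p" for A
    using that
  proof (induction A rule: finite_induct)
    case empty
    then show ?case
      by (intro exI[of _ "\<lambda>_. 0"]) simp
  next
    case (insert m A)
    then obtain g where g: "\<And>i. g i \<in> forms t"
      "(\<Sum>m\<in>A. Poly_Mapping.single m (Poly_Mapping.lookup p m)) = (\<Sum>i\<in>UNIV. var i * g i)"
      by auto
    have "(\<Sum>i\<in>UNIV. Poly_Mapping.lookup m i) = Suc t"
      using insert.prems assms by (simp add: forms_def)
    from *[OF this] obtain h where h: "\<And>i. h i \<in> forms t"
      "Poly_Mapping.single m (Poly_Mapping.lookup p m) = (\<Sum>i\<in>UNIV. var i * h i)"
      by metis
    show ?case
      by (rule exI[of _ "\<lambda>i. h i + g i"])
        (use insert.hyps g h in \<open>auto simp: distrib_left sum.distrib intro: forms_add\<close>)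
  qed
  from this[of "Poly_Mapping.keys p"] show ?thesis
    using poly4_sum_singles[of p] by simp
qed

text \<open>Coefficients that witness membership in an ideal may have any degree; homogeneous parts
  cut them down to forms of the required degree.\<close>

definition hom_part :: "nat \<Rightarrow> 'k::comm_ring_1 poly4 \<Rightarrow> 'k poly4" where
  "hom_part t p = (\<Sum>m\<in>{m \<in> Poly_Mapping.keys p. (\<Sum>i\<in>UNIV. Poly_Mapping.lookup m i) = t}.
     Poly_Mapping.single m (Poly_Mapping.lookup p m))"

lemma lookup_hom_part:
  "Poly_Mapping.lookup (hom_part t p) m
    = (if (\<Sum>i\<in>UNIV. Poly_Mapping.lookup m i) = t then Poly_Mapping.lookup p m else 0)"
proof -
  let ?A = "{m \<in> Poly_Mapping.keys p. (\<Sum>i\<in>UNIV. Poly_Mapping.lookup m i) = t}"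
  have "Poly_Mapping.lookup (hom_part t p) m = (\<Sum>n\<in>?A. if n = m then Poly_Mapping.lookup p n else 0)"
    unfolding hom_part_def lookup_sum by (rule sum.cong) (auto simp: lookup_single)
  also have "\<dots> = (if m \<in> ?A then Poly_Mapping.lookup p m else 0)"
    by (simp add: sum.delta)
  finally show ?thesis
    by (auto simp: in_keys_iff)
qed

lemma hom_part_forms: "hom_part t p \<in> forms t"
  unfolding hom_part_def by (intro forms_sum) (auto intro: single_in_forms)

lemma hom_part_add: "hom_part t (p + q) = hom_part t p + hom_part t q"
  by (rule poly_mapping_eqI) (simp add: lookup_hom_part lookup_add)

lemma hom_part_sum: "hom_part t (sum f A) = (\<Sum>x\<in>A. hom_part t (f x))"
proof (induction A rule: infinite_finite_induct)
  case empty
  show ?case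
    by (rule poly_mapping_eqI) (simp add: lookup_hom_part)
next
  case (infinite A)
  then show ?case
    by (simp, intro poly_mapping_eqI) (simp add: lookup_hom_part)
qed (simp add: hom_part_add)

lemma hom_part_same: "p \<in> forms t \<Longrightarrow> hom_part t p = p"
  by (rule poly_mapping_eqI) (auto simp: lookup_hom_part forms_def in_keys_iff)

lemma hom_part_other: "p \<in> forms s \<Longrightarrow> s \<noteq> t \<Longrightarrow> hom_part t p = 0"
  by (rule poly_mapping_eqI) (auto simp: lookup_hom_part forms_def in_keys_iff)

lemma hom_part_mult:
  assumes "p \<in> forms s"
  shows "hom_part t (p * q) = (if s \<le> t then p * hom_part (t - s) q else 0)"
proof (induction q rule: poly4_induct)
  case (single m c)
  let ?n = "\<Sum>i\<in>UNIV. Poly_Mapping.lookup m i"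
  have *: "Poly_Mapping.single m c \<in> forms ?n"
    by (simp add: single_in_forms)
  with assms have "p * Poly_Mapping.single m c \<in> forms (s + ?n)"
    by (rule forms_mult)
  then show ?case
    using * by (cases "s + ?n = t") (auto simp: hom_part_same hom_part_other)
qed (simp add: hom_part_add distrib_left)

subsection \<open>Linear forms and derivations\<close>

lemma linear_form_alt: "linear_form \<alpha> = (\<Sum>i\<in>UNIV. cst (\<alpha> $ i) * var i)"
  by (simp add: linear_form_def var_def cst_mult_single)

lemma linear_form_add: "linear_form (\<alpha> + \<beta>) = linear_form \<alpha> + linear_form \<beta>"
  by (simp add: linear_form_alt cst_add distrib_right sum.distrib)

lemma linear_form_scale: "linear_form (c *s \<alpha>) = cst c * linear_form \<alpha>"
  by (simp add: linear_form_alt cst_mult sum_distrib_left mult.assoc)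

lemma linear_form_diff: "linear_form (\<alpha> - \<beta>) = linear_form \<alpha> - linear_form \<beta>"
  by (simp add: linear_form_alt cst_diff left_diff_distrib sum_subtractf)

lemma linear_form_axis: "linear_form (axis i 1) = var i"
proof -
  have "linear_form (axis i 1) = (\<Sum>j\<in>UNIV. if j = i then var j else 0)"
    unfolding linear_form_alt by (rule sum.cong) (auto simp: axis_def)
  then show ?thesis
    by simp
qed

lemma forms_linear_form [simp]: "linear_form \<alpha> \<in> forms 1"
  unfolding linear_form_alt by (intro forms_sum forms_cst_mult forms_var)

lemma poly_eval_linear_form: "poly_eval (linear_form \<alpha>) v = (\<Sum>i\<in>UNIV. \<alpha> $ i * v $ i)"
  by (simp add: linear_form_alt poly_eval_sum poly_eval_mult)

lemma partial_deriv_superset: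
  assumes "finite A" and "Poly_Mapping.keys p \<subseteq> A"
  shows "partial_deriv i p = (\<Sum>m\<in>A. Poly_Mapping.single (m - Poly_Mapping.single i 1)
                     (of_nat (Poly_Mapping.lookup m i) * Poly_Mapping.lookup p m))"
  unfolding partial_deriv_def
  by (rule sum.mono_neutral_left) (use assms in \<open>auto simp: in_keys_iff\<close>)

lemma partial_deriv_add: "partial_deriv i (p + q) = partial_deriv i p + partial_deriv i q"
proof -
  let ?A = "Poly_Mapping.keys p \<union> Poly_Mapping.keys q"
  have "Poly_Mapping.keys (p + q) \<subseteq> ?A"
    by (rule keys_add)
  then show ?thesis
    by (simp add: partial_deriv_superset[of ?A] lookup_add distrib_left single_add sum.distrib)
qed

lemma partial_deriv_single:
  "partial_deriv i (Poly_Mapping.single m c)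
    = Poly_Mapping.single (m - Poly_Mapping.single i 1) (of_nat (Poly_Mapping.lookup m i) * c)"
  by (simp add: partial_deriv_def)

lemma partial_deriv_mult:
  "partial_deriv i (p * q) = partial_deriv i p * q + p * partial_deriv i q"
proof (induction p rule: poly4_induct)
  case (single m c)
  show ?case
  proof (induction q rule: poly4_induct)
    case (single n d)
    have shift: "m - Poly_Mapping.single i 1 + n = m + n - Poly_Mapping.single i 1"
      if "Poly_Mapping.lookup m i \<noteq> 0" for m n :: "4 \<Rightarrow>\<^sub>0 nat"
      using that by (intro poly_mapping_eqI) (auto simp: lookup_add lookup_minus lookup_single when_def)
    have s1: "Poly_Mapping.single (m - Poly_Mapping.single i 1 + n) (of_nat (Poly_Mapping.lookup m i) * x)
        = Poly_Mapping.single (m + n - Poly_Mapping.single i 1) (of_nat (Poly_Mapping.lookup m i) * x)"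
      for m n :: "4 \<Rightarrow>\<^sub>0 nat" and x :: 'a
      using shift[of m n] by (cases "Poly_Mapping.lookup m i = 0") simp_all
    have s2: "Poly_Mapping.single (m + (n - Poly_Mapping.single i 1)) (of_nat (Poly_Mapping.lookup n i) * x)
        = Poly_Mapping.single (m + n - Poly_Mapping.single i 1) (of_nat (Poly_Mapping.lookup n i) * x)" for x :: 'a
      using s1[of n m x] by (simp only: add.commute)
    show ?case
      unfolding mult_single partial_deriv_single lookup_add of_nat_add distrib_right single_add mult.assoc s1
      unfolding s2 mult.left_commute[of c] by (simp only: )
  next
    case (add p q)
    then show ?case
      by (simp add: partial_deriv_add distrib_left)
  qed
next
  case (add p q)
  then show ?case
    by (simp add: partial_deriv_add distrib_right)
qed

lemma partial_deriv_commute: "partial_deriv i (partial_deriv j p) = partial_deriv j (partial_deriv i p)"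
proof (induction p rule: poly4_induct)
  case (single m c)
  show ?case
    by (cases "i = j")
      (simp_all add: partial_deriv_single lookup_minus lookup_single diff_diff_add add.commute mult.left_commute)
qed (simp add: partial_deriv_add)

lemma partial_deriv_cst [simp]: "partial_deriv i (cst c) = 0"
  by (simp add: cst_def partial_deriv_single)

lemma partial_deriv_0 [simp]: "partial_deriv i 0 = 0"
  using partial_deriv_cst[of i 0] by simp

lemma partial_deriv_sum: "partial_deriv i (sum f A) = (\<Sum>x\<in>A. partial_deriv i (f x))"
  by (induction A rule: infinite_finite_induct) (simp_all add: partial_deriv_add)

lemma partial_deriv_var: "partial_deriv i (var j) = (if i = j then 1 else 0)"
  by (auto simp: var_def partial_deriv_single lookup_single)

lemma partial_deriv_forms:
  assumes "p \<in> forms (Suc t)"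
  shows "partial_deriv i p \<in> forms t"
  using assms
proof (induction t arbitrary: p)
  case 0
  then obtain g where g: "\<And>j. g j \<in> forms 0" "p = (\<Sum>j\<in>UNIV. var j * g j)"
    using forms_Suc_decompose by blast
  have "partial_deriv i (var j * g j) \<in> forms 0" for j
    using forms_0_cst[OF g(1)[of j]] by (auto simp: partial_deriv_mult partial_deriv_var)
  then show ?case
    by (auto simp: g(2) partial_deriv_sum intro: forms_sum)
next
  case (Suc t)
  then obtain g where g: "\<And>j. g j \<in> forms (Suc t)" "p = (\<Sum>j\<in>UNIV. var j * g j)"
    using forms_Suc_decompose by blast
  have "partial_deriv i (var j * g j) \<in> forms (Suc t)" for j
    using g(1)[of j] forms_mult[OF forms_var Suc.IH[OF g(1)[of j]], of j]
    by (auto simp: partial_deriv_mult partial_deriv_var intro: forms_add)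
  then show ?case
    by (auto simp: g(2) partial_deriv_sum intro: forms_sum)
qed

text \<open>Directions of derivations and coefficient vectors of linear forms live in dual spaces
  but share a type; this is the pairing between them.\<close>

definition vdot :: "'k::comm_ring_1 ^ 4 \<Rightarrow> 'k ^ 4 \<Rightarrow> 'k" where
  "vdot \<xi> \<alpha> = (\<Sum>i\<in>UNIV. \<xi> $ i * \<alpha> $ i)"

lemma vdot_add_left: "vdot (\<xi> + \<mu>) \<alpha> = vdot \<xi> \<alpha> + vdot \<mu> \<alpha>"
  and vdot_add_right: "vdot \<xi> (\<alpha> + \<beta>) = vdot \<xi> \<alpha> + vdot \<xi> \<beta>"
  and vdot_diff_left: "vdot (\<xi> - \<mu>) \<alpha> = vdot \<xi> \<alpha> - vdot \<mu> \<alpha>"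
  and vdot_diff_right: "vdot \<xi> (\<alpha> - \<beta>) = vdot \<xi> \<alpha> - vdot \<xi> \<beta>"
  and vdot_minus_left: "vdot (- \<xi>) \<alpha> = - vdot \<xi> \<alpha>"
  and vdot_scale_left: "vdot (c *s \<xi>) \<alpha> = c * vdot \<xi> \<alpha>"
  and vdot_scale_right: "vdot \<xi> (c *s \<alpha>) = c * vdot \<xi> \<alpha>"
  by (simp_all add: vdot_def algebra_simps sum.distrib sum_subtractf sum_distrib_left sum_negf)

lemmas vdot_simps = vdot_minus_left vdot_add_left vdot_add_right vdot_diff_left vdot_diff_right vdot_scale_left
  vdot_scale_right

definition Der :: "'k::comm_ring_1 ^ 4 \<Rightarrow> 'k poly4 \<Rightarrow> 'k poly4" where
  "Der \<xi> p = (\<Sum>i\<in>UNIV. cst (\<xi> $ i) * partial_deriv i p)"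

lemma Der_add: "Der \<xi> (p + q) = Der \<xi> p + Der \<xi> q"
  by (simp add: Der_def partial_deriv_add distrib_left sum.distrib)

lemma Der_cst [simp]: "Der \<xi> (cst c) = 0"
  by (simp add: Der_def)

lemma Der_0 [simp]: "Der \<xi> 0 = 0"
  by (simp add: Der_def)

lemma Der_mult: "Der \<xi> (p * q) = Der \<xi> p * q + p * Der \<xi> q"
  by (simp add: Der_def partial_deriv_mult distrib_left sum.distrib sum_distrib_left
      sum_distrib_right algebra_simps)

lemma Der_cst_mult: "Der \<xi> (cst c * p) = cst c * Der \<xi> p"
  by (simp add: Der_mult)

lemma Der_linear_form: "Der \<xi> (linear_form \<alpha>) = cst (vdot \<xi> \<alpha>)"
proof -
  have "partial_deriv i (linear_form \<alpha>) = (\<Sum>j\<in>UNIV. if j = i then cst (\<alpha> $ j) else 0)" for i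
    unfolding linear_form_alt partial_deriv_sum
    by (rule sum.cong) (auto simp: partial_deriv_mult partial_deriv_var)
  then show ?thesis
    by (simp add: Der_def vdot_def cst_sum cst_mult)
qed

lemma Der_power_Suc: "Der \<xi> (p ^ Suc n) = of_nat (Suc n) * p ^ n * Der \<xi> p"
  by (induction n) (simp_all add: Der_mult algebra_simps)

lemma Der_commute: "Der \<xi> (Der \<mu> p) = Der \<mu> (Der \<xi> p)"
proof -
  have "Der \<xi> (Der \<mu> p)
      = (\<Sum>i\<in>UNIV. \<Sum>j\<in>UNIV. cst (\<xi> $ i) * (cst (\<mu> $ j) * partial_deriv i (partial_deriv j p)))" for \<xi> \<mu>
    by (simp add: Der_def partial_deriv_sum partial_deriv_mult sum_distrib_left)
  note this[of \<xi> \<mu>]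
  also have "(\<Sum>i\<in>UNIV. \<Sum>j\<in>UNIV. cst (\<xi> $ i) * (cst (\<mu> $ j) * partial_deriv i (partial_deriv j p)))
      = (\<Sum>j\<in>UNIV. \<Sum>i\<in>UNIV. cst (\<mu> $ j) * (cst (\<xi> $ i) * partial_deriv j (partial_deriv i p)))"
    by (subst sum.swap) (simp add: partial_deriv_commute mult.left_commute)
  also have "\<dots> = Der \<mu> (Der \<xi> p)"
    by (simp add: Der_def partial_deriv_sum partial_deriv_mult sum_distrib_left)
  finally show ?thesis .
qed

lemma Der_forms: "p \<in> forms (Suc t) \<Longrightarrow> Der \<xi> p \<in> forms t"
  unfolding Der_def by (intro forms_sum forms_cst_mult partial_deriv_forms)

lemma Der_forms_0: "p \<in> forms 0 \<Longrightarrow> Der \<xi> p = 0"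
  using forms_0_cst by fastforce

lemma Der_scale_left: "Der (c *s \<xi>) p = cst c * Der \<xi> p"
  by (simp add: Der_def cst_mult sum_distrib_left mult.assoc)

lemma Der_funpow_forms:
  assumes "p \<in> forms t"
  shows "(Der \<xi> ^^ Suc t) p = 0"
  using assms
proof (induction t arbitrary: p)
  case (Suc t)
  then show ?case
    using Suc.IH[OF Der_forms[OF Suc.prems, of \<xi>]] by (simp only: funpow_Suc_right o_apply)
qed (simp add: Der_forms_0)

subsection \<open>Univariate polynomials\<close>

text \<open>A power of \<open>[:- x i, 1:]\<close> does not affect the order at another node, so the
  powers can be split off one by one.\<close>

lemma linear_powers_dvd:
  fixes p :: "'k::field poly"
  assumes "finite A" and "inj_on x A" and "p \<noteq> 0" and "\<And>i. i \<in> A \<Longrightarrow> [:- x i, 1:] ^ n i dvd p"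
  shows "(\<Prod>i\<in>A. [:- x i, 1:] ^ n i) dvd p"
  using assms
proof (induction A arbitrary: p rule: finite_induct)
  case (insert i A)
  then obtain q where q: "p = [:- x i, 1:] ^ n i * q"
    by (metis dvdE insertI1)
  have "[:- x j, 1:] ^ n j dvd q" if "j \<in> A" for j
  proof -
    have "x j \<noteq> x i"
      using that insert.prems(1) insert.hyps(2) by (auto simp: inj_on_def)
    then have "order (x j) ([:- x i, 1:] ^ n i) = 0"
      by (simp add: order_0I)
    then have "order (x j) p = order (x j) q"
      using insert.prems(2) order_mult[of "[:- x i, 1:] ^ n i" q] by (simp add: q)
    moreover have "n j \<le> order (x j) p"
      using insert.prems(3)[of j] insert.prems(2) that by (simp add: order_divides)
    ultimately show ?thesis
      by (simp add: order_divides)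
  qed
  moreover have "inj_on x A" "q \<noteq> 0"
    using insert.prems by (auto simp: q)
  ultimately have "(\<Prod>i\<in>A. [:- x i, 1:] ^ n i) dvd q"
    using insert.IH by blast
  then show ?case
    using insert.hyps by (simp add: q mult_dvd_mono)
qed simp

lemma linear_powers_dvd_eq_0:
  fixes p :: "'k::field poly"
  assumes "finite A" and "inj_on x A" and "\<And>i. i \<in> A \<Longrightarrow> [:- x i, 1:] ^ n i dvd p"
    and "degree p < (\<Sum>i\<in>A. n i)"
  shows "p = 0"
proof (rule ccontr)
  assume "p \<noteq> 0"
  then have "degree (\<Prod>i\<in>A. [:- x i, 1:] ^ n i) \<le> degree p"
    using assms linear_powers_dvd by (intro dvd_imp_degree_le) blast+
  moreover have "degree (\<Prod>i\<in>A. [:- x i, 1:] ^ n i) = (\<Sum>i\<in>A. n i)"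
    by (subst degree_prod_eq_sum_degree) (simp_all add: degree_linear_power)
  ultimately show False
    using assms(4) by simp
qed

text \<open>Characteristic zero matters: differentiation lowers the order of a root by exactly
  one.\<close>

lemma linear_power_dvdI:
  fixes p :: "'k::field_char_0 poly"
  assumes "\<And>u. u < n \<Longrightarrow> poly ((pderiv ^^ u) p) c = 0"
  shows "[:- c, 1:] ^ n dvd p"
  using assms
proof (induction n arbitrary: p)
  case (Suc n)
  show ?case
  proof (cases "pderiv p = 0 \<or> p = 0")
    case True
    then obtain b where "p = [:b:]"
      by (metis pderiv_eq_0_iff degree_eq_zeroE degree_0)
    with Suc.prems[of 0] show ?thesis
      by simp
  next
    case False
    have "[:- c, 1:] ^ n dvd pderiv p"
      using Suc.prems[of "Suc u" for u] by (intro Suc.IH) (simp add: funpow_Suc_right del: funpow.simps)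
    moreover have "order c p = Suc (order c (pderiv p))"
      using False Suc.prems[of 0] by (intro order_pderiv) (simp_all add: order_root)
    ultimately show ?thesis
      using False by (simp add: order_divides del: power_Suc)
  qed
qed simp

lemma power_dvd_funpow_pderiv:
  fixes p q :: "'r::idom poly"
  assumes "q ^ n dvd p"
  shows "q ^ (n - u) dvd (pderiv ^^ u) p"
proof (induction u)
  case (Suc u)
  have step: "q ^ (N - 1) dvd pderiv f" if "q ^ N dvd f" for N f
  proof (cases N)
    case (Suc M)
    with that obtain g where g: "f = q ^ Suc M * g"
      by (metis dvdE)
    have "pderiv f = q ^ M * (smult (of_nat (Suc M)) (pderiv q * g) + q * pderiv g)"
      unfolding g pderiv_mult pderiv_power_Suc by (simp add: algebra_simps)
    with Suc show ?thesis
      by simp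
  qed simp
  from step[OF Suc] show ?case
    by simp
qed (use assms in simp)

text \<open>The sum is the coefficient of degree \<open>card A - 1\<close> in the polynomial that
  interpolates \<open>q\<close> at the nodes. That polynomial is \<open>q\<close> itself, whose
  degree is smaller.\<close>

lemma lagrange_sum_eq_0:
  fixes q :: "'k::field poly"
  assumes "finite A" and "inj_on x A" and "degree q + 2 \<le> card A"
  shows "(\<Sum>i\<in>A. poly q (x i) / (\<Prod>j\<in>A - {i}. x i - x j)) = 0"
proof -
  define P where "P = (\<Sum>i\<in>A. smult (poly q (x i) / (\<Prod>j\<in>A - {i}. x i - x j)) (\<Prod>j\<in>A - {i}. [:- x j, 1:]))"
  have deg: "degree (\<Prod>j\<in>A - {i}. [:- x j, 1:]) = card A - 1" if "i \<in> A" for i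
    using that assms(1) by (subst degree_prod_eq_sum_degree) (simp_all add: card_Diff_singleton)
  have lc: "coeff (\<Prod>j\<in>A - {i}. [:- x j, 1:]) (card A - 1) = 1" if "i \<in> A" for i
    using deg[OF that] lead_coeff_prod[of "\<lambda>j. [:- x j, 1:]" "A - {i}"] by simp
  have "degree P \<le> card A - 1"
    unfolding P_def using deg by (intro degree_sum_le assms(1)) (metis degree_smult_le)
  moreover have "poly P (x i) = poly q (x i)" if i: "i \<in> A" for i
  proof -
    have nz: "(\<Prod>j\<in>A - {i}. x i - x j) \<noteq> 0"
      using i assms(1,2) by (auto simp: inj_on_def)
    have "poly P (x i) = (\<Sum>k\<in>A. poly q (x k) / (\<Prod>j\<in>A - {k}. x k - x j) * (\<Prod>j\<in>A - {k}. x i - x j))"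
      by (simp add: P_def poly_sum poly_prod)
    also have "\<dots> = (\<Sum>k\<in>A. if k = i then poly q (x i) else 0)"
    proof (rule sum.cong)
      fix k assume "k \<in> A"
      have "(\<Prod>j\<in>A - {k}. x i - x j) = 0" if "k \<noteq> i"
        using that i assms(1) by (intro prod_zero) auto
      with nz show "poly q (x k) / (\<Prod>j\<in>A - {k}. x k - x j) * (\<Prod>j\<in>A - {k}. x i - x j)
          = (if k = i then poly q (x i) else 0)"
        by auto
    qed simp
    finally show ?thesis
      using i assms(1) by simp
  qed
  then have "[:- x i, 1:] ^ 1 dvd P - q" if "i \<in> A" for i
    using that by (simp add: poly_eq_0_iff_dvd[symmetric])
  moreover have "degree (P - q) < (\<Sum>i\<in>A. 1)"
    using \<open>degree P \<le> card A - 1\<close> assms(3) degree_diff_le[of P "card A - 1" q] by force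
  ultimately have "P - q = 0"
    using assms(1,2) by (intro linear_powers_dvd_eq_0[where n = "\<lambda>_. 1"]) auto
  then have "coeff P (card A - 1) = 0"
    using assms(3) by (simp add: coeff_eq_0)
  then show ?thesis
    using lc by (simp add: P_def coeff_sum)
qed

subsection \<open>Linear functionals on the polynomial ring\<close>

definition functional :: "('k::field poly4 \<Rightarrow> 'k) \<Rightarrow> bool" where
  "functional \<Phi> \<longleftrightarrow> (\<forall>p q. \<Phi> (p + q) = \<Phi> p + \<Phi> q) \<and> (\<forall>c p. \<Phi> (cst c * p) = c * \<Phi> p)"

lemma functional_add: "functional \<Phi> \<Longrightarrow> \<Phi> (p + q) = \<Phi> p + \<Phi> q"
  and functional_cst_mult: "functional \<Phi> \<Longrightarrow> \<Phi> (cst c * p) = c * \<Phi> p"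
  by (simp_all add: functional_def)

lemma functional_0: "functional \<Phi> \<Longrightarrow> \<Phi> 0 = 0"
  using functional_cst_mult[of \<Phi> 0 0] by simp

lemma functional_sum: "functional \<Phi> \<Longrightarrow> \<Phi> (sum f A) = (\<Sum>x\<in>A. \<Phi> (f x))"
  by (induction A rule: infinite_finite_induct) (simp_all add: functional_0 functional_add)

lemma functional_of_nat_mult: "functional \<Phi> \<Longrightarrow> \<Phi> (of_nat n * p) = of_nat n * \<Phi> p"
  by (metis cst_of_nat functional_cst_mult)

lemma functional_diff: "functional \<Phi> \<Longrightarrow> \<Phi> (p - q) = \<Phi> p - \<Phi> q"
  using functional_add[of \<Phi> "p - q" q] by simp

text \<open>A basis of \<open>W\<close> stays independent when \<open>f\<close> is added, so a
  linear map may be prescribed as 0 on the basis and 1 at \<open>f\<close>. Through such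
  functionals, membership in an ideal is proved by contradiction.\<close>

lemma separating_functional:
  fixes W :: "'k::field poly4 set"
  assumes "0 \<in> W" and "\<And>p q. p \<in> W \<Longrightarrow> q \<in> W \<Longrightarrow> p + q \<in> W"
    and "\<And>c p. p \<in> W \<Longrightarrow> cst c * p \<in> W" and "f \<notin> W"
  obtains \<Phi> where "functional \<Phi>" and "\<And>p. p \<in> W \<Longrightarrow> \<Phi> p = 0" and "\<Phi> f \<noteq> 0"
proof -
  interpret V: vector_space "\<lambda>(c::'k) (p::'k poly4). cst c * p"
    by standard (simp_all only: distrib_left distrib_right cst_add cst_mult mult.assoc cst_1 mult_1)
  interpret K: vector_space "(*) :: 'k \<Rightarrow> 'k \<Rightarrow> 'k"
    by standard (simp_all add: algebra_simps)
  interpret vector_space_pair "\<lambda>(c::'k) (p::'k poly4). cst c * p" "(*) :: 'k \<Rightarrow> 'k \<Rightarrow> 'k" ..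
  obtain B where B: "B \<subseteq> W" "V.independent B" "W \<subseteq> V.span B"
    using V.maximal_independent_subset by blast
  have "V.span B \<subseteq> W"
    using B(1) assms by (intro V.span_minimal) (auto simp: V.subspace_def)
  then have "f \<notin> V.span B"
    using assms(4) by blast
  then have "V.independent (insert f B)"
    using B(2) by (rule V.independent_insertI)
  from linear_independent_extend[OF this, of "\<lambda>p. if p = f then 1 else 0"]
  obtain \<Phi> where lin: "Vector_Spaces.linear (\<lambda>c p. cst c * p) (*) \<Phi>"
    and val: "\<And>p. p \<in> insert f B \<Longrightarrow> \<Phi> p = (if p = f then 1 else 0)"
    by blast
  interpret L: Vector_Spaces.linear "\<lambda>c p. cst c * p" "(*)" \<Phi>
    by (rule lin)
  have "\<Phi> p = 0" if "p \<in> V.span B" for p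
  proof (rule V.span_induct[OF that])
    show "V.subspace {p. \<Phi> p = 0}"
      by (rule L.subspace_kernel)
    show "\<Phi> p = 0" if "p \<in> B" for p
      using val[of p] that B(1) assms(4) by auto
  qed
  moreover have "functional \<Phi>"
    by (simp add: functional_def L.add L.scale)
  ultimately show ?thesis
    using val[of f] B(3) by (intro that[of \<Phi>]) auto
qed

lemma pderiv_map_poly:
  assumes "functional \<Phi>"
  shows "(pderiv ^^ u) (map_poly \<Phi> p) = map_poly \<Phi> ((pderiv ^^ u) p)"
proof -
  have "pderiv (map_poly \<Phi> q) = map_poly \<Phi> (pderiv q)" for q
    using assms by (intro poly_eqI)
      (simp add: coeff_pderiv coeff_map_poly functional_0 functional_of_nat_mult del: of_nat_Suc)
  then show ?thesis
    by (induction u) simp_all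
qed

text \<open>Only constants may be substituted, since \<open>\<Phi>\<close> is linear over the field
  but not multiplicative.\<close>

lemma poly_map_poly_functional:
  assumes "functional \<Phi>"
  shows "poly (map_poly \<Phi> p) c = \<Phi> (poly p (cst c))"
  using assms
  by (induction p) (simp_all add: map_poly_pCons functional_0 functional_add functional_cst_mult)

subsection \<open>Products of derivations\<close>

lemma poly_eval_linear_form_0 [simp]: "poly_eval (linear_form \<alpha>) 0 = 0"
  by (simp add: poly_eval_linear_form)

lemma Der_linear_form_power_mult:
  "Der \<xi> (linear_form \<alpha> ^ Suc n * g)
    = linear_form \<alpha> ^ n * (cst (of_nat (Suc n) * vdot \<xi> \<alpha>) * g + linear_form \<alpha> * Der \<xi> g)"
  unfolding Der_mult Der_power_Suc Der_linear_form cst_mult cst_of_nat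
  by (simp add: algebra_simps)

lemma Der_linear_form_power_mult_0:
  assumes "vdot \<xi> \<alpha> = 0"
  shows "Der \<xi> (linear_form \<alpha> ^ n * g) = linear_form \<alpha> ^ n * Der \<xi> g"
proof (cases n)
  case (Suc k)
  show ?thesis
    unfolding Suc Der_linear_form_power_mult assms by (simp add: mult_ac)
qed simp

lemma fold_Der_add: "fold Der ls (p + q) = fold Der ls p + fold Der ls q"
  by (induction ls arbitrary: p q) (simp_all add: Der_add)

lemma fold_Der_cst_mult: "fold Der ls (cst c * p) = cst c * fold Der ls p"
  by (induction ls arbitrary: p) (simp_all add: Der_cst_mult)

lemma fold_Der_0 [simp]: "fold Der ls 0 = 0"
  by (induction ls) simp_all

lemma fold_Der_sum: "fold Der ls (sum f A) = (\<Sum>x\<in>A. fold Der ls (f x))"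
  by (induction A rule: infinite_finite_induct) (simp_all add: fold_Der_add)

text \<open>A derivation with \<open>vdot \<xi> \<alpha> = 0\<close> leaves the power intact, and
  any other one uses up at most one factor. So a factor that vanishes at 0 survives.\<close>

lemma fold_Der_kills_power:
  assumes "length (filter (\<lambda>\<xi>. vdot \<xi> \<alpha> \<noteq> 0) ls) < d"
  shows "poly_eval (fold Der ls (linear_form \<alpha> ^ d * g)) 0 = 0"
  using assms
proof (induction ls arbitrary: d g)
  case Nil
  then show ?case
    by (simp add: poly_eval_mult poly_eval_power zero_power)
next
  case (Cons \<xi> ls)
  show ?case
  proof (cases "vdot \<xi> \<alpha> = 0")
    case True
    with Cons show ?thesis
      by (simp add: Der_linear_form_power_mult_0)
  next
    case False
    with Cons.prems obtain d' where "d = Suc d'" "length (filter (\<lambda>\<xi>. vdot \<xi> \<alpha> \<noteq> 0) ls) < d'"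
      by (cases d) auto
    with Cons.IH show ?thesis
      by (simp add: Der_linear_form_power_mult del: power_Suc)
  qed
qed

text \<open>Compared with \<open>fold_Der_kills_power\<close> for the exponent \<open>j\<close>, the
  factor in the ideal of the two linear forms pays for one more derivation, provided that the
  derivations not counted kill both forms. The summand with \<open>h\<close> makes the shape stable
  under the product rule.\<close>

lemma fold_Der_kills_power_mult:
  assumes "length (filter (\<lambda>\<xi>. \<not> (vdot \<xi> \<alpha> = 0 \<and> vdot \<xi> \<beta> = 0)) ls) \<le> j"
  shows "poly_eval (fold Der ls (linear_form \<alpha> ^ j * (linear_form \<beta> * g + linear_form \<alpha> * h))) 0 = 0"
  using assms
proof (induction ls arbitrary: j g h)
  case Nil
  then show ?case
    by (simp add: poly_eval_mult poly_eval_add)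
next
  case (Cons \<xi> ls)
  show ?case
  proof (cases "vdot \<xi> \<alpha> = 0 \<and> vdot \<xi> \<beta> = 0")
    case True
    then have "Der \<xi> (linear_form \<alpha> ^ j * (linear_form \<beta> * g + linear_form \<alpha> * h))
        = linear_form \<alpha> ^ j * (linear_form \<beta> * Der \<xi> g + linear_form \<alpha> * Der \<xi> h)"
      by (subst Der_linear_form_power_mult_0) (simp_all add: Der_add Der_mult Der_linear_form)
    with True Cons show ?thesis
      by simp
  next
    case False
    with Cons.prems obtain j' where j: "j = Suc j'"
      "length (filter (\<lambda>\<xi>. \<not> (vdot \<xi> \<alpha> = 0 \<and> vdot \<xi> \<beta> = 0)) ls) \<le> j'"
      by (cases j) auto
    let ?c = "cst (of_nat (Suc j') * vdot \<xi> \<alpha>)" and ?f = "linear_form \<beta> * g + linear_form \<alpha> * h"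
    have "?c * ?f + linear_form \<alpha> * Der \<xi> ?f
        = linear_form \<beta> * (?c * g) + linear_form \<alpha> * (?c * h + Der \<xi> ?f)"
      by (simp add: algebra_simps)
    with Cons.IH[OF j(2)] show ?thesis
      by (simp add: j(1) Der_linear_form_power_mult del: power_Suc)
  qed
qed

text \<open>Apolarity: up to a factorial, a product of derivations acts on a power of a linear form
  by evaluation at the dual point.\<close>

lemma fold_Der_power:
  "fold Der ls (linear_form \<alpha> ^ length ls) = cst (of_nat (fact (length ls)) * prod_list (map (\<lambda>\<xi>. vdot \<xi> \<alpha>) ls))"
proof (induction ls)
  case (Cons \<xi> ls)
  have "Der \<xi> (linear_form \<alpha> ^ Suc (length ls))
      = cst (of_nat (Suc (length ls)) * vdot \<xi> \<alpha>) * linear_form \<alpha> ^ length ls"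
    unfolding Der_power_Suc Der_linear_form cst_mult cst_of_nat by (simp only: mult_ac)
  then have "fold Der (\<xi> # ls) (linear_form \<alpha> ^ length (\<xi> # ls))
      = cst (of_nat (Suc (length ls)) * vdot \<xi> \<alpha>) * fold Der ls (linear_form \<alpha> ^ length ls)"
    by (simp add: fold_Der_cst_mult del: of_nat_Suc power_Suc)
  then show ?case
    unfolding Cons cst_mult[symmetric] by (simp add: algebra_simps)
qed simp

lemma length_filter_concat_ge:
  assumes "x \<in> set xs"
  shows "length (filter P (f x)) \<le> length (filter P (concat (map f xs)))"
  using assms by (induction xs) auto

subsection \<open>Grids in adapted coordinates\<close>

text \<open>The vectors \<open>f00\<close>, ..., \<open>f11\<close> form the dual basis. The
  condition \<open>r i \<noteq> s j\<close> is what generality of the linear form provides: its dual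
  point \<open>e10 - e01\<close> lies in no tangent plane of the quadric at a grid point.\<close>

locale grid_frame =
  fixes a :: nat and e00 e10 e01 e11 f00 f10 f01 f11 :: "'k::field_char_0 ^ 4" and r s :: "nat \<Rightarrow> 'k"
  assumes dual [simp]:
      "vdot f00 e00 = 1" "vdot f00 e10 = 0" "vdot f00 e01 = 0" "vdot f00 e11 = 0"
      "vdot f10 e00 = 0" "vdot f10 e10 = 1" "vdot f10 e01 = 0" "vdot f10 e11 = 0"
      "vdot f01 e00 = 0" "vdot f01 e10 = 0" "vdot f01 e01 = 1" "vdot f01 e11 = 0"
      "vdot f11 e00 = 0" "vdot f11 e10 = 0" "vdot f11 e01 = 0" "vdot f11 e11 = 1"
    and expand: "\<And>\<alpha>. \<alpha> = vdot f00 \<alpha> *s e00 + vdot f10 \<alpha> *s e10 + vdot f01 \<alpha> *s e01 + vdot f11 \<alpha> *s e11"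
    and a_ge_2: "2 \<le> a"
    and inj_r: "inj_on r {..<a}" and inj_s: "inj_on s {..<a}"
    and r_neq_s: "\<And>i j. i < a \<Longrightarrow> j < a \<Longrightarrow> r i \<noteq> s j"
begin

definition pt :: "'k \<Rightarrow> 'k \<Rightarrow> 'k ^ 4" where
  "pt x y = e00 + x *s e10 + y *s e01 + (x * y) *s e11"

\<comment> \<open>Derivations along \<open>fn u v\<close> see \<open>L x y\<close> through \<open>(x - u) (y - v)\<close> and kill \<open>ell\<close> when \<open>u = v\<close>.\<close>
definition fn :: "'k \<Rightarrow> 'k \<Rightarrow> 'k ^ 4" where
  "fn u v = f11 - v *s f10 - u *s f01 + (u * v) *s f00"

definition ell :: "'k poly4" where
  "ell = linear_form (e10 - e01)"

definition L :: "'k \<Rightarrow> 'k \<Rightarrow> 'k poly4" where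
  "L x y = linear_form (pt x y)"

abbreviation grid_sum :: "nat \<Rightarrow> (nat \<Rightarrow> nat \<Rightarrow> 'k poly4) \<Rightarrow> 'k poly4" where
  "grid_sum d g \<equiv> \<Sum>i<a. \<Sum>j<a. L (r i) (s j) ^ d * g i j"

text \<open>Explicit combinations, so that membership hands over coefficients;
  \<open>power_ideal_eq_grid_ideal\<close> makes the link with the ideal of the theorem.\<close>

definition grid_ideal :: "nat \<Rightarrow> 'k poly4 set" where
  "grid_ideal d = {f. \<exists>g. f = grid_sum d g}"

lemma vdot_fn_pt: "vdot (fn u v) (pt x y) = (x - u) * (y - v)"
  by (simp add: fn_def pt_def vdot_simps algebra_simps)

lemma vdot_fn_ell: "vdot (fn u v) (e10 - e01) = u - v"
  by (simp add: fn_def vdot_simps)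

lemma L_diff_swap: "L x y - L y x = cst (x - y) * ell"
proof -
  have "pt x y - pt y x = (x - y) *s (e10 - e01)"
    by (simp add: pt_def vec_eq_iff algebra_simps)
  then show ?thesis
    by (simp add: L_def ell_def linear_form_diff[symmetric] linear_form_scale[symmetric])
qed

lemma forms_L: "L x y \<in> forms 1"
  by (simp only: L_def forms_linear_form)

lemma forms_ell: "ell \<in> forms 1"
  by (simp only: ell_def forms_linear_form)

lemma forms_L_power: "L x y ^ n \<in> forms n"
  using forms_power[OF forms_L, of x y n] by simp

lemma grid_ideal_0: "0 \<in> grid_ideal d"
  unfolding grid_ideal_def by (intro CollectI exI[of _ "\<lambda>i j. 0"]) simp

lemma grid_ideal_add:
  assumes "p \<in> grid_ideal d" and "q \<in> grid_ideal d"
  shows "p + q \<in> grid_ideal d"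
proof -
  from assms obtain g h where
    "p = grid_sum d g" "q = grid_sum d h"
    by (auto simp: grid_ideal_def)
  then have "p + q = (\<Sum>i<a. \<Sum>j<a. L (r i) (s j) ^ d * (g i j + h i j))"
    by (simp add: distrib_left sum.distrib)
  then show ?thesis
    unfolding grid_ideal_def by (intro CollectI exI[of _ "\<lambda>i j. g i j + h i j"])
qed

lemma grid_ideal_mult:
  assumes "p \<in> grid_ideal d"
  shows "c * p \<in> grid_ideal d"
proof -
  from assms obtain g where "p = grid_sum d g"
    by (auto simp: grid_ideal_def)
  then have "c * p = (\<Sum>i<a. \<Sum>j<a. L (r i) (s j) ^ d * (c * g i j))"
    by (simp add: sum_distrib_left mult_ac)
  then show ?thesis
    unfolding grid_ideal_def by (intro CollectI exI[of _ "\<lambda>i j. c * g i j"])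
qed

lemma grid_ideal_sum: "(\<And>x. x \<in> A \<Longrightarrow> f x \<in> grid_ideal d) \<Longrightarrow> sum f A \<in> grid_ideal d"
  by (induction A rule: infinite_finite_induct) (auto intro: grid_ideal_add grid_ideal_0)

lemma L_power_in_grid_ideal:
  assumes "i < a" and "j < a" and "d \<le> e"
  shows "L (r i) (s j) ^ e * p \<in> grid_ideal d"
proof -
  have 1: "L (r i) (s j) ^ e * p = L (r i) (s j) ^ d * (L (r i) (s j) ^ (e - d) * p)"
    using assms(3) by (simp add: mult.assoc[symmetric] power_add[symmetric])
  let ?q = "L (r i) (s j) ^ (e - d) * p"
  have *: "L (r i') (s j') ^ d * (if i' = i \<and> j' = j then ?q else 0)
      = (if i' = i then if j' = j then L (r i) (s j) ^ d * ?q else 0 else 0)" for i' j'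
    by simp
  have "(\<Sum>i'<a. \<Sum>j'<a. L (r i') (s j') ^ d * (if i' = i \<and> j' = j then ?q else 0))
      = (\<Sum>i'<a. if i' = i then \<Sum>j'<a. if j' = j then L (r i) (s j) ^ d * ?q else 0 else 0)"
    unfolding * by (intro sum.cong refl) simp
  also have "\<dots> = (\<Sum>i'<a. if i' = i then L (r i) (s j) ^ d * ?q else 0)"
    using assms(2) by (simp only: sum.delta finite_lessThan lessThan_iff if_True)
  also have "\<dots> = L (r i) (s j) ^ d * ?q"
    using assms(1) by (simp only: sum.delta finite_lessThan lessThan_iff if_True)
  finally show ?thesis
    unfolding grid_ideal_def 1
    by (intro CollectI exI[of _ "\<lambda>i' j'. if i' = i \<and> j' = j then ?q else 0"]) (rule sym)
qed

lemma functional_kills_gridI: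
  assumes "functional \<Phi>" and "\<And>i j g. i < a \<Longrightarrow> j < a \<Longrightarrow> \<Phi> (L (r i) (s j) ^ d * g) = 0"
    and "f \<in> grid_ideal d"
  shows "\<Phi> f = 0"
  using assms(2,3) by (auto simp: grid_ideal_def functional_sum[OF assms(1)] intro!: sum.neutral)

lemma functional_fold_Der: "functional (\<lambda>p. poly_eval (fold Der ls p) 0)"
  by (simp add: functional_def fold_Der_add fold_Der_cst_mult poly_eval_add poly_eval_mult)

lemma fold_Der_L_power:
  assumes "length ls = t"
  shows "poly_eval (fold Der ls (L x y ^ t)) 0 = fact t * prod_list (map (\<lambda>\<xi>. vdot \<xi> (pt x y)) ls)"
  using fold_Der_power[of ls "pt x y"] assms by (simp add: L_def)

subsection \<open>Failure of surjectivity and injectivity\<close>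

lemma not_surjective:
  assumes t: "t + 1 = m + d" and d: "1 \<le> d" and am: "a * m \<le> t"
  shows "L (s 0) (s 0) ^ t - ell * g \<notin> grid_ideal d"
proof
  assume *: "L (s 0) (s 0) ^ t - ell * g \<in> grid_ideal d"
  \<comment> \<open>The \<open>m\<close> copies of \<open>fn (r i) (r i)\<close> kill
    \<open>L (r i) (s j)\<close>, so at most \<open>t - m = d - 1\<close> derivations act on it. The
    last block pads the product to degree \<open>t\<close>. None of them kills
    \<open>L (s 0) (s 0)\<close>.\<close>
  define ls where "ls = concat (map (\<lambda>i. replicate m (fn (r i) (r i))) [0..<a])
    @ replicate (t - a * m) (fn (r 0) (r 0))"
  have len: "length ls = t"
    using am by (simp add: ls_def length_concat comp_def sum_list_triv mult.commute)
  define \<Phi> where "\<Phi> = (\<lambda>p. poly_eval (fold Der ls p) 0)"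
  have \<Phi>: "functional \<Phi>"
    unfolding \<Phi>_def by (rule functional_fold_Der)
  have "\<Phi> (L (r i) (s j) ^ d * h) = 0" if "i < a" "j < a" for i j h
  proof -
    have "m \<le> length (filter (\<lambda>\<xi>. vdot \<xi> (pt (r i) (s j)) = 0) ls)"
      using length_filter_concat_ge[of i "[0..<a]" "\<lambda>\<xi>. vdot \<xi> (pt (r i) (s j)) = 0"
          "\<lambda>i. replicate m (fn (r i) (r i))"] that
      by (simp add: ls_def vdot_fn_pt filter_replicate)
    then have "length (filter (\<lambda>\<xi>. vdot \<xi> (pt (r i) (s j)) \<noteq> 0) ls) < d"
      using sum_length_filter_compl[of "\<lambda>\<xi>. vdot \<xi> (pt (r i) (s j)) = 0" ls] t d len by simp
    then show ?thesis
      unfolding \<Phi>_def L_def by (rule fold_Der_kills_power)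
  qed
  then have "\<Phi> (L (s 0) (s 0) ^ t - ell * g) = 0"
    using functional_kills_gridI[OF \<Phi> _ *] by blast
  moreover have "\<Phi> (ell * g) = 0"
  proof -
    have "filter (\<lambda>\<xi>. vdot \<xi> (e10 - e01) \<noteq> 0) ls = []"
      by (auto simp: ls_def filter_empty_conv vdot_fn_ell)
    then show ?thesis
      using fold_Der_kills_power[of "e10 - e01" ls 1 g] by (simp add: \<Phi>_def ell_def)
  qed
  ultimately have "\<Phi> (L (s 0) (s 0) ^ t) = 0"
    by (simp add: functional_diff[OF \<Phi>])
  then have "0 \<in> set (map (\<lambda>\<xi>. vdot \<xi> (pt (s 0) (s 0))) ls)"
    by (simp add: \<Phi>_def fold_Der_L_power[OF len] prod_list_zero_iff)
  moreover have "s 0 \<noteq> r i" if "i < a" for i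
    using r_neq_s[OF that, of 0] a_ge_2 by force
  ultimately show False
    using a_ge_2 by (auto simp: ls_def vdot_fn_pt split: if_splits)
qed

\<comment> \<open>\<open>L(x, y)\<close> as a polynomial in \<open>x\<close>.\<close>
definition Lx :: "'k \<Rightarrow> 'k poly4 poly" where
  "Lx y = [:linear_form (e00 + y *s e01), linear_form (e10 + y *s e11):]"

lemma poly_Lx: "poly (Lx y) (cst x) = L x y"
proof -
  have "pt x y = (e00 + y *s e01) + x *s (e10 + y *s e11)"
    by (simp add: pt_def vec_eq_iff algebra_simps)
  then show ?thesis
    by (simp add: Lx_def L_def linear_form_add linear_form_scale)
qed

lemma degree_Lx_power: "degree (Lx y ^ t) \<le> t"
  using degree_power_le[of "Lx y" t] by (simp add: Lx_def split: if_splits)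

text \<open>For \<open>u < m\<close> the \<open>u\<close>-th derivative keeps the factor
  \<open>Lx (s j) ^ (n - u)\<close>, and \<open>n - u \<ge> d\<close>. Hence its value at
  \<open>r i\<close> lies in the ideal.\<close>

lemma functional_vanishing_order:
  assumes \<Phi>: "functional \<Phi>" and kill: "\<And>f. f \<in> grid_ideal d \<Longrightarrow> \<Phi> f = 0"
    and ij: "i < a" "j < a" and dvd: "Lx (s j) ^ n dvd P" and m: "m + d \<le> n + 1"
  shows "[:- r i, 1:] ^ m dvd map_poly \<Phi> P"
proof (rule linear_power_dvdI)
  fix u assume u: "u < m"
  obtain Q where Q: "(pderiv ^^ u) P = Lx (s j) ^ (n - u) * Q"
    using power_dvd_funpow_pderiv[OF dvd, of u] by (metis dvdE)
  have "poly ((pderiv ^^ u) P) (cst (r i)) = L (r i) (s j) ^ (n - u) * poly Q (cst (r i))"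
    by (simp add: Q poly_Lx)
  also have "\<dots> \<in> grid_ideal d"
    using ij u m by (intro L_power_in_grid_ideal) auto
  finally show "poly ((pderiv ^^ u) (map_poly \<Phi> P)) (r i) = 0"
    by (simp add: pderiv_map_poly[OF \<Phi>] poly_map_poly_functional[OF \<Phi>] kill)
qed

lemma prod_list_concat_replicate:
  "prod_list (map f (concat (map (\<lambda>i. replicate n (g i)) [0..<k]))) = (\<Prod>i<k. f (g i) ^ n :: 'b::comm_monoid_mult)"
  by (induction k) (simp_all add: prod_list_replicate)

section \<open>Weights from Lagrange interpolation and a witness against injectivity\<close>

definition gp :: "'k \<Rightarrow> 'k" where
  "gp x = (\<Prod>i<a. x - r i)"

text \<open>The derivative at \<open>s j\<close> of the polynomial with the roots
  \<open>s k\<close>, as in the denominators of Lagrange interpolation.\<close>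

definition hp :: "nat \<Rightarrow> 'k" where
  "hp j = (\<Prod>k\<in>{..<a} - {j}. s j - s k)"

lemma gp_neq_0: "j < a \<Longrightarrow> gp (s j) \<noteq> 0"
  using r_neq_s by (fastforce simp: gp_def)

lemma hp_neq_0: "j < a \<Longrightarrow> hp j \<noteq> 0"
  using inj_s by (auto simp: hp_def inj_on_def)

text \<open>For a functional that kills the ideal, the polynomial \<open>p\<close> of the proof is
  divisible by all \<open>(x - r i)^m\<close>, and the upper bound on \<open>t\<close> leaves a
  quotient of degree at most \<open>a - 2\<close>. Its Lagrange sum over the nodes
  \<open>s j\<close> is therefore 0, and this sum is the value of the functional at
  \<open>?f\<close>.\<close>

lemma residue_sum_in_grid_ideal:
  assumes t: "t + 1 = m + d" and am: "a * m \<le> t" "t + 3 \<le> a * m + a" and k: "k < a"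
  shows "(\<Sum>j<a. cst ((s j - s k) / (gp (s j) ^ m * hp j)) * L (s j) (s k) ^ t) \<in> grid_ideal d"
proof (rule ccontr)
  let ?f = "\<Sum>j<a. cst ((s j - s k) / (gp (s j) ^ m * hp j)) * L (s j) (s k) ^ t"
  assume "?f \<notin> grid_ideal d"
  from separating_functional[OF grid_ideal_0 grid_ideal_add grid_ideal_mult this]
  obtain \<Phi> where \<Phi>: "functional \<Phi>" and kill: "\<And>p. p \<in> grid_ideal d \<Longrightarrow> \<Phi> p = 0"
    and nz: "\<Phi> ?f \<noteq> 0"
    by blast
  define p where "p = [:- s k, 1:] * map_poly \<Phi> (Lx (s k) ^ t)"
  have val: "poly p (s j) = (s j - s k) * \<Phi> (L (s j) (s k) ^ t)" for j
    by (simp add: p_def poly_map_poly_functional[OF \<Phi>] poly_Lx algebra_simps)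
  have "p \<noteq> 0"
  proof
    assume "p = 0"
    then have "(s j - s k) * \<Phi> (L (s j) (s k) ^ t) = 0" for j
      using val[of j] by simp
    then have "\<Phi> ?f = 0"
      by (auto simp: functional_sum[OF \<Phi>] functional_cst_mult[OF \<Phi>] intro!: sum.neutral)
    with nz show False
      by simp
  qed
  have "[:- r i, 1:] ^ m dvd p" if "i < a" for i
    unfolding p_def using that k t
    by (intro dvd_mult functional_vanishing_order[OF \<Phi> kill, where n = t and j = k]) auto
  then have "(\<Prod>i<a. [:- r i, 1:] ^ m) dvd p"
    using inj_r \<open>p \<noteq> 0\<close> by (intro linear_powers_dvd) auto
  then obtain q where q: "p = (\<Prod>i<a. [:- r i, 1:] ^ m) * q"
    by (metis dvdE)
  have "degree p \<le> 1 + degree (map_poly \<Phi> (Lx (s k) ^ t))"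
    unfolding p_def using degree_mult_le[of "[:- s k, 1:]"] by fastforce
  also have "\<dots> \<le> 1 + t"
    using map_poly_degree_leq[of \<Phi> "Lx (s k) ^ t"] degree_Lx_power[of "s k" t] functional_0[OF \<Phi>]
    by linarith
  finally have "degree p \<le> 1 + t" .
  moreover have "degree p = a * m + degree q"
    using \<open>p \<noteq> 0\<close> unfolding q
    by (subst degree_mult_eq) (auto simp: degree_prod_eq_sum_degree degree_linear_power)
  ultimately have "degree q + 2 \<le> card {..<a}"
    using am by simp
  from lagrange_sum_eq_0[OF _ inj_s this]
  have "(\<Sum>j<a. poly q (s j) / hp j) = 0"
    by (simp add: hp_def)
  moreover have pq: "poly p (s j) = gp (s j) ^ m * poly q (s j)" for j
    by (simp add: q poly_prod gp_def prod_power_distrib)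
  then have "\<Phi> ?f = (\<Sum>j<a. poly q (s j) / hp j)"
    unfolding functional_sum[OF \<Phi>] functional_cst_mult[OF \<Phi>]
  proof (intro sum.cong refl)
    fix j assume "j \<in> {..<a}"
    then have "gp (s j) ^ m \<noteq> 0"
      using gp_neq_0 by simp
    moreover have "(s j - s k) * \<Phi> (L (s j) (s k) ^ t) = gp (s j) ^ m * poly q (s j)"
      using val[of j] pq[of j] by simp
    then have "(s j - s k) / (gp (s j) ^ m * hp j) * \<Phi> (L (s j) (s k) ^ t)
        = (gp (s j) ^ m * poly q (s j)) / (gp (s j) ^ m * hp j)"
      by (metis times_divide_eq_left)
    ultimately show "(s j - s k) / (gp (s j) ^ m * hp j) * \<Phi> (L (s j) (s k) ^ t) = poly q (s j) / hp j"
      by (metis mult_divide_mult_cancel_left)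
  qed
  ultimately show False
    using nz by simp
qed

lemma not_injective:
  assumes t: "t + 1 = m + d" and m: "1 \<le> m" and am: "a * m \<le> t" "t + 3 \<le> a * m + a"
  shows "\<exists>f\<in>forms (t - 1). ell * f \<in> grid_ideal d \<and> f \<notin> grid_ideal d"
proof -
  \<comment> \<open>The weights of \<open>residue_sum_in_grid_ideal\<close>, divided by
    \<open>gp (s k) ^ m * hp k\<close>. The division keeps the sum over \<open>j\<close> in the
    ideal and makes \<open>w\<close> antisymmetric.\<close>
  define w where "w j k = (s j - s k) / (gp (s j) ^ m * hp j * (gp (s k) ^ m * hp k))" for j k
  have w_swap: "w k j = - w j k" for j k
    by (simp add: w_def divide_simps)
  define \<Omega> where "\<Omega> = (\<Sum>k<a. \<Sum>j<a. cst (w j k) * L (s j) (s k) ^ t)"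
  \<comment> \<open>The inner sum is the quotient of \<open>A ^ t - B ^ t\<close> by
    \<open>A - B\<close> for \<open>A = L (s j) (s k)\<close> and \<open>B = L (s k) (s j)\<close>,
    where \<open>A - B = cst (s j - s k) * ell\<close>. Antisymmetry of \<open>w\<close> then gives
    \<open>ell * f = \<Omega> + \<Omega>\<close>.\<close>
  define f where "f = (\<Sum>k<a. \<Sum>j<a. cst (w j k * (s j - s k)) *
    (\<Sum>i<t. L (s k) (s j) ^ (t - Suc i) * L (s j) (s k) ^ i))"
  have "1 \<le> t"
    using am m a_ge_2 by (metis le_trans mult_le_mono nat_mult_1 one_le_numeral)
  have "ell * (cst (w j k * (s j - s k)) * (\<Sum>i<t. L (s k) (s j) ^ (t - Suc i) * L (s j) (s k) ^ i))
      = cst (w j k) * (L (s j) (s k) ^ t - L (s k) (s j) ^ t)" for j k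
    unfolding power_diff_sumr2 L_diff_swap cst_mult by (simp only: mult_ac)
  then have "ell * f = \<Omega> - (\<Sum>k<a. \<Sum>j<a. cst (w j k) * L (s k) (s j) ^ t)"
    by (simp add: f_def \<Omega>_def sum_distrib_left right_diff_distrib sum_subtractf)
  also have "(\<Sum>k<a. \<Sum>j<a. cst (w j k) * L (s k) (s j) ^ t) = (\<Sum>j<a. \<Sum>k<a. cst (w j k) * L (s k) (s j) ^ t)"
    by (rule sum.swap)
  also have "\<dots> = - \<Omega>"
    unfolding \<Omega>_def sum_negf[symmetric]
  proof (intro sum.cong refl)
    fix j k
    show "cst (w j k) * L (s k) (s j) ^ t = - (cst (w k j) * L (s k) (s j) ^ t)"
      unfolding w_swap[of k j] cst_minus by simp
  qed
  finally have ell_f: "ell * f = \<Omega> + \<Omega>"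
    by simp
  have "\<Omega> \<in> grid_ideal d"
    unfolding \<Omega>_def
  proof (rule grid_ideal_sum)
    fix k assume "k \<in> {..<a}"
    then have "cst (1 / (gp (s k) ^ m * hp k)) *
        (\<Sum>j<a. cst ((s j - s k) / (gp (s j) ^ m * hp j)) * L (s j) (s k) ^ t) \<in> grid_ideal d"
      using residue_sum_in_grid_ideal[OF t am] by (intro grid_ideal_mult) auto
    moreover have "cst (1 / (gp (s k) ^ m * hp k)) * (cst ((s j - s k) / (gp (s j) ^ m * hp j)) * L (s j) (s k) ^ t)
        = cst (w j k) * L (s j) (s k) ^ t" for j
    proof -
      have "1 / (gp (s k) ^ m * hp k) * ((s j - s k) / (gp (s j) ^ m * hp j)) = w j k"
        by (simp add: w_def mult_ac)
      then show ?thesis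
        by (simp only: mult.assoc[symmetric] cst_mult[symmetric])
    qed
    ultimately show "(\<Sum>j<a. cst (w j k) * L (s j) (s k) ^ t) \<in> grid_ideal d"
      unfolding sum_distrib_left by simp
  qed
  then have "ell * f \<in> grid_ideal d"
    unfolding ell_f by (intro grid_ideal_add)
  moreover have "f \<in> forms (t - 1)"
    unfolding f_def
  proof (intro forms_sum forms_cst_mult)
    fix i j k assume "i \<in> {..<t}"
    then show "L (s k) (s j) ^ (t - Suc i) * L (s j) (s k) ^ i \<in> forms (t - 1)"
      using forms_mult[OF forms_L_power[of "s k" "s j" "t - Suc i"] forms_L_power[of "s j" "s k" i]] by simp
  qed
  moreover have "f \<notin> grid_ideal d"
  proof
    assume f: "f \<in> grid_ideal d"
    define x where "x = t + 1 - a * m"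
    \<comment> \<open>The functional must kill \<open>ell\<close> times the ideal but not
      \<open>\<Omega>\<close>. At a grid point other than \<open>(0, 0)\<close> the middle block
      supplies an \<open>m\<close>-th derivation that kills it; at \<open>(0, 0)\<close> the factor
      \<open>ell\<close> makes up for the missing one. The exponent \<open>x\<close> fills up the
      degree: \<open>a (m - 1) + (a - 1) + x = t\<close>.\<close>
    define ls where "ls = concat (map (\<lambda>i. replicate (m - 1) (fn (r i) (r i))) [0..<a])
      @ map (\<lambda>i. fn (r i) (s i)) [1..<a] @ replicate x (fn (s 0) (r 0))"
    have "a * m = a * (m - 1) + a"
      using m by (cases m) simp_all
    then have len: "length ls = t"
      using am a_ge_2 by (simp add: ls_def length_concat comp_def sum_list_triv x_def mult.commute)
    define \<Phi> where "\<Phi> = (\<lambda>p. poly_eval (fold Der ls p) 0)"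
    have \<Phi>: "functional \<Phi>"
      unfolding \<Phi>_def by (rule functional_fold_Der)
    have \<Phi>': "functional (\<lambda>p. \<Phi> (ell * p))"
      using \<Phi> by (simp add: functional_def distrib_left mult.left_commute[of ell])
    have "\<Phi> (ell * (L (r i) (s j) ^ d * h)) = 0" if ij: "i < a" "j < a" for i j h
    proof (cases "i = 0 \<and> j = 0")
      case True
      \<comment> \<open>The derivations \<open>fn (r i) (r i)\<close> kill \<open>ell\<close> as
        well as the point, as \<open>fold_Der_kills_power_mult\<close> requires; at most
        \<open>t - (m - 1) = d\<close> others remain.\<close>
      let ?P = "\<lambda>\<xi>. vdot \<xi> (pt (r i) (s j)) = 0 \<and> vdot \<xi> (e10 - e01) = 0"
      have "m - 1 \<le> length (filter ?P ls)"
        using length_filter_concat_ge[of i "[0..<a]" ?P "\<lambda>i. replicate (m - 1) (fn (r i) (r i))"] ij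
        by (simp add: ls_def vdot_fn_pt vdot_fn_ell filter_replicate)
      then have le: "length (filter (\<lambda>\<xi>. \<not> ?P \<xi>) ls) \<le> d"
        using sum_length_filter_compl[of ?P ls] t len by linarith
      have eq: "ell * (L (r i) (s j) ^ d * h) = linear_form (pt (r i) (s j)) ^ d *
          (linear_form (e10 - e01) * h + linear_form (pt (r i) (s j)) * 0)"
        unfolding ell_def L_def mult_zero_right add_0_right by (rule mult.left_commute)
      show ?thesis
        unfolding \<Phi>_def eq by (rule fold_Der_kills_power_mult[OF le])
    next
      case False
      \<comment> \<open>\<open>fn (r l) (s l)\<close> kills the grid points in row \<open>l\<close>
        and in column \<open>l\<close>; together, the indices \<open>l \<ge> 1\<close> miss only
        \<open>(0, 0)\<close>.\<close>
      then have "\<exists>l. 1 \<le> l \<and> l < a \<and> (l = i \<or> l = j)"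
        unfolding de_Morgan_conj
      proof (elim disjE)
        assume "i \<noteq> 0"
        then show ?thesis
          using ij by (intro exI[of _ i]) simp
      next
        assume "j \<noteq> 0"
        then show ?thesis
          using ij by (intro exI[of _ j]) simp
      qed
      then obtain l where l: "1 \<le> l" "l < a" "l = i \<or> l = j"
        by blast
      let ?P = "\<lambda>\<xi>. vdot \<xi> (pt (r i) (s j)) = 0"
      have "m - 1 \<le> length (filter ?P (concat (map (\<lambda>i. replicate (m - 1) (fn (r i) (r i))) [0..<a])))"
        using length_filter_concat_ge[of i "[0..<a]" ?P "\<lambda>i. replicate (m - 1) (fn (r i) (r i))"] ij
        by (simp add: vdot_fn_pt filter_replicate)
      moreover have "1 \<le> length (filter ?P (map (\<lambda>i. fn (r i) (s i)) [1..<a]))"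
      proof -
        have "?P (fn (r l) (s l))"
          unfolding vdot_fn_pt mult_eq_0_iff right_minus_eq using l(3) by blast
        moreover have "fn (r l) (s l) \<in> set (map (\<lambda>i. fn (r i) (s i)) [1..<a])"
          unfolding set_map using l(1,2) by (intro imageI) simp
        ultimately have "fn (r l) (s l) \<in> set (filter ?P (map (\<lambda>i. fn (r i) (s i)) [1..<a]))"
          by (simp only: set_filter mem_Collect_eq simp_thms)
        from length_pos_if_in_set[OF this] show ?thesis
          by linarith
      qed
      ultimately have "m \<le> length (filter ?P ls)"
        unfolding ls_def filter_append length_append using m by linarith
      then have "length (filter (\<lambda>\<xi>. \<not> ?P \<xi>) ls) < d"
        using sum_length_filter_compl[of ?P ls] t len \<open>1 \<le> t\<close> by linarith
      from fold_Der_kills_power[OF this, of "ell * h"] show ?thesis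
        unfolding \<Phi>_def L_def mult.left_commute[of ell] .
    qed
    then have "\<Phi> (ell * f) = 0"
      using functional_kills_gridI[OF \<Phi>' _ f] by blast
    then have "2 * \<Phi> \<Omega> = 0"
      unfolding ell_f functional_add[OF \<Phi>] by (simp only: mult_2)
    then have "\<Phi> \<Omega> = 0"
      by simp
    define E where "E x y = prod_list (map (\<lambda>\<xi>. vdot \<xi> (pt x y)) ls)" for x y
    have E: "E u v = (\<Prod>i<a. ((u - r i) * (v - r i)) ^ (m - 1)) * (\<Prod>i\<in>{1..<a}. (u - r i) * (v - s i))
        * ((u - s 0) * (v - r 0)) ^ x" for u v
    proof -
      have "prod_list (map ((\<lambda>\<xi>. vdot \<xi> (pt u v)) \<circ> (\<lambda>i. fn (r i) (s i))) [1..<a])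
          = (\<Prod>i\<in>{1..<a}. (u - r i) * (v - s i))"
        by (subst prod.distinct_set_conv_list[symmetric]) (simp_all add: vdot_fn_pt)
      then show ?thesis
        unfolding E_def ls_def map_append prod_list.append prod_list_concat_replicate
        by (simp add: vdot_fn_pt prod_list_replicate mult_ac)
    qed
    \<comment> \<open>The middle block contributes the factors \<open>v - s k\<close> with
      \<open>k \<ge> 1\<close>, so only the terms of \<open>\<Omega>\<close> with
      \<open>k = 0\<close> survive.\<close>
    have E0: "E (s j) (s k) = 0" if "1 \<le> k" "k < a" for j k
    proof -
      have "(\<Prod>i\<in>{1..<a}. (s j - r i) * (s k - s i)) = 0"
        using that by (intro prod_zero) auto
      then show ?thesis
        by (simp add: E)
    qed
    have "\<Phi> \<Omega> = fact t * (\<Sum>k<a. \<Sum>j<a. w j k * E (s j) (s k))"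
      unfolding \<Omega>_def functional_sum[OF \<Phi>] functional_cst_mult[OF \<Phi>]
      by (simp add: \<Phi>_def fold_Der_L_power[OF len] E_def sum_distrib_left mult_ac)
    also have "(\<Sum>k<a. \<Sum>j<a. w j k * E (s j) (s k)) = (\<Sum>k\<in>{0}. \<Sum>j<a. w j k * E (s j) (s k))"
      using a_ge_2 E0 by (intro sum.mono_neutral_right) (auto simp: Suc_le_eq intro!: sum.neutral)
    finally have sum0: "(\<Sum>j<a. w j 0 * E (s j) (s 0)) = 0"
      using \<open>\<Phi> \<Omega> = 0\<close> by simp
    \<comment> \<open>The part of the surviving terms that does not depend on \<open>j\<close>. The
      cancellation leaves the extra denominator \<open>s j - r 0\<close> because the middle block
      starts at index 1.\<close>
    define C where "C = (\<Prod>i<a. (s 0 - r i) ^ (m - 1)) * (\<Prod>i\<in>{1..<a}. s 0 - s i) * (s 0 - r 0) ^ x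
      / (gp (s 0) ^ m * hp 0)"
    have C: "C \<noteq> 0"
    proof -
      have "s 0 \<noteq> s i" if "i \<in> {1..<a}" for i
        using that a_ge_2 inj_on_eq_iff[OF inj_s, of 0 i] by simp
      then have "(\<Prod>i\<in>{1..<a}. s 0 - s i) \<noteq> 0"
        by simp
      moreover have "s 0 \<noteq> r i" if "i < a" for i
        using not_sym[OF r_neq_s[OF that, of 0]] a_ge_2 by simp
      then have "(\<Prod>i<a. (s 0 - r i) ^ (m - 1)) \<noteq> 0" "(s 0 - r 0) ^ x \<noteq> 0"
        using a_ge_2 by simp_all
      moreover have "gp (s 0) ^ m * hp 0 \<noteq> 0"
        using gp_neq_0[of 0] hp_neq_0[of 0] a_ge_2 by simp
      ultimately show ?thesis
        unfolding C_def by (simp only: divide_eq_0_iff mult_eq_0_iff simp_thms)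
    qed
    have "w j 0 * E (s j) (s 0) = C * ((s j - s 0) ^ (x + 1) / (hp j * (s j - r 0)))" if "j < a" for j
    proof -
      let ?g = "\<Prod>i\<in>{1..<a}. s j - r i"
      have ins: "{..<a} = insert 0 {1..<a}"
        using a_ge_2 by auto
      have gj: "gp (s j) = (s j - r 0) * ?g"
        unfolding gp_def ins by (subst prod.insert) auto
      have nz: "s j - r 0 \<noteq> 0" "?g \<noteq> 0"
        using gp_neq_0[OF that] by (simp_all add: gj)
      have "(\<Prod>i<a. (s j - r i) ^ (m - 1)) = gp (s j) ^ (m - 1)"
        by (simp add: gp_def prod_power_distrib)
      moreover have "gp (s j) ^ m = gp (s j) ^ (m - 1) * ((s j - r 0) * ?g)"
        using m by (cases m) (simp_all add: gj)
      ultimately show ?thesis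
        unfolding E w_def C_def prod.distrib power_mult_distrib
        using nz gp_neq_0[OF that] gp_neq_0[of 0] hp_neq_0[OF that] hp_neq_0[of 0] a_ge_2
        by (simp add: divide_simps)
    qed
    then have "(\<Sum>j<a. w j 0 * E (s j) (s 0)) = C * (\<Sum>j<a. (s j - s 0) ^ (x + 1) / (hp j * (s j - r 0)))"
      by (simp add: sum_distrib_left)
    with sum0 C have sum1: "(\<Sum>j<a. (s j - s 0) ^ (x + 1) / (hp j * (s j - r 0))) = 0"
      by simp
    \<comment> \<open>The nodes \<open>s j\<close> with \<open>r 0\<close> adjoined at index
      \<open>a\<close>. Their Lagrange sum for \<open>(X - s 0) ^ (x + 1)\<close> is 0 as
      \<open>x + 1 \<le> a - 1\<close>. By \<open>sum1\<close> the terms at the \<open>s j\<close>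
      add up to 0, so the nonzero term at \<open>r 0\<close> would have to vanish.\<close>
    define z where "z i = (if i < a then s i else r 0)" for i
    have "inj_on z (insert a {..<a})"
    proof (rule inj_onI)
      fix u v assume "u \<in> insert a {..<a}" "v \<in> insert a {..<a}" "z u = z v"
      then show "u = v"
        using inj_onD[OF inj_s, of u v] r_neq_s[of 0 u] r_neq_s[of 0 v] a_ge_2
        by (cases "u < a"; cases "v < a") (auto simp: z_def)
    qed
    moreover have "degree ([:- s 0, 1:] ^ (x + 1)) + 2 \<le> card (insert a {..<a})"
      using am by (simp add: degree_linear_power x_def del: power_Suc)
    ultimately have "(\<Sum>i\<in>insert a {..<a}. poly ([:- s 0, 1:] ^ (x + 1)) (z i)
        / (\<Prod>j\<in>insert a {..<a} - {i}. z i - z j)) = 0"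
      by (intro lagrange_sum_eq_0) auto
    moreover have "poly ([:- s 0, 1:] ^ (x + 1)) (z i) / (\<Prod>j\<in>insert a {..<a} - {i}. z i - z j)
        = (s i - s 0) ^ (x + 1) / (hp i * (s i - r 0))" if "i < a" for i
    proof -
      have "insert a {..<a} - {i} = insert a ({..<a} - {i})"
        using that by auto
      then have "(\<Prod>j\<in>insert a {..<a} - {i}. z i - z j) = hp i * (s i - r 0)"
        using that by (simp add: z_def hp_def)
      moreover have "poly ([:- s 0, 1:] ^ (x + 1)) (z i) = (s i - s 0) ^ (x + 1)"
        unfolding poly_power using that by (simp add: z_def)
      ultimately show ?thesis
        by (simp only: )
    qed
    ultimately have "poly ([:- s 0, 1:] ^ (x + 1)) (z a) / (\<Prod>j\<in>insert a {..<a} - {a}. z a - z j) = 0"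
      using sum1 by (simp del: power_Suc)
    moreover have "(\<Prod>j\<in>insert a {..<a} - {a}. z a - z j) \<noteq> 0" "poly ([:- s 0, 1:] ^ (x + 1)) (z a) \<noteq> 0"
      using r_neq_s[of 0] a_ge_2 by (auto simp: z_def)
    ultimately show False
      by (simp del: power_Suc)
  qed
  ultimately show ?thesis
    by blast
qed

end

subsection \<open>Surjectivity\<close>

text \<open>For \<open>q < v\<close> the falling factorial contains the factor 0, so truncation of
  the exponent \<open>q - v\<close> does no harm.\<close>

lemma poly_funpow_pderiv:
  fixes P :: "'r::idom poly"
  assumes "degree P \<le> n"
  shows "poly ((pderiv ^^ v) P) x = (\<Sum>q\<le>n. of_nat (\<Prod>i<v. q - i) * coeff P q * x ^ (q - v))"
proof -
  have mon: "(pderiv ^^ v) (monom c q) = monom (of_nat (\<Prod>i<v. q - i) * c) (q - v)" for c :: 'r and q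
    by (induction v) (simp_all add: pderiv_monom mult_ac)
  have "P = (\<Sum>q\<le>n. monom (coeff P q) q)"
    using assms by (simp add: poly_as_sum_of_monoms')
  then have "poly ((pderiv ^^ v) P) x = poly ((pderiv ^^ v) (\<Sum>q\<le>n. monom (coeff P q) q)) x"
    by simp
  also have "\<dots> = (\<Sum>q\<le>n. of_nat (\<Prod>i<v. q - i) * coeff P q * x ^ (q - v))"
    by (simp only: higher_pderiv_sum poly_sum mon poly_monom)
  finally show ?thesis .
qed

lemma coeff_linear_power:
  fixes b c :: "'r::comm_ring_1"
  shows "coeff ([:b, c:] ^ n) k = of_nat (n choose k) * b ^ (n - k) * c ^ k"
proof (cases "k \<le> n")
  case True
  then show ?thesis
    using coeff_linear_poly_power[OF True, of b c] by (simp add: mult_ac)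
next
  case False
  moreover have "degree ([:b, c:] ^ n) \<le> n"
    using degree_power_le[of "[:b, c:]" n] by (simp split: if_splits)
  ultimately show ?thesis
    by (simp add: coeff_eq_0 binomial_eq_0)
qed

context grid_frame
begin

abbreviation "z00 \<equiv> linear_form e00"
abbreviation "z10 \<equiv> linear_form e10"
abbreviation "z01 \<equiv> linear_form e01"
abbreviation "z11 \<equiv> linear_form e11"

lemma ell_alt: "ell = z10 - z01"
  by (simp add: ell_def linear_form_diff)

lemma linear_form_expand:
  "linear_form \<alpha> = cst (vdot f00 \<alpha>) * z00 + cst (vdot f10 \<alpha>) * z10 + cst (vdot f01 \<alpha>) * z01
     + cst (vdot f11 \<alpha>) * z11"
  by (subst expand[of \<alpha>]) (simp only: linear_form_add linear_form_scale)

\<comment> \<open>\<open>L(x, y)\<close> as a polynomial in \<open>x\<close> and \<open>y\<close>; the outer variable is \<open>y\<close>.\<close>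
definition LL :: "'k poly4 poly poly" where
  "LL = [:[:z00, z10:], [:z01, z11:]:]"

lemma poly_LL: "poly LL [:cst y:] = Lx y"
  by (simp add: LL_def Lx_def linear_form_add linear_form_scale)

lemma coeff_LL_mult:
  "coeff (coeff (LL * P) q) p = z00 * coeff (coeff P q) p
     + (case p of 0 \<Rightarrow> 0 | Suc p' \<Rightarrow> z10 * coeff (coeff P q) p')
     + (case q of 0 \<Rightarrow> 0 | Suc q' \<Rightarrow> z01 * coeff (coeff P q') p
          + (case p of 0 \<Rightarrow> 0 | Suc p' \<Rightarrow> z11 * coeff (coeff P q') p'))"
  by (simp add: LL_def coeff_pCons split: nat.split)

text \<open>Exchanging \<open>x\<close> and \<open>y\<close> in \<open>LL\<close> exchanges
  \<open>z10\<close> and \<open>z01\<close>, whose difference is \<open>ell\<close>; the recursion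
  \<open>coeff_LL_mult\<close> carries this through the powers.\<close>

lemma coeff_LL_power_swap: "ell dvd coeff (coeff (LL ^ t) q) p - coeff (coeff (LL ^ t) p) q"
proof (induction t arbitrary: p q)
  case 0
  show ?case
    by (auto simp: coeff_1 split: if_splits)
next
  case (Suc t)
  let ?c = "\<lambda>q p. coeff (coeff (LL ^ t) q) p"
  have swap: "ell dvd z10 * ?c q p - z01 * ?c p q" for p q
  proof -
    have "z10 * ?c q p - z01 * ?c p q = ell * ?c q p + z01 * (?c q p - ?c p q)"
      by (simp add: ell_alt algebra_simps)
    then show ?thesis
      using Suc[of q p] by simp
  qed
  show ?case
  proof (cases p; cases q)
    fix p' q' assume pq: "p = Suc p'" "q = Suc q'"
    have "coeff (coeff (LL ^ Suc t) q) p - coeff (coeff (LL ^ Suc t) p) q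
        = z00 * (?c q p - ?c p q) + (z10 * ?c q p' - z01 * ?c p' q) - (z10 * ?c p q' - z01 * ?c q' p)
          + z11 * (?c q' p' - ?c p' q')"
      unfolding power_Suc coeff_LL_mult pq by (simp add: algebra_simps)
    then show ?thesis
      using Suc[of q p] Suc[of q' p'] swap[of q p'] swap[of p q'] by simp
  next
    fix p' assume pq: "p = Suc p'" "q = 0"
    have "coeff (coeff (LL ^ Suc t) q) p - coeff (coeff (LL ^ Suc t) p) q
        = z00 * (?c q p - ?c p q) + (z10 * ?c q p' - z01 * ?c p' q)"
      unfolding power_Suc coeff_LL_mult pq by (simp add: algebra_simps)
    then show ?thesis
      using Suc[of q p] swap[of q p'] by simp
  next
    fix q' assume pq: "p = 0" "q = Suc q'"
    have "coeff (coeff (LL ^ Suc t) q) p - coeff (coeff (LL ^ Suc t) p) q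
        = z00 * (?c q p - ?c p q) - (z10 * ?c p q' - z01 * ?c q' p)"
      unfolding power_Suc coeff_LL_mult pq by (simp add: algebra_simps)
    then show ?thesis
      using Suc[of q p] swap[of p q'] by simp
  qed simp
qed

lemma degree_LL_power: "degree (LL ^ t) \<le> t"
  using degree_power_le[of LL t] by (simp add: LL_def split: if_splits)

lemma hom_part_grid_ideal:
  assumes "p \<in> grid_ideal d"
  shows "hom_part t p \<in> grid_ideal d"
proof -
  from assms obtain g where "p = grid_sum d g"
    by (auto simp: grid_ideal_def)
  then have "hom_part t p = (\<Sum>i<a. \<Sum>j<a. if d \<le> t then L (r i) (s j) ^ d * hom_part (t - d) (g i j) else 0)"
    by (simp add: hom_part_sum hom_part_mult[OF forms_L_power])
  also have "\<dots> \<in> grid_ideal d"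
    by (cases "d \<le> t") (auto intro!: grid_ideal_sum L_power_in_grid_ideal grid_ideal_0)
  finally show ?thesis .
qed

end

text \<open>A functional that would refute surjectivity; the aim is
  \<open>kill_forms\<close>.\<close>

locale grid_functional = grid_frame a e00 e10 e01 e11 f00 f10 f01 f11 r s
  for a and e00 e10 e01 e11 f00 f10 f01 f11 :: "'b::field_char_0 ^ 4" and r s +
  fixes t m d :: nat and \<Phi> :: "'b poly4 \<Rightarrow> 'b"
  assumes t: "t + 1 = m + d" and d: "1 \<le> d" and am: "t < a * m"
    and \<Phi>: "functional \<Phi>" and kill_ideal: "\<And>p. p \<in> grid_ideal d \<Longrightarrow> \<Phi> p = 0"
    and kill_ell: "\<And>p. \<Phi> (ell * p) = 0"
begin

text \<open>The coefficient of \<open>x^p y^q\<close> in \<open>\<Phi>(L(x, y)^t)\<close>; the index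
  of the outer variable \<open>y\<close> comes first.\<close>

definition \<gamma> :: "nat \<Rightarrow> nat \<Rightarrow> 'b" where
  "\<gamma> q p = \<Phi> (coeff (coeff (LL ^ t) q) p)"

\<comment> \<open>\<open>slice v y\<close> is the \<open>v\<close>-th derivative in \<open>y\<close> of \<open>\<Phi>(L(x, y)\<^sup>t)\<close>, as a polynomial in \<open>x\<close>.\<close>
definition slice :: "nat \<Rightarrow> 'b \<Rightarrow> 'b poly" where
  "slice v y = map_poly \<Phi> (poly ((pderiv ^^ v) (LL ^ t)) [:cst y:])"

lemma \<gamma>_swap: "\<gamma> q p = \<gamma> p q"
proof -
  obtain g where "coeff (coeff (LL ^ t) q) p - coeff (coeff (LL ^ t) p) q = ell * g"
    using coeff_LL_power_swap by (metis dvdE)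
  then have "\<Phi> (coeff (coeff (LL ^ t) q) p - coeff (coeff (LL ^ t) p) q) = 0"
    using kill_ell by simp
  then show ?thesis
    by (simp add: \<gamma>_def functional_diff[OF \<Phi>])
qed

lemma \<gamma>_eq_0: "t < p \<Longrightarrow> \<gamma> q p = 0"
  using degree_LL_power[of t] unfolding \<gamma>_swap[of q p]
  by (simp add: \<gamma>_def coeff_eq_0 functional_0[OF \<Phi>])

lemma coeff_slice: "coeff (slice v y) p = (\<Sum>q\<le>t. of_nat (\<Prod>i<v. q - i) * \<gamma> q p * y ^ (q - v))"
proof -
  have *: "[:cst y:] ^ n = [:cst (y ^ n):]" for n
    by (simp add: poly_const_pow cst_power)
  have **: "of_nat N * P * [:cst c:] = smult (cst (of_nat N * c)) P" for N c and P :: "'b poly4 poly"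
  proof -
    have N: "(of_nat N :: 'b poly4 poly) = [:cst (of_nat N):]"
      by (simp only: of_nat_poly cst_of_nat)
    show ?thesis
      unfolding N by (simp add: cst_mult mult_ac)
  qed
  show ?thesis
    unfolding slice_def coeff_map_poly[of \<Phi>, OF functional_0[OF \<Phi>]]
      poly_funpow_pderiv[OF degree_LL_power] * ** coeff_sum functional_sum[OF \<Phi>] coeff_smult
      functional_cst_mult[OF \<Phi>] \<gamma>_def
    by (simp add: mult_ac)
qed

lemma degree_slice: "degree (slice v y) \<le> t"
  by (intro degree_le) (simp add: coeff_slice \<gamma>_eq_0)

text \<open>For a symmetric polynomial, the mixed derivative of order \<open>(u, v)\<close> at
  \<open>(x, y)\<close> is the one of order \<open>(v, u)\<close> at \<open>(y, x)\<close>.\<close>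

lemma slice_swap: "poly ((pderiv ^^ u) (slice v y)) x = poly ((pderiv ^^ v) (slice u x)) y"
proof -
  have *: "poly ((pderiv ^^ u) (slice v y)) x = (\<Sum>p\<le>t. \<Sum>q\<le>t. of_nat (\<Prod>i<u. p - i) *
      (of_nat (\<Prod>i<v. q - i) * \<gamma> q p * y ^ (q - v)) * x ^ (p - u))" for u v x y
    unfolding poly_funpow_pderiv[OF degree_slice] coeff_slice by (simp only: sum_distrib_left sum_distrib_right)
  show ?thesis
    unfolding * by (subst sum.swap) (simp add: \<gamma>_swap mult_ac)
qed

lemma slice_vanishing_order:
  assumes "i < a" and "j < a"
  shows "[:- r i, 1:] ^ (m - v) dvd slice v (s j)"
proof (cases "v \<le> m")
  case True
  have "LL ^ (t - v) dvd (pderiv ^^ v) (LL ^ t)"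
    by (intro power_dvd_funpow_pderiv) simp
  then obtain Q where "(pderiv ^^ v) (LL ^ t) = LL ^ (t - v) * Q"
    by (metis dvdE)
  then have "Lx (s j) ^ (t - v) dvd poly ((pderiv ^^ v) (LL ^ t)) [:cst (s j):]"
    by (simp add: poly_LL)
  then show ?thesis
    unfolding slice_def using True t d assms
    by (intro functional_vanishing_order[OF \<Phi> kill_ideal, where n = "t - v" and j = j]) auto
qed simp

text \<open>By induction the lower slices at all \<open>s i\<close> vanish. By
  \<open>slice_swap\<close> this slice then vanishes to order \<open>v\<close> at every
  \<open>s i\<close>, besides the order \<open>m - v\<close> at every \<open>r i\<close>. These are
  at least \<open>a m > t\<close> zeros, more than the degree allows.\<close>

lemma slice_at_s: "j < a \<Longrightarrow> slice v (s j) = 0"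
proof (induction v arbitrary: j rule: less_induct)
  case (less v)
  \<comment> \<open>A disjoint union, so that \<open>r\<close> and \<open>s\<close> form one
    injective family of nodes.\<close>
  let ?A = "{..<a} <+> {..<a}"
  have "inj_on (case_sum r s) ?A"
  proof (rule inj_onI)
    fix u v assume uv: "u \<in> ?A" "v \<in> ?A" "case_sum r s u = case_sum r s v"
    show "u = v"
    proof (cases u; cases v)
      fix i j assume "u = Inl i" "v = Inl j"
      then show ?thesis
        using uv inj_on_eq_iff[OF inj_r, of i j] by auto
    next
      fix i j assume "u = Inr i" "v = Inr j"
      then show ?thesis
        using uv inj_on_eq_iff[OF inj_s, of i j] by auto
    next
      fix i j assume "u = Inl i" "v = Inr j"
      then show ?thesis
        using uv r_neq_s[of i j] by auto
    next
      fix i j assume "u = Inr i" "v = Inl j"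
      then show ?thesis
        using uv r_neq_s[of j i] by auto
    qed
  qed
  moreover have "[:- case_sum r s k, 1:] ^ case_sum (\<lambda>_. m - v) (\<lambda>_. v) k dvd slice v (s j)" if "k \<in> ?A" for k
  proof (cases k)
    case (Inl i)
    then show ?thesis
      using that less.prems slice_vanishing_order by auto
  next
    case (Inr i)
    have "[:- s i, 1:] ^ v dvd slice v (s j)"
    proof (rule linear_power_dvdI)
      fix u assume "u < v"
      then have "slice u (s i) = 0"
        using less.IH that Inr by auto
      then show "poly ((pderiv ^^ u) (slice v (s j))) (s i) = 0"
        by (subst slice_swap) (simp add: higher_pderiv_0)
    qed
    then show ?thesis
      by (simp add: Inr)
  qed
  moreover have "degree (slice v (s j)) < (\<Sum>k\<in>?A. case_sum (\<lambda>_. m - v) (\<lambda>_. v) k)"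
  proof -
    have "(\<Sum>k\<in>?A. case_sum (\<lambda>_. m - v) (\<lambda>_. v) k) = a * (m - v) + a * v"
      by (simp add: sum.Plus)
    also have "\<dots> = a * ((m - v) + v)"
      by (simp only: distrib_left)
    also have "\<dots> \<ge> a * m"
      by (intro mult_le_mono) linarith+
    finally show ?thesis
      using degree_slice[of v "s j"] am by linarith
  qed
  ultimately show ?case
    by (intro linear_powers_dvd_eq_0[where A = ?A and x = "case_sum r s" and n = "case_sum (\<lambda>_. m - v) (\<lambda>_. v)"]) auto
qed

text \<open>All slices at \<open>s 0\<close> vanish, so by \<open>slice_swap\<close> every
  derivative of \<open>slice v y\<close> is 0 at \<open>s 0\<close>.\<close>

lemma slice_eq_0: "slice v y = 0"
proof -
  have "[:- s 0, 1:] ^ Suc t dvd slice v y"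
  proof (rule linear_power_dvdI)
    fix u
    have "slice u (s 0) = 0"
      using slice_at_s a_ge_2 by simp
    then show "poly ((pderiv ^^ u) (slice v y)) (s 0) = 0"
      by (subst slice_swap) (simp add: higher_pderiv_0)
  qed
  then show ?thesis
    using degree_slice[of v y]
    by (intro linear_powers_dvd_eq_0[where A = "{0}" and x = s and n = "\<lambda>_. Suc t"]) simp_all
qed

lemma \<gamma>_0: "\<gamma> v p = 0"
proof (cases "v \<le> t")
  case True
  \<comment> \<open>Evaluating the \<open>v\<close>-th derivative at \<open>y = 0\<close> isolates
    the coefficient of \<open>y^v\<close>. For \<open>q < v\<close> the truncated exponent turns the
    power of 0 into 1, and it is the falling factorial that vanishes.\<close>
  have "of_nat (\<Prod>i<v. q - i) * \<gamma> q p * 0 ^ (q - v) = (if q = v then fact v * \<gamma> v p else 0)" for q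
  proof -
    consider "q < v" | "q = v" | "v < q"
      by linarith
    then show ?thesis
    proof cases
      case 1
      then have "(\<Prod>i<v. q - i) = 0"
        by (intro prod_zero) auto
      then show ?thesis
        using 1 by simp
    next
      case 2
      have "(\<Prod>i<v. v - i) = fact v"
        by (simp add: fact_prod_rev lessThan_atLeast0)
      then show ?thesis
        using 2 by simp
    qed simp
  qed
  then have "coeff (slice v 0) p = fact v * \<gamma> v p"
    using True by (simp add: coeff_slice)
  then show ?thesis
    by (simp add: slice_eq_0)
qed (simp add: \<gamma>_swap \<gamma>_eq_0)

lemma kill_z10: "\<Phi> (f * z10 ^ n) = \<Phi> (f * z01 ^ n)"
proof -
  obtain g where "z10 ^ n - z01 ^ n = ell * g"
    unfolding ell_alt power_diff_sumr2 by blast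
  then have "f * z10 ^ n - f * z01 ^ n = ell * (f * g)"
    by (metis mult.left_commute right_diff_distrib)
  then have "\<Phi> (f * z10 ^ n - f * z01 ^ n) = 0"
    by (simp add: kill_ell)
  then show ?thesis
    by (simp add: functional_diff[OF \<Phi>])
qed

text \<open>The coefficient of \<open>x^w y^(j + w)\<close> in \<open>L(x, y)^t\<close> is, up to a
  binomial factor, a sum of terms with exponent \<open>w - k\<close> of \<open>z11\<close>. The term
  for \<open>k = 0\<close> is a nonzero multiple of the monomial wanted; the others are killed by
  induction once \<open>z01\<close> replaces \<open>z10\<close>.\<close>

lemma kill_monomial': "i + j + w = t \<Longrightarrow> \<Phi> (z00 ^ i * z01 ^ j * z11 ^ w) = 0"
proof (induction w arbitrary: i j rule: less_induct)
  case (less w)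
  let ?v = "j + w"
  have "coeff (LL ^ t) ?v = of_nat (t choose ?v) * ([:z00, z10:] ^ i * [:z01, z11:] ^ ?v)"
    using less.prems by (simp add: LL_def coeff_linear_power mult_ac flip: less.prems)
  then have "coeff (coeff (LL ^ t) ?v) w = of_nat (t choose ?v) * coeff ([:z00, z10:] ^ i * [:z01, z11:] ^ ?v) w"
    by (simp add: of_nat_poly)
  moreover have "\<Phi> (coeff (coeff (LL ^ t) ?v) w) = 0"
    using \<gamma>_0 by (simp add: \<gamma>_def)
  moreover have "t choose ?v \<noteq> 0"
    using less.prems by simp
  ultimately have "\<Phi> (coeff ([:z00, z10:] ^ i * [:z01, z11:] ^ ?v) w) = 0"
    by (simp add: functional_of_nat_mult[OF \<Phi>])
  define T where "T k = (of_nat (i choose k) * z00 ^ (i - k) * z10 ^ k) *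
      (of_nat (?v choose (w - k)) * z01 ^ (?v - (w - k)) * z11 ^ (w - k))" for k
  have "coeff ([:z00, z10:] ^ i * [:z01, z11:] ^ ?v) w = (\<Sum>k\<le>w. T k)"
    unfolding coeff_mult coeff_linear_power T_def ..
  moreover have "\<Phi> (T k) = 0" if k: "0 < k" "k \<le> w" for k
  proof (cases "k \<le> i")
    case True
    have T: "T k = of_nat ((i choose k) * (?v choose (w - k))) *
        ((z00 ^ (i - k) * z01 ^ (?v - (w - k)) * z11 ^ (w - k)) * z10 ^ k)"
      by (simp add: T_def mult_ac)
    have z: "(z00 ^ (i - k) * z01 ^ (?v - (w - k)) * z11 ^ (w - k)) * z01 ^ k
        = z00 ^ (i - k) * z01 ^ (?v - (w - k) + k) * z11 ^ (w - k)"
      by (simp only: power_add mult_ac)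
    have "\<Phi> (z00 ^ (i - k) * z01 ^ (?v - (w - k) + k) * z11 ^ (w - k)) = 0"
      using True k less.prems by (intro less.IH) auto
    then show ?thesis
      unfolding T functional_of_nat_mult[OF \<Phi>] kill_z10 z by (simp only: mult_zero_right)
  next
    case False
    then show ?thesis
      by (simp add: T_def functional_0[OF \<Phi>] binomial_eq_0)
  qed
  then have "(\<Sum>k\<le>w. \<Phi> (T k)) = (\<Sum>k\<in>{0}. \<Phi> (T k))"
    by (intro sum.mono_neutral_right) auto
  moreover have "T 0 = of_nat (?v choose w) * (z00 ^ i * z01 ^ j * z11 ^ w)"
    by (simp add: T_def mult_ac)
  ultimately have "of_nat (?v choose w) * \<Phi> (z00 ^ i * z01 ^ j * z11 ^ w) = 0"
    using \<open>\<Phi> (coeff ([:z00, z10:] ^ i * [:z01, z11:] ^ ?v) w) = 0\<close>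
    by (simp add: functional_sum[OF \<Phi>] functional_of_nat_mult[OF \<Phi>])
  then show ?case
    by simp
qed

lemma kill_monomial:
  assumes "i + j + l + w = t"
  shows "\<Phi> (z00 ^ i * z01 ^ j * z10 ^ l * z11 ^ w) = 0"
proof -
  have "\<Phi> ((z00 ^ i * z01 ^ j * z11 ^ w) * z10 ^ l) = \<Phi> (z00 ^ i * z01 ^ (j + l) * z11 ^ w)"
    unfolding kill_z10 by (simp add: power_add mult_ac)
  then show ?thesis
    using kill_monomial'[of i "j + l" w] assms by (simp add: mult_ac)
qed

text \<open>The variables of \<open>f\<close> are expanded in the basis \<open>z00\<close>,
  \<open>z10\<close>, \<open>z01\<close>, \<open>z11\<close> one degree at a time; the monomial in
  front collects the factors already expanded.\<close>

lemma kill_forms_aux: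
  assumes "f \<in> forms n" and "i + j + l + w + n = t"
  shows "\<Phi> (z00 ^ i * z01 ^ j * z10 ^ l * z11 ^ w * f) = 0"
  using assms
proof (induction n arbitrary: f i j l w)
  case 0
  then obtain c where f: "f = cst c"
    using forms_0_cst by blast
  show ?case
    using 0 kill_monomial[of i j l w]
    unfolding f mult.commute[of _ "cst c"] functional_cst_mult[OF \<Phi>] by simp
next
  case (Suc n)
  let ?M = "z00 ^ i * z01 ^ j * z10 ^ l * z11 ^ w"
  obtain g where g: "\<And>k. g k \<in> forms n" "f = (\<Sum>k\<in>UNIV. var k * g k)"
    using forms_Suc_decompose[OF Suc.prems(1)] by blast
  have "\<Phi> (?M * (var k * g k)) = 0" for k
  proof -
    have "\<Phi> (?M * (z00 * g k)) = 0" "\<Phi> (?M * (z01 * g k)) = 0" "\<Phi> (?M * (z10 * g k)) = 0"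
      "\<Phi> (?M * (z11 * g k)) = 0"
      using Suc.IH[OF g(1), of "Suc i" j l w k] Suc.IH[OF g(1), of i "Suc j" l w k]
        Suc.IH[OF g(1), of i j "Suc l" w k] Suc.IH[OF g(1), of i j l "Suc w" k] Suc.prems(2)
      by (simp_all add: mult_ac)
    moreover have eq: "?M * ((cst b * z) * g k) = cst b * (?M * (z * g k))" for b z
      by (simp only: mult_ac)
    ultimately show ?thesis
      unfolding linear_form_axis[symmetric] linear_form_expand[of "axis k 1"] distrib_left distrib_right
        functional_add[OF \<Phi>] eq functional_cst_mult[OF \<Phi>] by (simp only: mult_zero_right add_0_right)
  qed
  then show ?case
    unfolding g(2) sum_distrib_left by (simp add: functional_sum[OF \<Phi>])
qed

lemma kill_forms: "f \<in> forms t \<Longrightarrow> \<Phi> f = 0"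
  using kill_forms_aux[of f t 0 0 0 0] by simp

end

context grid_frame
begin

lemma surjective:
  assumes t: "t + 1 = m + d" and d: "1 \<le> d" and am: "t < a * m" and f: "f \<in> forms t"
  shows "\<exists>g\<in>forms (t - 1). f - ell * g \<in> grid_ideal d"
proof -
  define W where "W = {p + ell * q | p q. p \<in> grid_ideal d}"
  have "f \<in> W"
  proof (rule ccontr)
    assume fW: "f \<notin> W"
    have W0: "0 \<in> W"
      unfolding W_def using grid_ideal_0 by (intro CollectI exI[of _ 0]) simp
    have Wadd: "p + q \<in> W" if "p \<in> W" "q \<in> W" for p q
    proof -
      from that obtain p1 p2 q1 q2 where "p = p1 + ell * p2" "q = q1 + ell * q2"
        "p1 \<in> grid_ideal d" "q1 \<in> grid_ideal d"
        by (auto simp: W_def)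
      then have "p + q = (p1 + q1) + ell * (p2 + q2)" "p1 + q1 \<in> grid_ideal d"
        by (auto simp: algebra_simps intro: grid_ideal_add)
      then show ?thesis
        unfolding W_def by blast
    qed
    have Wmult: "cst c * p \<in> W" if "p \<in> W" for c p
    proof -
      from that obtain p1 p2 where "p = p1 + ell * p2" "p1 \<in> grid_ideal d"
        by (auto simp: W_def)
      then have "cst c * p = cst c * p1 + ell * (cst c * p2)" "cst c * p1 \<in> grid_ideal d"
        using grid_ideal_mult by (simp_all add: distrib_left mult.left_commute)
      then show ?thesis
        unfolding W_def by blast
    qed
    from separating_functional[OF W0 Wadd Wmult fW]
    obtain \<Psi> where \<Psi>: "functional \<Psi>" "\<And>p. p \<in> W \<Longrightarrow> \<Psi> p = 0" "\<Psi> f \<noteq> 0"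
      by blast
    have W: "p + ell * q \<in> W" if "p \<in> grid_ideal d" for p q
      unfolding W_def using that by blast
    have "\<Psi> p = 0" if "p \<in> grid_ideal d" for p
      using \<Psi>(2)[OF W[OF that, of 0]] by simp
    moreover have "\<Psi> (ell * q) = 0" for q
      using \<Psi>(2)[OF W[OF grid_ideal_0, of q]] by simp
    ultimately interpret grid_functional a e00 e10 e01 e11 f00 f10 f01 f11 r s t m d \<Psi>
      using t d am \<Psi>(1) by unfold_locales auto
    show False
      using kill_forms[OF f] \<Psi>(3) by simp
  qed
  then obtain p q where pq: "f = p + ell * q" "p \<in> grid_ideal d"
    by (auto simp: W_def)
  have "1 \<le> t"
    using t d am by (cases m) auto
  \<comment> \<open>\<open>q\<close> need not be homogeneous, so both sides are cut down to degree
    \<open>t\<close>.\<close>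
  then have "f = hom_part t p + ell * hom_part (t - 1) q"
    using hom_part_same[OF f] by (simp add: pq(1) hom_part_add hom_part_mult[OF forms_ell])
  then have "f - ell * hom_part (t - 1) q = hom_part t p"
    by (metis add_diff_cancel_right')
  then show ?thesis
    using hom_part_grid_ideal[OF pq(2), of t] hom_part_forms[of "t - 1" q] by metis
qed

end

subsection \<open>Injectivity\<close>

lemma fold_Der_perm:
  assumes "mset ls = mset ls'"
  shows "fold Der ls = fold Der ls'"
  using assms by (rule fold_multiset_equiv[rotated]) (simp add: fun_eq_iff Der_commute)

lemma euler_identity:
  assumes "f \<in> forms n"
  shows "of_nat n * f = (\<Sum>i\<in>UNIV. var i * partial_deriv i f)"
  using assms
proof (induction n arbitrary: f)
  case 0
  then show ?case
    using forms_0_cst by fastforce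
next
  case (Suc n)
  obtain g where g: "\<And>k. g k \<in> forms n" "f = (\<Sum>k\<in>UNIV. var k * g k)"
    using forms_Suc_decompose[OF Suc.prems] by blast
  have "(\<Sum>i\<in>UNIV. var i * partial_deriv i (var k * g k)) = of_nat (Suc n) * (var k * g k)" for k
  proof -
    have "var i * partial_deriv i (var k * g k)
        = (if i = k then var k * g k else 0) + var k * (var i * partial_deriv i (g k))" for i
      by (simp add: partial_deriv_mult partial_deriv_var distrib_left mult.left_commute)
    then have "(\<Sum>i\<in>UNIV. var i * partial_deriv i (var k * g k))
        = var k * g k + var k * (\<Sum>i\<in>UNIV. var i * partial_deriv i (g k))"
      by (simp add: sum.distrib sum_distrib_left)
    also have "\<dots> = var k * g k + var k * (of_nat n * g k)"
      by (simp only: Suc.IH[OF g(1)])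
    also have "\<dots> = of_nat (Suc n) * (var k * g k)"
      by (simp add: distrib_right distrib_left mult.left_commute)
    finally show ?thesis .
  qed
  then have "(\<Sum>k\<in>UNIV. \<Sum>i\<in>UNIV. var i * partial_deriv i (var k * g k)) = of_nat (Suc n) * f"
    unfolding g(2) sum_distrib_left by (simp only: )
  then show ?case
    unfolding g(2) partial_deriv_sum sum_distrib_left by (rule trans[OF sym sum.swap])
qed

context grid_frame
begin

lemma ell_dvd_Der:
  assumes "vdot \<xi> (e10 - e01) = 0" and "ell dvd p"
  shows "ell dvd Der \<xi> p"
proof -
  obtain q where "p = ell * q"
    using assms(2) by (metis dvdE)
  then have "Der \<xi> p = ell * Der \<xi> q"
    using assms(1) by (simp add: Der_mult ell_def Der_linear_form)
  then show ?thesis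
    by simp
qed

lemma ell_dvd_fold_Der:
  assumes "\<And>\<xi>. \<xi> \<in> set ls \<Longrightarrow> vdot \<xi> (e10 - e01) = 0" and "ell dvd p"
  shows "ell dvd fold Der ls p"
  using assms by (induction ls arbitrary: p) (simp_all add: ell_dvd_Der)

lemma ell_dvd_cst_mult: "c \<noteq> 0 \<Longrightarrow> ell dvd cst c * p \<Longrightarrow> ell dvd p"
  by (metis cst_inverse_cancel dvd_mult)

lemma ell_dvd_descend:
  assumes \<xi>: "vdot \<xi> (e10 - e01) = 0" "vdot \<xi> \<alpha> \<noteq> 0" and h: "h \<in> forms n"
    and dvd: "ell dvd cst (of_nat (Suc e) * vdot \<xi> \<alpha>) * h + linear_form \<alpha> * Der \<xi> h"
  shows "ell dvd h"
proof -
  \<comment> \<open>Applying \<open>Der \<xi>\<close> repeatedly gives one relation for each \<open>i\<close>; the last one has no second term.\<close>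
  have A: "ell dvd cst (of_nat (Suc e + i) * vdot \<xi> \<alpha>) * (Der \<xi> ^^ i) h + linear_form \<alpha> * (Der \<xi> ^^ Suc i) h" for i
  proof (induction i)
    case 0
    show ?case
      using dvd by simp
  next
    case (Suc i)
    let ?h = "(Der \<xi> ^^ Suc i) h"
    have "ell dvd Der \<xi> (cst (of_nat (Suc e + i) * vdot \<xi> \<alpha>) * (Der \<xi> ^^ i) h + linear_form \<alpha> * ?h)"
      using \<xi>(1) Suc by (rule ell_dvd_Der)
    also have "Der \<xi> (cst (of_nat (Suc e + i) * vdot \<xi> \<alpha>) * (Der \<xi> ^^ i) h + linear_form \<alpha> * ?h)
        = cst (of_nat (Suc e + i) * vdot \<xi> \<alpha>) * ?h + (cst (vdot \<xi> \<alpha>) * ?h + linear_form \<alpha> * Der \<xi> ?h)"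
      by (simp add: Der_add Der_cst_mult Der_mult[of \<xi> "linear_form \<alpha>"] Der_linear_form)
    also have "\<dots> = cst (of_nat (Suc e + Suc i) * vdot \<xi> \<alpha>) * ?h + linear_form \<alpha> * Der \<xi> ?h"
    proof -
      have "of_nat (Suc e + Suc i) * vdot \<xi> \<alpha> = of_nat (Suc e + i) * vdot \<xi> \<alpha> + vdot \<xi> \<alpha>"
        by (simp add: distrib_right)
      then show ?thesis
        by (simp only: cst_add distrib_right add.assoc)
    qed
    finally show ?case
      by simp
  qed
  have "ell dvd (Der \<xi> ^^ (Suc n - i)) h" for i
  proof (induction i)
    case 0
    then show ?case
      using Der_funpow_forms[OF h, of \<xi>] by simp
  next
    case (Suc i)
    show ?case
    proof (cases "i \<le> n")
      case True
      then have "Suc n - i = Suc (n - i)"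
        by simp
      then have "ell dvd (Der \<xi> ^^ Suc (n - i)) h"
        using Suc by metis
      then have "ell dvd cst (of_nat (Suc e + (n - i)) * vdot \<xi> \<alpha>) * (Der \<xi> ^^ (n - i)) h"
        using A[of "n - i"] dvd_add_left_iff dvd_mult by blast
      moreover have "of_nat (Suc e + (n - i)) * vdot \<xi> \<alpha> \<noteq> 0"
        unfolding add_Suc mult_eq_0_iff using \<xi>(2) of_nat_neq_0 by blast
      ultimately have "ell dvd (Der \<xi> ^^ (n - i)) h"
        using ell_dvd_cst_mult by blast
      then show ?thesis
        by (simp only: diff_Suc_Suc)
    next
      case False
      with Suc show ?thesis
        by simp
    qed
  qed
  from this[of "Suc n"] show ?thesis
    by simp
qed

text \<open>Each derivation turns the cofactor \<open>h\<close> into a form of the same degree, and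
  by \<open>ell_dvd_descend\<close> divisibility by \<open>ell\<close> passes back from it to
  \<open>h\<close>.\<close>

lemma fold_Der_descend:
  assumes "\<And>\<xi>. \<xi> \<in> set ls \<Longrightarrow> vdot \<xi> (e10 - e01) = 0 \<and> vdot \<xi> \<alpha> \<noteq> 0"
    and "length ls \<le> e" and "h \<in> forms n"
  shows "\<exists>h'\<in>forms n. fold Der ls (linear_form \<alpha> ^ e * h) = linear_form \<alpha> ^ (e - length ls) * h'
    \<and> (ell dvd h' \<longrightarrow> ell dvd h)"
  using assms
proof (induction ls arbitrary: e h)
  case Nil
  then show ?case
    by auto
next
  case (Cons \<xi> ls)
  then obtain e' where e: "e = Suc e'" "length ls \<le> e'"
    by (cases e) auto
  let ?h = "cst (of_nat (Suc e') * vdot \<xi> \<alpha>) * h + linear_form \<alpha> * Der \<xi> h"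
  have "?h \<in> forms n"
  proof (cases n)
    case 0
    with Cons.prems(3) show ?thesis
      by (simp add: Der_forms_0 forms_cst_mult del: of_nat_Suc)
  next
    case (Suc n')
    with Cons.prems(3) have "linear_form \<alpha> * Der \<xi> h \<in> forms n"
      using forms_mult[OF forms_linear_form Der_forms, of h n' \<alpha> \<xi>] by simp
    with Cons.prems(3) show ?thesis
      by (intro forms_add forms_cst_mult)
  qed
  then obtain h' where h': "h' \<in> forms n" "ell dvd h' \<longrightarrow> ell dvd ?h"
    "fold Der ls (linear_form \<alpha> ^ e' * ?h) = linear_form \<alpha> ^ (e' - length ls) * h'"
    using Cons.IH[of e' ?h] Cons.prems(1) e(2) by auto
  moreover have "ell dvd h" if "ell dvd ?h"
    using that Cons.prems(1)[of \<xi>] Cons.prems(3) by (intro ell_dvd_descend[of \<xi> \<alpha> h n e']) auto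
  moreover have "fold Der (\<xi> # ls) (linear_form \<alpha> ^ e * h) = linear_form \<alpha> ^ (e - length (\<xi> # ls)) * h'"
    using h'(3) by (simp add: e(1) Der_linear_form_power_mult del: power_Suc of_nat_Suc)
  ultimately show ?case
    by blast
qed

text \<open>Part of the induction step of \<open>independent_mod_ell\<close>, stated once for both
  families: it is used with \<open>x = r\<close>, \<open>k i j = i\<close> and with
  \<open>x = s\<close>, \<open>k i j = j\<close>. When the degree \<open>n\<close> falls by one, the
  bound on \<open>d\<close> falls by \<open>a - 1\<close>, which is the loss in the
  exponent.\<close>

lemma ell_dvd_Der_of_sum:
  assumes IH: "\<And>d g. (a - 1) * (n + 2) \<le> d \<Longrightarrow> (\<And>i j. i < a \<Longrightarrow> j < a \<Longrightarrow> g i j \<in> forms n) \<Longrightarrow>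
      ell dvd (grid_sum d g) \<Longrightarrow>
      (\<And>i j. i < a \<Longrightarrow> j < a \<Longrightarrow> ell dvd g i j)"
    and k: "\<And>i j. i < a \<Longrightarrow> j < a \<Longrightarrow> k i j < a"
    and x: "\<And>i j l. i < a \<Longrightarrow> j < a \<Longrightarrow> l < a \<Longrightarrow> vdot (fn (x l) (x l)) (pt (r i) (s j)) = 0 \<longleftrightarrow> l = k i j"
    and d: "(a - 1) * (Suc n + 2) \<le> d"
    and g: "\<And>i j. i < a \<Longrightarrow> j < a \<Longrightarrow> g i j \<in> forms (Suc n)"
    and dvd: "ell dvd (grid_sum d g)"
    and ij: "i < a" "j < a"
  shows "ell dvd Der (fn (x (k i j)) (x (k i j))) (g i j)"
proof -
  \<comment> \<open>Of the \<open>a\<close> derivations \<open>K l\<close>, exactly one kills a given \<open>L (r i) (s j)\<close>; it reduces the degree of \<open>g i j\<close>,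
    and the others reduce the exponent \<open>d\<close>.\<close>
  define K where "K l = fn (x l) (x l)" for l
  have K_ell: "vdot (K l) (e10 - e01) = 0" for l
    by (simp add: K_def vdot_fn_ell)
  have ex: "\<exists>h'\<in>forms n. fold Der (map K [0..<a]) (L (r i) (s j) ^ d * g i j) = L (r i) (s j) ^ (d - (a - 1)) * h'
    \<and> (ell dvd h' \<longrightarrow> ell dvd Der (K (k i j)) (g i j))" if ij: "i < a" "j < a" for i j
  proof -
    define ls where "ls = map K (remove1 (k i j) [0..<a])"
    have "mset (map K [0..<a]) = mset (K (k i j) # ls)"
      using k[OF ij] by (simp add: ls_def image_mset_add_mset[symmetric] del: image_mset_add_mset)
    from fold_Der_perm[OF this]
    have "fold Der (map K [0..<a]) (L (r i) (s j) ^ d * g i j)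
        = fold Der ls (Der (K (k i j)) (L (r i) (s j) ^ d * g i j))"
      by (simp only: fold_simps)
    also have "Der (K (k i j)) (L (r i) (s j) ^ d * g i j) = L (r i) (s j) ^ d * Der (K (k i j)) (g i j)"
      unfolding L_def K_def using x[OF ij k[OF ij]] by (intro Der_linear_form_power_mult_0) simp
    finally have 1: "fold Der (map K [0..<a]) (L (r i) (s j) ^ d * g i j)
        = fold Der ls (L (r i) (s j) ^ d * Der (K (k i j)) (g i j))" .
    have len: "length ls = a - 1"
      using k[OF ij] by (simp add: ls_def length_remove1)
    have "a - 1 \<le> d"
      using d by (simp add: algebra_simps)
    moreover have "vdot \<xi> (e10 - e01) = 0 \<and> vdot \<xi> (pt (r i) (s j)) \<noteq> 0" if "\<xi> \<in> set ls" for \<xi>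
    proof -
      from that obtain l where "l \<in> set (remove1 (k i j) [0..<a])" and "\<xi> = K l"
        unfolding ls_def set_map by blast
      then have l: "l < a" "l \<noteq> k i j" "\<xi> = K l"
        by simp_all
      then show ?thesis
        using x[OF ij l(1)] K_ell[of l] by (simp add: K_def)
    qed
    ultimately show ?thesis
      unfolding 1 unfolding L_def using fold_Der_descend[of ls "pt (r i) (s j)" d "Der (K (k i j)) (g i j)" n] len
        Der_forms[OF g[OF ij]] by simp
  qed
  then obtain h where h: "\<And>i j. i < a \<Longrightarrow> j < a \<Longrightarrow> h i j \<in> forms n"
    "\<And>i j. i < a \<Longrightarrow> j < a \<Longrightarrow> fold Der (map K [0..<a]) (L (r i) (s j) ^ d * g i j)
       = L (r i) (s j) ^ (d - (a - 1)) * h i j"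
    "\<And>i j. i < a \<Longrightarrow> j < a \<Longrightarrow> ell dvd h i j \<Longrightarrow> ell dvd Der (K (k i j)) (g i j)"
    by metis
  have "ell dvd fold Der (map K [0..<a]) (grid_sum d g)"
    using dvd K_ell by (intro ell_dvd_fold_Der) auto
  also have "fold Der (map K [0..<a]) (grid_sum d g)
      = (\<Sum>i<a. \<Sum>j<a. L (r i) (s j) ^ (d - (a - 1)) * h i j)"
    unfolding fold_Der_sum using h(2) by (intro sum.cong refl) simp
  finally have "ell dvd h i j"
    using d h(1) ij by (intro IH[of "d - (a - 1)" h]) (simp_all add: algebra_simps)
  then show ?thesis
    using h(3)[OF ij] by (simp add: K_def)
qed

text \<open>
  Euler's identity in the basis \<open>pt u v\<close>, \<open>pt v v\<close>, \<open>pt u u\<close>, \<open>e10 - e01\<close>, whose dual basis consists of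
  \<open>\<delta>\<close> and multiples of \<open>fn u u\<close>, \<open>fn v v\<close>, \<open>fn u v\<close>.
\<close>

lemma euler_frame:
  fixes u v :: 'k
  assumes uv: "u \<noteq> v" and f: "f \<in> forms n"
  defines "\<delta> \<equiv> (- 1 / (u - v) ^ 2) *s (fn u v + fn v u)"
  assumes K: "ell dvd Der (fn u u) f" and M: "ell dvd Der (fn v v) f"
  shows "ell dvd of_nat n * f - L u v * Der \<delta> f"
proof -
  \<comment> \<open>Coordinates are compared after multiplication by \<open>w\<close>, which clears
    the denominators of the dual basis.\<close>
  define w where "w = (u - v) ^ 2"
  have w: "w \<noteq> 0"
    using uv by (simp add: w_def)
  define K' M' N' where "K' = (1 / w) *s fn u u" and "M' = (1 / w) *s fn v v" and "N' = (1 / (u - v)) *s fn u v"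
  have id: "\<alpha> = vdot \<delta> \<alpha> *s pt u v + vdot K' \<alpha> *s pt v v + vdot M' \<alpha> *s pt u u + vdot N' \<alpha> *s (e10 - e01)" for \<alpha>
  proof -
    define c0 c1 c2 c3 where "c0 = vdot f00 \<alpha>" and "c1 = vdot f10 \<alpha>" and "c2 = vdot f01 \<alpha>" and "c3 = vdot f11 \<alpha>"
    have fn: "vdot (fn x y) \<alpha> = c3 - y * c1 - x * c2 + x * y * c0" for x y
      by (simp add: fn_def vdot_simps c0_def c1_def c2_def c3_def)
    define D K0 M0 N0 where "D = vdot \<delta> \<alpha>" and "K0 = vdot K' \<alpha>" and "M0 = vdot M' \<alpha>" and "N0 = vdot N' \<alpha>"
    have eqs: "w * D = - (vdot (fn u v) \<alpha> + vdot (fn v u) \<alpha>)" "w * K0 = vdot (fn u u) \<alpha>"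
        "w * M0 = vdot (fn v v) \<alpha>" "w * N0 = (u - v) * vdot (fn u v) \<alpha>"
      using w uv by (simp_all add: D_def K0_def M0_def N0_def K'_def M'_def N'_def \<delta>_def vdot_simps
          w_def power2_eq_square)
    have "w * (D + K0 + M0) = w * c0" "w * (u * D + v * K0 + u * M0 + N0) = w * c1"
      "w * (v * D + v * K0 + u * M0 - N0) = w * c2" "w * (u * v * D + v * v * K0 + u * u * M0) = w * c3"
    proof -
      have "w * (D + K0 + M0) = w * D + w * K0 + w * M0"
        by (simp only: distrib_left)
      then show "w * (D + K0 + M0) = w * c0"
        unfolding eqs fn by (simp add: w_def power2_eq_square algebra_simps)
      have "w * (u * D + v * K0 + u * M0 + N0) = u * (w * D) + v * (w * K0) + u * (w * M0) + w * N0"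
        by (simp only: distrib_left mult_ac)
      then show "w * (u * D + v * K0 + u * M0 + N0) = w * c1"
        unfolding eqs fn by (simp add: w_def power2_eq_square algebra_simps)
      have "w * (v * D + v * K0 + u * M0 - N0) = v * (w * D) + v * (w * K0) + u * (w * M0) - w * N0"
        by (simp only: distrib_left right_diff_distrib mult_ac)
      then show "w * (v * D + v * K0 + u * M0 - N0) = w * c2"
        unfolding eqs fn by (simp add: w_def power2_eq_square algebra_simps)
      have "w * (u * v * D + v * v * K0 + u * u * M0) = u * v * (w * D) + v * v * (w * K0) + u * u * (w * M0)"
        by (simp only: distrib_left mult_ac)
      then show "w * (u * v * D + v * v * K0 + u * u * M0) = w * c3"
        unfolding eqs fn by (simp add: w_def power2_eq_square algebra_simps)
    qed
    then have c: "c0 = D + K0 + M0" "c1 = u * D + v * K0 + u * M0 + N0"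
      "c2 = v * D + v * K0 + u * M0 - N0" "c3 = u * v * D + v * v * K0 + u * u * M0"
      using w by (metis mult_left_cancel)+
    have "\<alpha> = c0 *s e00 + c1 *s e10 + c2 *s e01 + c3 *s e11"
      unfolding c0_def c1_def c2_def c3_def by (rule expand)
    also have "\<dots> = D *s pt u v + K0 *s pt v v + M0 *s pt u u + N0 *s (e10 - e01)"
      unfolding c by (simp add: pt_def vec_eq_iff algebra_simps)
    finally show ?thesis
      unfolding D_def K0_def M0_def N0_def .
  qed
  have comp: "vdot \<xi> (axis i 1) = \<xi> $ i" for \<xi> :: "'k ^ 4" and i
    by (simp add: vdot_def axis_def if_distrib cong: if_cong)
  have var: "var i = cst (\<delta> $ i) * L u v + cst (K' $ i) * L v v + cst (M' $ i) * L u u + cst (N' $ i) * ell" for i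
    unfolding linear_form_axis[symmetric] L_def ell_def
    by (subst id[of "axis i 1"]) (simp only: linear_form_add linear_form_scale comp)
  have "of_nat n * f = L u v * Der \<delta> f + L v v * Der K' f + L u u * Der M' f + ell * Der N' f"
    unfolding euler_identity[OF f] var distrib_right sum.distrib Der_def
    by (simp only: sum_distrib_left mult_ac)
  then have "of_nat n * f - L u v * Der \<delta> f = L v v * Der K' f + L u u * Der M' f + ell * Der N' f"
    by simp
  moreover have "ell dvd Der K' f" "ell dvd Der M' f"
    unfolding K'_def M'_def Der_scale_left using K M by simp_all
  ultimately show ?thesis
    by simp
qed

text \<open>Modulo \<open>ell\<close> the ring has the coordinates \<open>L u v\<close>,
  \<open>L v v\<close>, \<open>L u u\<close>, and up to scalars \<open>fn u u\<close> and
  \<open>fn v v\<close> give the partial derivatives in the last two. A form that both kill involves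
  only \<open>L u v\<close>.\<close>

lemma form_eq_power_mod_ell:
  assumes uv: "u \<noteq> v" and f: "f \<in> forms n"
    and "ell dvd Der (fn u u) f" and "ell dvd Der (fn v v) f"
  shows "\<exists>c. ell dvd f - cst c * L u v ^ n"
  using f assms(3,4)
proof (induction n arbitrary: f)
  case 0
  then obtain c where "f = cst c"
    using forms_0_cst by blast
  then show ?case
    by (intro exI[of _ c]) simp
next
  case (Suc n)
  define \<delta> where "\<delta> = (- 1 / (u - v) ^ 2) *s (fn u v + fn v u)"
  have \<delta>: "vdot \<delta> (e10 - e01) = 0"
    unfolding \<delta>_def vdot_scale_left vdot_add_left vdot_fn_ell by simp
  have "ell dvd Der (fn u u) (Der \<delta> f)" "ell dvd Der (fn v v) (Der \<delta> f)"
    using Suc.prems(2,3) \<delta> ell_dvd_Der Der_commute[of "fn u u" \<delta> f] Der_commute[of "fn v v" \<delta> f]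
    by simp_all
  then obtain c where c: "ell dvd Der \<delta> f - cst c * L u v ^ n"
    using Suc.IH[of "Der \<delta> f"] Der_forms[OF Suc.prems(1)] by blast
  have "ell dvd (of_nat (Suc n) * f - L u v * Der \<delta> f) + L u v * (Der \<delta> f - cst c * L u v ^ n)"
    using euler_frame[OF uv Suc.prems] c unfolding \<delta>_def by (intro dvd_add dvd_mult)
  also have "\<dots> = of_nat (Suc n) * f - cst c * L u v ^ Suc n"
    by (simp add: algebra_simps)
  also have "\<dots> = cst (of_nat (Suc n)) * (f - cst (c / of_nat (Suc n)) * L u v ^ Suc n)"
  proof -
    have "cst c = cst (of_nat (Suc n)) * cst (c / of_nat (Suc n))"
      unfolding cst_mult[symmetric] by (metis nonzero_eq_divide_eq mult.commute of_nat_neq_0)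
    then show ?thesis
      by (simp only: right_diff_distrib mult.assoc cst_of_nat)
  qed
  finally have "ell dvd f - cst (c / of_nat (Suc n)) * L u v ^ Suc n"
    by (rule ell_dvd_cst_mult[rotated]) (rule of_nat_neq_0)
  then show ?case
    by blast
qed

lemma ell_neq_0: "ell \<noteq> 0"
proof
  assume "ell = 0"
  then have "Der f10 ell = 0"
    by simp
  then have "cst (1::'k) = 0"
    by (simp add: ell_def Der_linear_form vdot_diff_right)
  then show False
    by simp
qed

text \<open>Modulo \<open>ell\<close> every \<open>g i j\<close> is a multiple of
  \<open>L (r i) (s j) ^ n\<close>, which leaves a relation between powers of exponent
  \<open>d + n \<ge> 2 (a - 1)\<close>. The derivations \<open>fn (r l) (r l)\<close> with
  \<open>l \<noteq> i0\<close> and \<open>fn (s l) (s l)\<close> with \<open>l \<noteq> j0\<close>,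
  \<open>2 (a - 1)\<close> in number, single out the coefficient at \<open>(i0, j0)\<close>.\<close>

lemma independent_step:
  assumes d: "(a - 1) * (n + 2) \<le> d" and g: "\<And>i j. i < a \<Longrightarrow> j < a \<Longrightarrow> g i j \<in> forms n"
    and dvd: "ell dvd (grid_sum d g)"
    and ij0: "i0 < a" "j0 < a"
    and K: "\<And>i j. i < a \<Longrightarrow> j < a \<Longrightarrow> ell dvd Der (fn (r i) (r i)) (g i j)"
    and M: "\<And>i j. i < a \<Longrightarrow> j < a \<Longrightarrow> ell dvd Der (fn (s j) (s j)) (g i j)"
  shows "ell dvd g i0 j0"
proof -
  have "\<exists>c. ell dvd g i j - cst c * L (r i) (s j) ^ n" if "i < a" "j < a" for i j
    using form_eq_power_mod_ell[OF r_neq_s[OF that] g[OF that] K[OF that] M[OF that]] .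
  then obtain c where c: "\<And>i j. i < a \<Longrightarrow> j < a \<Longrightarrow> ell dvd g i j - cst (c i j) * L (r i) (s j) ^ n"
    by metis
  define t where "t = d + n"
  have "2 * (a - 1) \<le> (a - 1) * (n + 2)"
    by (simp add: distrib_left)
  then have t: "2 * (a - 1) \<le> t"
    using d by (simp add: t_def)
  have "ell dvd (grid_sum d g)
      - (\<Sum>i<a. \<Sum>j<a. L (r i) (s j) ^ d * (g i j - cst (c i j) * L (r i) (s j) ^ n))"
    by (rule dvd_diff[OF dvd]) (intro dvd_sum dvd_mult c, simp_all)
  also have "\<dots> = (\<Sum>i<a. \<Sum>j<a. cst (c i j) * L (r i) (s j) ^ t)"
    unfolding sum_subtractf[symmetric] t_def power_add
    by (intro sum.cong refl) (simp add: right_diff_distrib mult.left_commute)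
  finally have "ell dvd (\<Sum>i<a. \<Sum>j<a. cst (c i j) * L (r i) (s j) ^ t)" .
  then obtain q where q: "(\<Sum>i<a. \<Sum>j<a. cst (c i j) * L (r i) (s j) ^ t) = ell * q"
    by (rule dvdE)
  \<comment> \<open>The padding must not kill \<open>L (r i0) (s j0)\<close> either;
    \<open>a \<ge> 2\<close> leaves an index other than \<open>i0\<close>.\<close>
  define l0 where "l0 = (if i0 = 0 then 1 else 0 :: nat)"
  have l0: "l0 < a" "l0 \<noteq> i0"
    using a_ge_2 by (auto simp: l0_def)
  define ls where "ls = map (\<lambda>l. fn (r l) (r l)) (remove1 i0 [0..<a])
    @ map (\<lambda>l. fn (s l) (s l)) (remove1 j0 [0..<a]) @ replicate (t - 2 * (a - 1)) (fn (r l0) (r l0))"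
  have "length (remove1 i0 [0..<a]) = a - 1" "length (remove1 j0 [0..<a]) = a - 1"
    using ij0 by (simp_all add: length_remove1)
  then have len: "length ls = t"
    unfolding ls_def length_append length_map length_replicate using t by linarith
  define \<Phi> where "\<Phi> = (\<lambda>p. poly_eval (fold Der ls p) 0)"
  have \<Phi>: "functional \<Phi>"
    unfolding \<Phi>_def by (rule functional_fold_Der)
  have "\<exists>x. \<xi> = fn x x" if "\<xi> \<in> set ls" for \<xi>
    using that unfolding ls_def set_append set_map set_replicate_conv_if by (auto split: if_splits)
  then have "vdot \<xi> (e10 - e01) = 0" if "\<xi> \<in> set ls" for \<xi>
    using that vdot_fn_ell by (metis diff_self)
  then have "filter (\<lambda>\<xi>. vdot \<xi> (e10 - e01) \<noteq> 0) ls = []"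
    by (simp add: filter_empty_conv)
  then have \<Phi>q: "\<Phi> (ell * q) = 0"
    using fold_Der_kills_power[of "e10 - e01" ls 1 q] by (simp add: \<Phi>_def ell_def)
  define E where "E i j = prod_list (map (\<lambda>\<xi>. vdot \<xi> (pt (r i) (s j))) ls)" for i j
  have \<Phi>E: "\<Phi> (\<Sum>i<a. \<Sum>j<a. cst (c i j) * L (r i) (s j) ^ t) = (\<Sum>i<a. \<Sum>j<a. c i j * (fact t * E i j))"
    unfolding functional_sum[OF \<Phi>] functional_cst_mult[OF \<Phi>]
    by (simp add: \<Phi>_def fold_Der_L_power[OF len] E_def)
  have E0: "E i j = 0" if "i < a" "j < a" "i \<noteq> i0 \<or> j \<noteq> j0" for i j
  proof -
    have "fn (r i) (r i) \<in> set ls \<or> fn (s j) (s j) \<in> set ls"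
      using that by (auto simp: ls_def)
    then have "\<exists>\<xi>\<in>set ls. vdot \<xi> (pt (r i) (s j)) = 0"
      by (metis vdot_fn_pt diff_self mult_zero_left mult_zero_right)
    then show ?thesis
      unfolding E_def prod_list_zero_iff by force
  qed
  have "(\<Sum>i<a. \<Sum>j<a. c i j * (fact t * E i j)) = (\<Sum>i\<in>{i0}. \<Sum>j<a. c i j * (fact t * E i j))"
    using ij0 E0 by (intro sum.mono_neutral_right) (auto intro!: sum.neutral)
  also have "\<dots> = (\<Sum>j<a. c i0 j * (fact t * E i0 j))"
    by simp
  also have "\<dots> = (\<Sum>j\<in>{j0}. c i0 j * (fact t * E i0 j))"
    using ij0 E0 by (intro sum.mono_neutral_right) auto
  finally have "(\<Sum>i<a. \<Sum>j<a. c i j * (fact t * E i j)) = c i0 j0 * (fact t * E i0 j0)"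
    by simp
  then have "c i0 j0 * (fact t * E i0 j0) = 0"
    using \<Phi>E \<Phi>q unfolding q by simp
  moreover have "E i0 j0 \<noteq> 0"
  proof -
    have 1: "r i0 \<noteq> r l" "s j0 \<noteq> r l" if "l < a" "l \<noteq> i0" for l
      using that ij0 inj_on_eq_iff[OF inj_r, of i0 l] r_neq_s[of l j0] by auto
    have 2: "r i0 \<noteq> s l" "s j0 \<noteq> s l" if "l < a" "l \<noteq> j0" for l
      using that ij0 inj_on_eq_iff[OF inj_s, of j0 l] r_neq_s[of i0 l] by auto
    have "vdot \<xi> (pt (r i0) (s j0)) \<noteq> 0" if "\<xi> \<in> set ls" for \<xi>
    proof -
      have "set ls \<subseteq> (\<lambda>l. fn (r l) (r l)) ` {l. l < a \<and> l \<noteq> i0} \<union> (\<lambda>l. fn (s l) (s l)) ` {l. l < a \<and> l \<noteq> j0}"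
        using l0 unfolding ls_def by auto
      with that consider l where "l < a" "l \<noteq> i0" "\<xi> = fn (r l) (r l)"
        | l where "l < a" "l \<noteq> j0" "\<xi> = fn (s l) (s l)"
        by blast
      then show ?thesis
        using 1 2 by cases (auto simp: vdot_fn_pt)
    qed
    then show ?thesis
      unfolding E_def prod_list_zero_iff by force
  qed
  ultimately have "c i0 j0 = 0"
    by simp
  then show ?thesis
    using c[OF ij0] by simp
qed

text \<open>In the bound, \<open>2 (a - 1)\<close> is the cost of the separation in
  \<open>independent_step\<close>, and each degree of the coefficients costs a further
  \<open>a - 1\<close>.\<close>

lemma independent_mod_ell:
  assumes "(a - 1) * (n + 2) \<le> d" and "\<And>i j. i < a \<Longrightarrow> j < a \<Longrightarrow> g i j \<in> forms n"
    and "ell dvd (grid_sum d g)"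
    and "i < a" and "j < a"
  shows "ell dvd g i j"
  using assms
proof (induction n arbitrary: d g i j)
  case (0 d g i0 j0)
  show ?case
    by (rule independent_step[OF 0]) (use 0(2) in \<open>simp_all add: Der_forms_0\<close>)
next
  case (Suc n d g i0 j0)
  have kr: "vdot (fn (r l) (r l)) (pt (r i) (s j)) = 0 \<longleftrightarrow> l = i" if "i < a" "j < a" "l < a" for i j l
    using that inj_on_eq_iff[OF inj_r, of i l] r_neq_s[of l j] by (auto simp: vdot_fn_pt)
  have ks: "vdot (fn (s l) (s l)) (pt (r i) (s j)) = 0 \<longleftrightarrow> l = j" if "i < a" "j < a" "l < a" for i j l
    using that inj_on_eq_iff[OF inj_s, of j l] r_neq_s[of i l] by (auto simp: vdot_fn_pt)
  have "ell dvd Der (fn (r i) (r i)) (g i j)" if "i < a" "j < a" for i j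
  proof (rule ell_dvd_Der_of_sum[where n = n and x = r and k = "\<lambda>i j. i" and d = d and g = g])
    show "ell dvd g' i' j'" if "(a - 1) * (n + 2) \<le> d'" "\<And>i j. i < a \<Longrightarrow> j < a \<Longrightarrow> g' i j \<in> forms n"
      "ell dvd (grid_sum d' g')" "i' < a" "j' < a" for d' g' i' j'
      using that by (rule Suc.IH)
  qed (assumption | rule Suc.prems that kr)+
  moreover have "ell dvd Der (fn (s j) (s j)) (g i j)" if "i < a" "j < a" for i j
  proof (rule ell_dvd_Der_of_sum[where n = n and x = s and k = "\<lambda>i j. j" and d = d and g = g])
    show "ell dvd g' i' j'" if "(a - 1) * (n + 2) \<le> d'" "\<And>i j. i < a \<Longrightarrow> j < a \<Longrightarrow> g' i j \<in> forms n"
      "ell dvd (grid_sum d' g')" "i' < a" "j' < a" for d' g' i' j'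
      using that by (rule Suc.IH)
  qed (assumption | rule Suc.prems that ks)+
  ultimately show ?case
    using independent_step[OF Suc.prems] by blast
qed

text \<open>An equation \<open>ell * f = grid_sum d g\<close> is a relation modulo
  \<open>ell\<close> between the powers. Once its coefficients are known to be multiples of
  \<open>ell\<close>, that factor cancels.\<close>

lemma injective:
  assumes t: "t + 1 = m + d" and m: "1 \<le> m" and d: "(a - 1) * (m + 1) \<le> d"
    and f: "f \<in> forms (t - 1)" and ell_f: "ell * f \<in> grid_ideal d"
  shows "f \<in> grid_ideal d"
proof -
  obtain n where n: "m = Suc n"
    using m by (cases m) auto
  have "1 \<le> d"
    using d a_ge_2 by (cases d) auto
  then have t': "t = Suc (t - 1)" "t - d = n" "d \<le> t"
    using t n by auto
  from ell_f obtain g where g: "ell * f = grid_sum d g"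
    by (auto simp: grid_ideal_def)
  have "ell * f \<in> forms t"
    using forms_mult[OF forms_ell f] t'(1) by simp
  then have "ell * f = hom_part t (grid_sum d g)"
    unfolding g[symmetric] by (rule hom_part_same[symmetric])
  also have "\<dots> = (\<Sum>i<a. \<Sum>j<a. L (r i) (s j) ^ d * hom_part n (g i j))"
    using t' by (simp add: hom_part_sum hom_part_mult[OF forms_L_power])
  finally have eq: "ell * f = (\<Sum>i<a. \<Sum>j<a. L (r i) (s j) ^ d * hom_part n (g i j))" .
  have "ell dvd hom_part n (g i j)" if "i < a" "j < a" for i j
  proof (rule independent_mod_ell[where g = "\<lambda>i j. hom_part n (g i j)" and d = d, OF _ hom_part_forms _ that])
    show "(a - 1) * (n + 2) \<le> d"
      using d n by simp
    show "ell dvd (\<Sum>i<a. \<Sum>j<a. L (r i) (s j) ^ d * hom_part n (g i j))"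
      unfolding eq[symmetric] by (rule dvd_triv_left)
  qed
  then obtain h where h: "\<And>i j. i < a \<Longrightarrow> j < a \<Longrightarrow> hom_part n (g i j) = ell * h i j"
    unfolding dvd_def by metis
  have "ell * f = (\<Sum>i<a. \<Sum>j<a. ell * (L (r i) (s j) ^ d * h i j))"
    unfolding eq using h by (intro sum.cong refl) (simp add: mult.left_commute)
  then have "ell * f = ell * (grid_sum d h)"
    by (simp only: sum_distrib_left)
  then have "f = grid_sum d h"
    using ell_neq_0 by (simp only: mult_cancel_left simp_thms)
  then show ?thesis
    unfolding grid_ideal_def by blast
qed

text \<open>The ideal contains no nonzero form of degree below \<open>d\<close>, and
  \<open>ell\<close> is not a zero divisor.\<close>

lemma injective_low_degree:
  assumes "f \<in> forms t" and "t + 1 < d" and "ell * f \<in> grid_ideal d"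
  shows "f \<in> grid_ideal d"
proof -
  from assms(3) obtain g where g: "ell * f = grid_sum d g"
    by (auto simp: grid_ideal_def)
  have "ell * f \<in> forms (t + 1)"
    using forms_mult[OF forms_ell assms(1)] by (simp add: add.commute)
  then have "ell * f = hom_part (t + 1) (grid_sum d g)"
    unfolding g[symmetric] by (rule hom_part_same[symmetric])
  also have "\<dots> = 0"
    using assms(2) by (simp add: hom_part_sum hom_part_mult[OF forms_L_power])
  finally show ?thesis
    using ell_neq_0 grid_ideal_0 by (simp add: mult_eq_0_iff)
qed

end

subsection \<open>Ideals and their quotients\<close>

lemma is_ideal_add: "is_ideal I \<Longrightarrow> p \<in> I \<Longrightarrow> q \<in> I \<Longrightarrow> p + q \<in> I"
  and is_ideal_mult: "is_ideal I \<Longrightarrow> p \<in> I \<Longrightarrow> c * p \<in> I"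
  and is_ideal_0: "is_ideal I \<Longrightarrow> 0 \<in> I"
  and is_ideal_diff: "is_ideal I \<Longrightarrow> p \<in> I \<Longrightarrow> q \<in> I \<Longrightarrow> p - q \<in> I"
  unfolding is_ideal_def
  by (fact self_module.subspace_add self_module.subspace_scale self_module.subspace_0
      self_module.subspace_diff)+

lemma is_ideal_sum: "is_ideal I \<Longrightarrow> (\<And>x. x \<in> A \<Longrightarrow> f x \<in> I) \<Longrightarrow> sum f A \<in> I"
  by (induction A rule: infinite_finite_induct) (auto intro: is_ideal_add is_ideal_0)

lemma is_ideal_power_mono: "is_ideal I \<Longrightarrow> p ^ n \<in> I \<Longrightarrow> n \<le> k \<Longrightarrow> p ^ k \<in> I"
  using is_ideal_mult[of I "p ^ n" "p ^ (k - n)"] by (simp add: power_add[symmetric])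

lemma nilpotent_add:
  assumes I: "is_ideal I" and p: "\<exists>n. p ^ n \<in> I" and q: "\<exists>n. q ^ n \<in> I"
  shows "\<exists>n. (p + q) ^ n \<in> I"
proof -
  obtain n k where nk: "p ^ n \<in> I" "q ^ k \<in> I"
    using p q by blast
  have "of_nat ((n + k) choose i) * p ^ i * q ^ (n + k - i) \<in> I" if "i \<le> n + k" for i
  proof (cases "n \<le> i")
    case True
    then have "p ^ i \<in> I"
      using is_ideal_power_mono[OF I nk(1)] by blast
    then show ?thesis
      using is_ideal_mult[OF I, of "p ^ i" "of_nat ((n + k) choose i) * q ^ (n + k - i)"] by (simp add: mult_ac)
  next
    case False
    then have "q ^ (n + k - i) \<in> I"
      by (intro is_ideal_power_mono[OF I nk(2)]) simp
    then show ?thesis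
      by (rule is_ideal_mult[OF I])
  qed
  then have "(p + q) ^ (n + k) \<in> I"
    unfolding binomial_ring by (intro is_ideal_sum[OF I]) simp
  then show ?thesis
    by blast
qed

lemma nilpotent_mult:
  assumes "is_ideal I" and "\<exists>n. p ^ n \<in> I"
  shows "\<exists>n. (c * p) ^ n \<in> I"
  using assms is_ideal_mult by (metis power_mult_distrib)

lemma var_power: "var i ^ n = Poly_Mapping.single (Poly_Mapping.single i n) 1"
  by (induction n) (simp_all add: var_def mult_single single_add[symmetric])

lemma single_in_ideal:
  assumes I: "is_ideal I" and N: "var i ^ N \<in> I" and m: "N \<le> Poly_Mapping.lookup m i"
  shows "Poly_Mapping.single m c \<in> I"
proof -
  have "m = (m - Poly_Mapping.single i N) + Poly_Mapping.single i N"
    using m by (intro poly_mapping_eqI) (auto simp: lookup_add lookup_minus lookup_single when_def)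
  then have "Poly_Mapping.single m c = Poly_Mapping.single (m - Poly_Mapping.single i N) c * var i ^ N"
    by (simp add: var_power mult_single)
  then show ?thesis
    using is_ideal_mult[OF I N] by simp
qed

lemma finite_bounded_exponents: "finite {m :: 4 \<Rightarrow>\<^sub>0 nat. \<forall>i. Poly_Mapping.lookup m i < N}"
proof -
  define S where "S = {f :: 4 \<Rightarrow> nat. \<forall>x. (x \<in> UNIV \<longrightarrow> f x \<in> {..<N}) \<and> (x \<notin> UNIV \<longrightarrow> f x = 0)}"
  have "finite S"
    unfolding S_def by (rule finite_set_of_finite_funs) simp_all
  moreover have "inj (Poly_Mapping.lookup :: (4 \<Rightarrow>\<^sub>0 nat) \<Rightarrow> 4 \<Rightarrow> nat)"
    by (rule injI) (simp only: poly_mapping_eq_iff)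
  ultimately have "finite (Poly_Mapping.lookup -` S :: (4 \<Rightarrow>\<^sub>0 nat) set)"
    by (rule finite_vimageI)
  moreover have "Poly_Mapping.lookup -` S = {m :: 4 \<Rightarrow>\<^sub>0 nat. \<forall>i. Poly_Mapping.lookup m i < N}"
    unfolding S_def by (simp only: vimage_def mem_Collect_eq UNIV_I lessThan_iff simp_thms)
  ultimately show ?thesis
    by (simp only: )
qed

text \<open>Modulo powers of the variables, finitely many monomials span the ring. A strictly
  descending chain of ideals above \<open>I\<close> would give arbitrarily many independent vectors
  in their span.\<close>

lemma artinian_quotientI:
  fixes I :: "'k::field poly4 set"
  assumes I: "is_ideal I" and nil: "\<And>i. \<exists>n. var i ^ n \<in> I"
  shows "artinian_quotient I"
  unfolding artinian_quotient_def
proof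
  assume "\<exists>J. \<forall>n::nat. is_ideal (J n) \<and> I \<subseteq> J n \<and> J (Suc n) \<subset> J n"
  then obtain J where *: "\<forall>n::nat. is_ideal (J n) \<and> I \<subseteq> J n \<and> J (Suc n) \<subset> J n"
    by (rule exE)
  then have J: "\<And>n. is_ideal (J n)" "\<And>n. I \<subseteq> J n" "\<And>n. J (Suc n) \<subset> J n"
    by simp_all
  have "\<forall>i. \<exists>n. var i ^ n \<in> I"
    using nil by simp
  from choice[OF this] obtain N' where N': "\<forall>i. var i ^ N' i \<in> I"
    by (rule exE)
  define N where "N = (\<Sum>i\<in>UNIV. N' i)"
  have N: "var i ^ N \<in> I" for i
  proof (rule is_ideal_power_mono[OF I N'[rule_format]])
    show "N' i \<le> N"
      unfolding N_def by (rule member_le_sum) simp_all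
  qed
  interpret V: vector_space "\<lambda>(c::'k) (p::'k poly4). cst c * p"
    by standard (simp_all only: distrib_left distrib_right cst_add cst_mult mult.assoc cst_1 mult_1)
  define M where "M = {m :: 4 \<Rightarrow>\<^sub>0 nat. \<forall>i. Poly_Mapping.lookup m i < N}"
  define B where "B = (\<lambda>m. Poly_Mapping.single m (1::'k)) ` M"
  have "finite B"
    unfolding B_def M_def by (intro finite_imageI finite_bounded_exponents)
  have low: "\<exists>y. y \<in> V.span B \<and> x - y \<in> I" for x
  proof (induction x rule: poly4_induct)
    case (single m c)
    show ?case
    proof (cases "m \<in> M")
      case True
      then have "cst c * Poly_Mapping.single m 1 \<in> V.span B"
        by (intro V.span_scale V.span_base) (auto simp: B_def)
      then show ?thesis
        using is_ideal_0[OF I] by (intro exI[of _ "Poly_Mapping.single m c"]) (simp add: cst_mult_single)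
    next
      case False
      then obtain i where "N \<le> Poly_Mapping.lookup m i"
        by (auto simp: M_def not_less)
      then show ?thesis
        using single_in_ideal[OF I N] V.span_zero by (intro exI[of _ 0]) simp
    qed
  next
    case (add p q)
    then obtain y z where "y \<in> V.span B" "p - y \<in> I" "z \<in> V.span B" "q - z \<in> I"
      by blast
    moreover have "p + q - (y + z) = (p - y) + (q - z)"
      by simp
    ultimately show ?case
      by (intro exI[of _ "y + z"]) (metis V.span_add is_ideal_add[OF I])
  qed
  \<comment> \<open>An element of \<open>I\<close> moves a vector into \<open>V.span B\<close>
    without changing which members of the chain contain it.\<close>
  have "\<exists>y. y \<in> J n \<and> y \<notin> J (Suc n) \<and> y \<in> V.span B" for n
  proof -
    obtain x where x: "x \<in> J n" "x \<notin> J (Suc n)"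
      using J(3) by blast
    obtain y where y: "y \<in> V.span B" "x - y \<in> I"
      using low by blast
    have xy: "x - y \<in> J k" for k
      using y(2) J(2) by blast
    have "x - (x - y) \<in> J n"
      by (rule is_ideal_diff[OF J(1) x(1) xy])
    moreover have "y \<notin> J (Suc n)"
    proof
      assume "y \<in> J (Suc n)"
      then have "(x - y) + y \<in> J (Suc n)"
        by (rule is_ideal_add[OF J(1) xy])
      with x(2) show False
        by simp
    qed
    ultimately show ?thesis
      using y(1) by auto
  qed
  then obtain y where y: "\<And>n. y n \<in> J n" "\<And>n. y n \<notin> J (Suc n)" "\<And>n. y n \<in> V.span B"
    by metis
  have J_mono: "J n \<subseteq> J k" if "k \<le> n" for n k
  proof (rule lift_Suc_antimono_le[OF _ that])
    show "J (Suc n) \<subseteq> J n" for n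
      using J(3)[of n] by (rule psubset_imp_subset)
  qed
  \<comment> \<open>The family grows at its front: all later vectors lie in
    \<open>J (Suc n)\<close>, and \<open>y n\<close> does not.\<close>
  have "V.independent (y ` {n..<n + k}) \<and> card (y ` {n..<n + k}) = k" for n k
  proof (induction k arbitrary: n)
    case 0
    show ?case
      by (simp add: V.independent_empty)
  next
    case (Suc k)
    let ?Y = "y ` {Suc n..<Suc n + k}"
    have sub: "?Y \<subseteq> J (Suc n)"
    proof (rule image_subsetI)
      fix i assume "i \<in> {Suc n..<Suc n + k}"
      then have "J i \<subseteq> J (Suc n)"
        by (intro J_mono) simp
      then show "y i \<in> J (Suc n)"
        using y(1)[of i] by (rule subsetD)
    qed
    have "V.subspace (J (Suc n))"
      by (rule V.subspaceI) (simp_all add: is_ideal_0 is_ideal_add is_ideal_mult J(1))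
    with sub have "V.span ?Y \<subseteq> J (Suc n)"
      by (rule V.span_minimal)
    then have "y n \<notin> V.span ?Y"
      using y(2)[of n] by (rule contra_subsetD)
    then have "V.independent (insert (y n) ?Y)"
      using conjunct1[OF Suc.IH[of "Suc n"]] by (rule V.independent_insertI)
    moreover have "y n \<notin> ?Y"
      using sub y(2)[of n] by (rule contra_subsetD)
    then have "card (insert (y n) ?Y) = Suc k"
      using conjunct2[OF Suc.IH[of "Suc n"]] by (subst card_insert_disjoint) simp_all
    moreover have "{n..<n + Suc k} = insert n {Suc n..<Suc n + k}"
      by auto
    then have "y ` {n..<n + Suc k} = insert (y n) ?Y"
      by (simp only: image_insert)
    ultimately show ?case
      by (simp only: simp_thms)
  qed
  from this[of 0 "Suc (card B)"] have ind: "V.independent (y ` {0..<0 + Suc (card B)})"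
    and card: "card (y ` {0..<0 + Suc (card B)}) = Suc (card B)"
    by (rule conjunct1, rule conjunct2)
  have "y ` {0..<0 + Suc (card B)} \<subseteq> V.span B"
    by (rule image_subsetI) (rule y(3))
  from conjunct2[OF V.independent_span_bound[OF \<open>finite B\<close> ind this]]
  have "card (y ` {0..<0 + Suc (card B)}) \<le> card B" .
  then show False
    unfolding card by simp
qed

lemma residue_class_eq_iff:
  assumes "is_ideal I"
  shows "residue_class I f = residue_class I g \<longleftrightarrow> f - g \<in> I"
proof
  assume eq: "residue_class I f = residue_class I g"
  have "f \<in> residue_class I f"
    using is_ideal_0[OF assms] by (simp add: residue_class_def)
  then show "f - g \<in> I"
    unfolding eq by (simp add: residue_class_def)
next
  assume fg: "f - g \<in> I"
  have "h - f \<in> I \<longleftrightarrow> h - g \<in> I" for h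
    using is_ideal_add[OF assms, of "h - f" "f - g"] is_ideal_diff[OF assms, of "h - g" "f - g"] fg by auto
  then show "residue_class I f = residue_class I g"
    by (simp add: residue_class_def)
qed

lemma inj_quot_mult_iff:
  fixes I :: "'k::field poly4 set"
  assumes I: "is_ideal I"
  shows "inj_on (quot_mult I l) (quot_component I t) \<longleftrightarrow> (\<forall>f\<in>forms t. l * f \<in> I \<longrightarrow> f \<in> I)"
proof
  assume inj: "inj_on (quot_mult I l) (quot_component I t)"
  show "\<forall>f\<in>forms t. l * f \<in> I \<longrightarrow> f \<in> I"
  proof (intro ballI impI)
    fix f :: "'k poly4"
    assume f: "f \<in> forms t" "l * f \<in> I"
    then have "residue_class I (l * f) = residue_class I (l * 0)"
      unfolding residue_class_eq_iff[OF I] by (simp only: mult_zero_right diff_zero)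
    then have "quot_mult I l (residue_class I f) = quot_mult I l (residue_class I 0)"
      unfolding quot_mult_residue_class[OF I] .
    moreover have "residue_class I g \<in> quot_component I t" if "g \<in> forms t" for g
      unfolding quot_component_def using that by (rule imageI)
    ultimately have "residue_class I f = residue_class I 0"
      using inj_onD[OF inj] f(1) forms_0 by blast
    then show "f \<in> I"
      unfolding residue_class_eq_iff[OF I] by (simp only: diff_zero)
  qed
next
  assume *: "\<forall>f\<in>forms t. l * f \<in> I \<longrightarrow> f \<in> I"
  show "inj_on (quot_mult I l) (quot_component I t)"
  proof (rule inj_onI)
    fix C D assume "C \<in> quot_component I t" "D \<in> quot_component I t" and eq: "quot_mult I l C = quot_mult I l D"
    then obtain f g where f: "C = residue_class I f" "f \<in> forms t" and g: "D = residue_class I g" "g \<in> forms t"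
      unfolding quot_component_def by blast
    have "l * (f - g) \<in> I"
      using eq unfolding f(1) g(1) quot_mult_residue_class[OF I] residue_class_eq_iff[OF I] right_diff_distrib .
    then have "f - g \<in> I"
      using * forms_diff[OF f(2) g(2)] by blast
    then show "C = D"
      unfolding f(1) g(1) residue_class_eq_iff[OF I] .
  qed
qed

lemma surj_quot_mult_iff:
  fixes I :: "'k::field poly4 set"
  assumes I: "is_ideal I" and l: "l \<in> forms 1"
  shows "quot_mult I l ` quot_component I t = quot_component I (Suc t)
    \<longleftrightarrow> (\<forall>f\<in>forms (Suc t). \<exists>g\<in>forms t. f - l * g \<in> I)"
proof -
  have img: "quot_mult I l ` quot_component I t = (\<lambda>g. residue_class I (l * g)) ` forms t"
    unfolding quot_component_def image_image quot_mult_residue_class[OF I] ..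
  have "(\<lambda>g. residue_class I (l * g)) ` forms t \<subseteq> quot_component I (Suc t)"
    using forms_mult[OF l] by (auto simp: quot_component_def)
  then have "quot_mult I l ` quot_component I t = quot_component I (Suc t)
      \<longleftrightarrow> residue_class I ` forms (Suc t) \<subseteq> (\<lambda>g. residue_class I (l * g)) ` forms t"
    unfolding img by (auto simp: quot_component_def)
  also have "\<dots> \<longleftrightarrow> (\<forall>f\<in>forms (Suc t). \<exists>g\<in>forms t. residue_class I f = residue_class I (l * g))"
    by (auto simp: image_iff subset_iff)
  finally show ?thesis
    unfolding residue_class_eq_iff[OF I] .
qed

section \<open>The ideal of a grid\<close>

context grid_frame
begin

lemma is_ideal_grid_ideal: "is_ideal (grid_ideal d)"
  unfolding is_ideal_def self_module.subspace_def
  using grid_ideal_0 grid_ideal_add grid_ideal_mult by blast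

text \<open>\<open>z11\<close>, \<open>z10\<close>, \<open>z01\<close>, \<open>z00\<close> are
  obtained in turn as combinations of the forms \<open>L (r i) (s j)\<close> with
  \<open>i, j < 2\<close>, and combinations of elements that are nilpotent modulo the ideal are
  again nilpotent.\<close>

lemma artinian_grid_ideal: "artinian_quotient (grid_ideal d)"
proof (rule artinian_quotientI[OF is_ideal_grid_ideal])
  fix k
  let ?nil = "\<lambda>p. \<exists>n. p ^ n \<in> grid_ideal d"
  note add = nilpotent_add[OF is_ideal_grid_ideal, of _ d]
  note mult = nilpotent_mult[OF is_ideal_grid_ideal, of _ d]
  have L: "?nil (L (r i) (s j))" if "i < a" "j < a" for i j
    using L_power_in_grid_ideal[OF that order.refl, of d 1] by (intro exI[of _ d]) simp
  have diff: "?nil (p - q)" if "?nil p" "?nil q" for p q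
    using add[OF that(1) mult[OF that(2), of "- 1"]] by simp
  have cancel: "?nil p" if "?nil (cst c * p)" "c \<noteq> 0" for c p
    using mult[OF that(1), of "cst (inverse c)"] unfolding cst_inverse_cancel[OF that(2)] .
  have L_expand: "L x y = z00 + cst x * z10 + cst y * z01 + cst x * (cst y * z11)" for x y
    by (simp add: L_def pt_def linear_form_add linear_form_scale cst_mult mult.assoc)
  have neq: "r 1 - r 0 \<noteq> 0" "s 1 - s 0 \<noteq> 0"
    using inj_on_eq_iff[OF inj_r, of 1 0] inj_on_eq_iff[OF inj_s, of 1 0] a_ge_2 by simp_all
  have a: "0 < a" "1 < a"
    using a_ge_2 by simp_all
  have x: "?nil (z10 + cst (s j) * z11)" if "j < a" for j
  proof (rule cancel[OF _ neq(1)])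
    have "cst (r 1 - r 0) * (z10 + cst (s j) * z11) = L (r 1) (s j) - L (r 0) (s j)"
      unfolding L_expand cst_diff by (simp add: algebra_simps)
    then show "?nil (cst (r 1 - r 0) * (z10 + cst (s j) * z11))"
      using diff[OF L[OF a(2) that] L[OF a(1) that]] by simp
  qed
  have z11: "?nil z11"
  proof (rule cancel[OF _ neq(2)])
    have "cst (s 1 - s 0) * z11 = (z10 + cst (s 1) * z11) - (z10 + cst (s 0) * z11)"
      unfolding cst_diff by (simp add: algebra_simps)
    then show "?nil (cst (s 1 - s 0) * z11)"
      using diff[OF x[OF a(2)] x[OF a(1)]] by simp
  qed
  have z10: "?nil z10"
    using diff[OF x[OF a(1)] mult[OF z11, of "cst (s 0)"]] by simp
  have y: "?nil (z01 + cst (r 0) * z11)"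
  proof (rule cancel[OF _ neq(2)])
    have "cst (s 1 - s 0) * (z01 + cst (r 0) * z11) = L (r 0) (s 1) - L (r 0) (s 0)"
      unfolding L_expand cst_diff by (simp add: algebra_simps)
    then show "?nil (cst (s 1 - s 0) * (z01 + cst (r 0) * z11))"
      using diff[OF L[OF a(1) a(2)] L[OF a(1) a(1)]] by simp
  qed
  have z01: "?nil z01"
    using diff[OF y mult[OF z11, of "cst (r 0)"]] by simp
  have z00: "?nil z00"
    using diff[OF diff[OF diff[OF L[OF a(1) a(1)] mult[OF z10, of "cst (r 0)"]] mult[OF z01, of "cst (s 0)"]]
        mult[OF mult[OF z11, of "cst (s 0)"], of "cst (r 0)"]]
    unfolding L_expand by simp
  show "?nil (var k)"
    unfolding linear_form_axis[symmetric] linear_form_expand[of "axis k 1"]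
    by (intro add mult z00 z10 z01 z11)
qed

lemma power_ideal_eq_grid_ideal:
  assumes X: "X = {proj_point (pt (r i) (s j)) | i j. i < a \<and> j < a}"
  shows "power_ideal d X = grid_ideal d"
proof
  have sub: "self_module.subspace (grid_ideal d)"
    using is_ideal_grid_ideal by (simp add: is_ideal_def)
  show "power_ideal d X \<subseteq> grid_ideal d"
    unfolding power_ideal_def ideal_generated_def
  proof (intro self_module.span_minimal sub subsetI)
    fix p assume "p \<in> {linear_form \<alpha> ^ d | \<alpha>. \<alpha> \<noteq> 0 \<and> proj_point \<alpha> \<in> X}"
    then obtain \<alpha> i j where p: "p = linear_form \<alpha> ^ d" and ij: "i < a" "j < a"
      and \<alpha>: "proj_point \<alpha> = proj_point (pt (r i) (s j))"
      by (auto simp: X)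
    have "\<alpha> \<in> vec.span {pt (r i) (s j)}"
      using \<alpha> vec.span_base[of \<alpha> "{\<alpha>}"] by (simp add: proj_point_def)
    then obtain c where "\<alpha> = c *s pt (r i) (s j)"
      by (auto simp: vec.span_singleton)
    then have "p = L (r i) (s j) ^ d * cst (c ^ d)"
      by (simp add: p L_def linear_form_scale power_mult_distrib cst_power mult.commute)
    then show "p \<in> grid_ideal d"
      using L_power_in_grid_ideal[OF ij order.refl] by simp
  qed
  show "grid_ideal d \<subseteq> power_ideal d X"
  proof
    fix p assume "p \<in> grid_ideal d"
    then obtain g where p: "p = grid_sum d g"
      by (auto simp: grid_ideal_def)
    have "L (r i) (s j) ^ d * g i j \<in> power_ideal d X" if "i < a" "j < a" for i j
    proof -
      have "vdot f00 (pt (r i) (s j)) = 1"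
        by (simp add: pt_def vdot_simps)
      then have "pt (r i) (s j) \<noteq> 0"
        by (auto simp: vdot_def)
      then have "L (r i) (s j) ^ d \<in> {linear_form \<alpha> ^ d | \<alpha>. \<alpha> \<noteq> 0 \<and> proj_point \<alpha> \<in> X}"
        using that unfolding X L_def by blast
      then have "g i j * L (r i) (s j) ^ d \<in> power_ideal d X"
        unfolding power_ideal_def ideal_generated_def
        by (intro self_module.span_scale self_module.span_base)
      then show ?thesis
        by (simp add: mult.commute)
    qed
    then show "p \<in> power_ideal d X"
      unfolding p power_ideal_def ideal_generated_def by (intro self_module.span_sum) simp
  qed
qed

subsection \<open>Maximal rank\<close>

lemma maximal_rank_iff:
  assumes d: "1 \<le> d"
  shows "(\<forall>t. inj_on (quot_mult (grid_ideal d) ell) (quot_component (grid_ideal d) t) \<or>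
      quot_mult (grid_ideal d) ell ` quot_component (grid_ideal d) t = quot_component (grid_ideal d) (Suc t))
    \<longleftrightarrow> d \<le> a - 1 \<or> (a - 1) dvd d" (is "?L \<longleftrightarrow> ?R")
proof
  assume R: ?R
  show ?L
  proof
    fix t
    show "inj_on (quot_mult (grid_ideal d) ell) (quot_component (grid_ideal d) t) \<or>
      quot_mult (grid_ideal d) ell ` quot_component (grid_ideal d) t = quot_component (grid_ideal d) (Suc t)"
      unfolding inj_quot_mult_iff[OF is_ideal_grid_ideal] surj_quot_mult_iff[OF is_ideal_grid_ideal forms_ell]
    proof (cases "t + 1 < d")
      case True
      then show "(\<forall>f\<in>forms t. ell * f \<in> grid_ideal d \<longrightarrow> f \<in> grid_ideal d) \<or>
          (\<forall>f\<in>forms (Suc t). \<exists>g\<in>forms t. f - ell * g \<in> grid_ideal d)"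
        using injective_low_degree by blast
    next
      case False
      \<comment> \<open>Solves \<open>Suc t + 1 = m + d\<close>: here \<open>t\<close> is the degree
        of the source, whereas \<open>surjective\<close> and \<open>injective\<close> count by the
        degree of the target.\<close>
      define m where "m = t + 2 - d"
      have m: "Suc t + 1 = m + d" "1 \<le> m"
        using False by (simp_all add: m_def)
      show "(\<forall>f\<in>forms t. ell * f \<in> grid_ideal d \<longrightarrow> f \<in> grid_ideal d) \<or>
          (\<forall>f\<in>forms (Suc t). \<exists>g\<in>forms t. f - ell * g \<in> grid_ideal d)"
      proof (cases "Suc t < a * m")
        case True
        then show ?thesis
          using surjective[OF m(1) d] by simp
      next
        case False
        have "a * m = (a - 1) * m + m"
          using a_ge_2 by (cases a) simp_all
        with False m have lt: "(a - 1) * m < d"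
          by linarith
        have "\<not> d \<le> a - 1"
          using lt m(2) mult_le_mono2[of 1 m "a - 1"] by linarith
        with R obtain c where c: "d = (a - 1) * c"
          by (auto elim: dvdE)
        \<comment> \<open>A multiple of \<open>a - 1\<close> above \<open>(a - 1) * m\<close> is at
          least \<open>(a - 1) * (m + 1)\<close>, so no degree falls between surjectivity and
          injectivity.\<close>
        with lt have "m + 1 \<le> c"
          by simp
        then have "(a - 1) * (m + 1) \<le> d"
          unfolding c by (rule mult_le_mono2)
        then show ?thesis
          using injective[OF m] by simp
      qed
    qed
  qed
next
  assume L: ?L
  show ?R
  proof (rule ccontr)
    assume R: "\<not> ?R"
    \<comment> \<open>The largest \<open>m\<close> with \<open>(a - 1) * m < d\<close>. Since
      \<open>a - 1\<close> does not divide \<open>d\<close>, the remainder \<open>q\<close> is not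
      \<open>a - 2\<close>; since \<open>d > a - 1\<close>, \<open>m\<close> is positive.\<close>
    define m where "m = (d - 1) div (a - 1)"
    define q where "q = (d - 1) mod (a - 1)"
    have a1: "0 < a - 1"
      using a_ge_2 by simp
    have dq: "d = (a - 1) * m + q + 1"
      using d by (simp add: m_def q_def)
    have q: "q < a - 1"
      using a1 by (simp add: q_def)
    have "q + 1 \<noteq> a - 1"
    proof
      assume "q + 1 = a - 1"
      then have "d = (a - 1) * (m + 1)"
        using dq by simp
      with R show False
        by simp
    qed
    have m: "1 \<le> m"
    proof (rule ccontr)
      assume "\<not> 1 \<le> m"
      then have "d = q + 1"
        using dq by simp
      with q R show False
        by simp
    qed
    define t where "t = m + d - 1"
    have t: "t + 1 = m + d" "1 \<le> t"
      using m d by (simp_all add: t_def)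
    have "a * m = (a - 1) * m + m"
      using a_ge_2 by (cases a) simp_all
    then have am: "a * m \<le> t" "t + 3 \<le> a * m + a"
      using dq q \<open>q + 1 \<noteq> a - 1\<close> t by linarith+
    have "\<not> (\<forall>f\<in>forms (t - 1). ell * f \<in> grid_ideal d \<longrightarrow> f \<in> grid_ideal d)"
      using not_injective[OF t(1) m am] by blast
    moreover have "L (s 0) (s 0) ^ t \<in> forms (Suc (t - 1))"
      using forms_L_power[of "s 0" "s 0" t] t(2) by simp
    then have "\<not> (\<forall>f\<in>forms (Suc (t - 1)). \<exists>g\<in>forms (t - 1). f - ell * g \<in> grid_ideal d)"
      using not_surjective[OF t(1) d am(1)] by blast
    ultimately show False
      using L unfolding inj_quot_mult_iff[OF is_ideal_grid_ideal] surj_quot_mult_iff[OF is_ideal_grid_ideal forms_ell]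
      by blast
  qed
qed

end

subsection \<open>Frames adapted to a grid and a linear form\<close>

text \<open>
  The grid \<open>X\<close> is \<open>{(1, r\<^sub>i) \<otimes> (1, s\<^sub>j)}\<close> in a basis in which \<open>\<alpha>\<close> is the antisymmetric tensor.
\<close>

abbreviation adapted_frame_at :: "nat \<Rightarrow> ('k::field_char_0 ^ 4) set set \<Rightarrow> 'k ^ 4 \<Rightarrow> bool" where
  "adapted_frame_at a X \<alpha> \<equiv> \<exists>e00 e10 e01 e11 f00 f10 f01 f11 r s. grid_frame a e00 e10 e01 e11 f00 f10 f01 f11 r s \<and>
     \<alpha> = e10 - e01 \<and> X = {proj_point (grid_frame.pt e00 e10 e01 e11 (r i) (s j)) | i j. i < a \<and> j < a}"

lemma proj_point_scale:
  fixes k :: "'k::field"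
  assumes "k \<noteq> 0"
  shows "proj_point (k *s w) = proj_point w"
  unfolding proj_point_def
proof
  show "vec.span {k *s w} \<subseteq> vec.span {w}"
    by (intro vec.span_minimal) (auto intro: vec.span_scale vec.span_base)
  have "(1 / k) *s (k *s w) \<in> vec.span {k *s w}"
    by (intro vec.span_scale vec.span_base) simp
  then have "w \<in> vec.span {k *s w}"
    using assms by simp
  then show "vec.span {w} \<subseteq> vec.span {k *s w}"
    by (intro vec.span_minimal) auto
qed

text \<open>Coordinates that make \<open>k^4\<close> the tensor product of two planes:
  \<open>E00\<close>, ..., \<open>E11\<close> are the products of basis vectors and
  \<open>h00\<close>, ..., \<open>h11\<close> the dual basis.\<close>

locale tensor_frame =
  fixes E00 E01 E10 E11 h00 h01 h10 h11 :: "'k::field_char_0 ^ 4"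
  assumes dual [simp]:
      "vdot h00 E00 = 1" "vdot h00 E01 = 0" "vdot h00 E10 = 0" "vdot h00 E11 = 0"
      "vdot h01 E00 = 0" "vdot h01 E01 = 1" "vdot h01 E10 = 0" "vdot h01 E11 = 0"
      "vdot h10 E00 = 0" "vdot h10 E01 = 0" "vdot h10 E10 = 1" "vdot h10 E11 = 0"
      "vdot h11 E00 = 0" "vdot h11 E01 = 0" "vdot h11 E10 = 0" "vdot h11 E11 = 1"
    and expand: "\<And>\<alpha>. \<alpha> = vdot h00 \<alpha> *s E00 + vdot h01 \<alpha> *s E01 + vdot h10 \<alpha> *s E10 + vdot h11 \<alpha> *s E11"
begin

definition ten :: "'k \<Rightarrow> 'k \<Rightarrow> 'k \<Rightarrow> 'k \<Rightarrow> 'k ^ 4" where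
  "ten v0 v1 u0 u1 = (v0 * u0) *s E00 + (v0 * u1) *s E01 + (v1 * u0) *s E10 + (v1 * u1) *s E11"

lemma vdot_ten [simp]:
  "vdot h00 (ten v0 v1 u0 u1) = v0 * u0" "vdot h01 (ten v0 v1 u0 u1) = v0 * u1"
  "vdot h10 (ten v0 v1 u0 u1) = v1 * u0" "vdot h11 (ten v0 v1 u0 u1) = v1 * u1"
  by (simp_all add: ten_def vdot_simps)

lemma eqI:
  assumes "vdot h00 \<alpha> = vdot h00 \<beta>" "vdot h01 \<alpha> = vdot h01 \<beta>" "vdot h10 \<alpha> = vdot h10 \<beta>" "vdot h11 \<alpha> = vdot h11 \<beta>"
  shows "\<alpha> = \<beta>"
  by (subst expand[of \<alpha>], subst expand[of \<beta>]) (simp only: assms)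

definition det2 :: "'k ^ 4 \<Rightarrow> 'k" where
  "det2 \<alpha> = vdot h00 \<alpha> * vdot h11 \<alpha> - vdot h01 \<alpha> * vdot h10 \<alpha>"

text \<open>The factors get the new bases \<open>p, q\<close> and \<open>(1, 0), (c, 1)\<close>. By
  Cramer's rule \<open>r i\<close> and \<open>s j\<close> are the affine coordinates of the grid
  vectors in them. The assumptions \<open>u\<close> and \<open>v\<close> keep these off infinity,
  and \<open>uv\<close> says that \<open>r i \<noteq> s j\<close>.\<close>

lemma adapted_frame:
  fixes a :: nat and v0 v1 u0 u1 :: "nat \<Rightarrow> 'k"
  assumes a: "2 \<le> a" and \<Delta>: "\<Delta> = p0 * q1 - p1 * q0" "\<Delta> \<noteq> 0"
    and u: "\<And>j. j < a \<Longrightarrow> u0 j - c * u1 j \<noteq> 0" and v: "\<And>i. i < a \<Longrightarrow> v0 i * q1 - v1 i * q0 \<noteq> 0"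
    and vi: "\<And>i k. i < a \<Longrightarrow> k < a \<Longrightarrow> i \<noteq> k \<Longrightarrow> v0 i * v1 k - v1 i * v0 k \<noteq> 0"
    and uj: "\<And>i k. i < a \<Longrightarrow> k < a \<Longrightarrow> i \<noteq> k \<Longrightarrow> u0 i * u1 k - u1 i * u0 k \<noteq> 0"
    and uv: "\<And>i j. i < a \<Longrightarrow> j < a \<Longrightarrow>
      (p0 * v1 i - p1 * v0 i) * (u0 j - c * u1 j) - u1 j * (v0 i * q1 - v1 i * q0) \<noteq> 0"
  shows "\<exists>f00 f10 f01 f11 r s. grid_frame a (ten p0 p1 1 0) (ten q0 q1 1 0) (ten p0 p1 c 1) (ten q0 q1 c 1)
      f00 f10 f01 f11 r s \<and>
    (\<forall>i<a. \<forall>j<a. \<exists>k. k \<noteq> 0 \<and> grid_frame.pt (ten p0 p1 1 0) (ten q0 q1 1 0) (ten p0 p1 c 1) (ten q0 q1 c 1)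
      (r i) (s j) = k *s ten (v0 i) (v1 i) (u0 j) (u1 j))"
proof -
  define f00 where "f00 = (1 / \<Delta>) *s (q1 *s (h00 - c *s h01) - q0 *s (h10 - c *s h11))"
  define f10 where "f10 = (1 / \<Delta>) *s (p0 *s (h10 - c *s h11) - p1 *s (h00 - c *s h01))"
  define f01 where "f01 = (1 / \<Delta>) *s (q1 *s h01 - q0 *s h11)"
  define f11 where "f11 = (1 / \<Delta>) *s (p0 *s h11 - p1 *s h01)"
  define r where "r i = (p0 * v1 i - p1 * v0 i) / (v0 i * q1 - v1 i * q0)" for i
  define s where "s j = u1 j / (u0 j - c * u1 j)" for j
  have ev: "vdot f00 \<alpha> = (q1 * (vdot h00 \<alpha> - c * vdot h01 \<alpha>) - q0 * (vdot h10 \<alpha> - c * vdot h11 \<alpha>)) / \<Delta>"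
    "vdot f10 \<alpha> = (p0 * (vdot h10 \<alpha> - c * vdot h11 \<alpha>) - p1 * (vdot h00 \<alpha> - c * vdot h01 \<alpha>)) / \<Delta>"
    "vdot f01 \<alpha> = (q1 * vdot h01 \<alpha> - q0 * vdot h11 \<alpha>) / \<Delta>"
    "vdot f11 \<alpha> = (p0 * vdot h11 \<alpha> - p1 * vdot h01 \<alpha>) / \<Delta>" for \<alpha>
    by (simp_all add: f00_def f10_def f01_def f11_def vdot_simps)
  have d1: "x / \<Delta> = 1" if "x = \<Delta>" for x
    using that \<Delta>(2) by simp
  have d0: "x / \<Delta> = 0" if "x = 0" for x
    using that by simp
  have cancel: "x / \<Delta> * y + x' / \<Delta> * y' + x'' / \<Delta> * y'' + x''' / \<Delta> * y''' = z"
    if "x * y + x' * y' + x'' * y'' + x''' * y''' = \<Delta> * z" for x y x' y' x'' y'' x''' y''' z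
  proof -
    have "x / \<Delta> * y + x' / \<Delta> * y' + x'' / \<Delta> * y'' + x''' / \<Delta> * y''' = (x * y + x' * y' + x'' * y'' + x''' * y''') / \<Delta>"
      by (simp add: add_divide_distrib)
    then show ?thesis
      using that \<Delta>(2) by simp
  qed
  interpret G: grid_frame a "ten p0 p1 1 0" "ten q0 q1 1 0" "ten p0 p1 c 1" "ten q0 q1 c 1" f00 f10 f01 f11 r s
  proof
    show "vdot f00 (ten p0 p1 1 0) = 1" "vdot f10 (ten q0 q1 1 0) = 1" "vdot f01 (ten p0 p1 c 1) = 1"
      "vdot f11 (ten q0 q1 c 1) = 1"
      unfolding ev by (rule d1, simp add: \<Delta>(1) algebra_simps)+
    show "vdot f00 (ten q0 q1 1 0) = 0" "vdot f00 (ten p0 p1 c 1) = 0" "vdot f00 (ten q0 q1 c 1) = 0"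
      "vdot f10 (ten p0 p1 1 0) = 0" "vdot f10 (ten p0 p1 c 1) = 0" "vdot f10 (ten q0 q1 c 1) = 0"
      "vdot f01 (ten p0 p1 1 0) = 0" "vdot f01 (ten q0 q1 1 0) = 0" "vdot f01 (ten q0 q1 c 1) = 0"
      "vdot f11 (ten p0 p1 1 0) = 0" "vdot f11 (ten q0 q1 1 0) = 0" "vdot f11 (ten p0 p1 c 1) = 0"
      unfolding ev by (rule d0, simp add: algebra_simps)+
    show "\<alpha> = vdot f00 \<alpha> *s ten p0 p1 1 0 + vdot f10 \<alpha> *s ten q0 q1 1 0 + vdot f01 \<alpha> *s ten p0 p1 c 1
        + vdot f11 \<alpha> *s ten q0 q1 c 1" for \<alpha>
    proof (rule eqI)
    qed (simp only: vdot_add_right vdot_scale_right vdot_ten ev, rule cancel[symmetric], simp add: \<Delta>(1) algebra_simps)+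
    show "2 \<le> a"
      by (rule a)
    show "inj_on r {..<a}"
    proof (rule inj_onI, rule ccontr)
      fix i k assume ik: "i \<in> {..<a}" "k \<in> {..<a}" "r i = r k" "i \<noteq> k"
      have "(p0 * v1 i - p1 * v0 i) * (v0 k * q1 - v1 k * q0) = (p0 * v1 k - p1 * v0 k) * (v0 i * q1 - v1 i * q0)"
        using ik(3) v[of i] v[of k] ik(1,2) by (simp add: r_def frac_eq_eq)
      then have "\<Delta> * (v0 i * v1 k - v1 i * v0 k) = 0"
        unfolding \<Delta>(1) by (simp add: algebra_simps)
      then show False
        using vi[of i k] ik \<Delta>(2) by simp
    qed
    show "inj_on s {..<a}"
    proof (rule inj_onI, rule ccontr)
      fix i k assume ik: "i \<in> {..<a}" "k \<in> {..<a}" "s i = s k" "i \<noteq> k"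
      have "u1 i * (u0 k - c * u1 k) = u1 k * (u0 i - c * u1 i)"
        using ik(3) u[of i] u[of k] ik(1,2) by (simp add: s_def frac_eq_eq)
      then have "u0 i * u1 k - u1 i * u0 k = 0"
        by (simp add: algebra_simps)
      then show False
        using uj[of i k] ik by simp
    qed
    show "r i \<noteq> s j" if "i < a" "j < a" for i j
    proof
      assume "r i = s j"
      then have "(p0 * v1 i - p1 * v0 i) * (u0 j - c * u1 j) = u1 j * (v0 i * q1 - v1 i * q0)"
        using u[OF that(2)] v[OF that(1)] by (simp add: r_def s_def frac_eq_eq)
      then show False
        using uv[OF that] by simp
    qed
  qed
  have "\<exists>k. k \<noteq> 0 \<and> G.pt (r i) (s j) = k *s ten (v0 i) (v1 i) (u0 j) (u1 j)" if "i < a" "j < a" for i j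
  proof (intro exI conjI)
    let ?V = "v0 i * q1 - v1 i * q0" and ?U = "u0 j - c * u1 j"
    have nz: "?V \<noteq> 0" "?U \<noteq> 0"
      using that u v by simp_all
    show "\<Delta> / (?V * ?U) \<noteq> 0"
      using nz \<Delta>(2) by simp
    have P: "p0 + r i * q0 = \<Delta> * v0 i / ?V" "p1 + r i * q1 = \<Delta> * v1 i / ?V"
      using nz by (simp_all add: r_def \<Delta>(1) divide_simps) (simp_all add: algebra_simps)
    have S: "1 + s j * c = u0 j / ?U" "s j = u1 j / ?U"
      using nz by (simp_all add: s_def divide_simps)
    have G: "G.pt (r i) (s j) = ten (p0 + r i * q0) (p1 + r i * q1) (1 + s j * c) (s j)"
      by (rule eqI) (simp_all add: G.pt_def vdot_add_right vdot_scale_right, simp_all add: algebra_simps)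
    show "G.pt (r i) (s j) = (\<Delta> / (?V * ?U)) *s ten (v0 i) (v1 i) (u0 j) (u1 j)"
      unfolding G P S(1) S(2)[symmetric]
      by (rule eqI) (simp_all only: vdot_ten vdot_scale_right S(2), simp_all)
  qed
  then show ?thesis
    using G.grid_frame_axioms by blast
qed

text \<open>The equation of the tangent plane to the quadric of pure tensors at
  \<open>ten v0 v1 u0 u1\<close>.\<close>

definition tangent_form :: "'k \<Rightarrow> 'k \<Rightarrow> 'k \<Rightarrow> 'k \<Rightarrow> 'k ^ 4" where
  "tangent_form v0 v1 u0 u1 = (v0 * u0) *s h11 - (v1 * u0) *s h01 - (v0 * u1) *s h10 + (v1 * u1) *s h00"

text \<open>It suffices that \<open>\<alpha>\<close> lies neither on the quadric nor in the tangent
  plane at a grid point. As an invertible matrix it then identifies the two factors in such a way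
  that it becomes antisymmetric itself.\<close>

lemma general_adapted_frame:
  fixes a :: nat and v0 v1 u0 u1 :: "nat \<Rightarrow> 'k"
  assumes a: "2 \<le> a"
    and v: "\<And>i. i < a \<Longrightarrow> v0 i \<noteq> 0 \<or> v1 i \<noteq> 0" and u: "\<And>j. j < a \<Longrightarrow> u0 j \<noteq> 0 \<or> u1 j \<noteq> 0"
    and vi: "\<And>i k. i < a \<Longrightarrow> k < a \<Longrightarrow> i \<noteq> k \<Longrightarrow> v0 i * v1 k - v1 i * v0 k \<noteq> 0"
    and uj: "\<And>i k. i < a \<Longrightarrow> k < a \<Longrightarrow> i \<noteq> k \<Longrightarrow> u0 i * u1 k - u1 i * u0 k \<noteq> 0"
    and X: "X = {proj_point (ten (v0 i) (v1 i) (u0 j) (u1 j)) | i j. i < a \<and> j < a}"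
  shows "\<exists>G. (\<exists>\<alpha>. poly_eval G \<alpha> \<noteq> 0) \<and> (\<forall>\<alpha>. poly_eval G \<alpha> \<noteq> 0 \<longrightarrow> adapted_frame_at a X \<alpha>)"
proof -
  define D where "D = linear_form h00 * linear_form h11 - linear_form h01 * linear_form h10"
  define N where "N i j = linear_form (tangent_form (v0 i) (v1 i) (u0 j) (u1 j))" for i j
  define P where "P = (\<Prod>ij\<in>{..<a} \<times> {..<a}. N (fst ij) (snd ij))"
  have lf: "poly_eval (linear_form \<xi>) \<alpha> = vdot \<xi> \<alpha>" for \<xi> \<alpha> :: "'k ^ 4"
    by (simp add: poly_eval_linear_form vdot_def)
  have D: "poly_eval D \<alpha> = vdot h00 \<alpha> * vdot h11 \<alpha> - vdot h01 \<alpha> * vdot h10 \<alpha>" for \<alpha>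
    by (simp add: D_def poly_eval_diff poly_eval_mult lf)
  have N: "poly_eval (N i j) \<alpha> = v0 i * u0 j * vdot h11 \<alpha> - v1 i * u0 j * vdot h01 \<alpha> - v0 i * u1 j * vdot h10 \<alpha>
      + v1 i * u1 j * vdot h00 \<alpha>" for i j \<alpha>
    by (simp add: N_def lf tangent_form_def vdot_simps)
  have "\<exists>\<alpha>. poly_eval (N i j) \<alpha> \<noteq> 0" if "i < a" "j < a" for i j
  proof -
    have "poly_eval (N i j) E11 = v0 i * u0 j" "poly_eval (N i j) E01 = - (v1 i * u0 j)"
      "poly_eval (N i j) E10 = - (v0 i * u1 j)" "poly_eval (N i j) E00 = v1 i * u1 j"
      unfolding N by simp_all
    then show ?thesis
      using v[OF that(1)] u[OF that(2)] by (metis mult_eq_0_iff neg_equal_0_iff_equal)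
  qed
  then have "\<exists>\<alpha>. poly_eval P \<alpha> \<noteq> 0"
    unfolding P_def by (intro exists_prod_nonzero) auto
  then obtain \<alpha>1 where \<alpha>1: "poly_eval P \<alpha>1 \<noteq> 0"
    by blast
  have "poly_eval D (E00 + E11) \<noteq> 0"
    unfolding D vdot_add_right by simp
  from exists_common_nonzero[OF this \<alpha>1] have "\<exists>\<alpha>. poly_eval (D * P) \<alpha> \<noteq> 0"
    by (simp add: poly_eval_mult)
  moreover have "adapted_frame_at a X \<alpha>"
    if "poly_eval (D * P) \<alpha> \<noteq> 0" for \<alpha>
  proof -
    define a00 a01 a10 a11 where "a00 = vdot h00 \<alpha>" and "a01 = vdot h01 \<alpha>" and "a10 = vdot h10 \<alpha>" and "a11 = vdot h11 \<alpha>"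
    have det: "a00 * a11 - a01 * a10 \<noteq> 0"
      using that by (simp add: poly_eval_mult D a00_def a01_def a10_def a11_def)
    have tan: "v0 i * u0 j * a11 - v1 i * u0 j * a01 - v0 i * u1 j * a10 + v1 i * u1 j * a00 \<noteq> 0"
      if ij: "i < a" "j < a" for i j
    proof -
      have "\<forall>ij\<in>{..<a} \<times> {..<a}. poly_eval (N (fst ij) (snd ij)) \<alpha> \<noteq> 0"
        using that \<open>poly_eval (D * P) \<alpha> \<noteq> 0\<close> by (simp add: poly_eval_mult P_def poly_eval_prod)
      then have "poly_eval (N i j) \<alpha> \<noteq> 0"
        using ij by fastforce
      then show ?thesis
        unfolding N a00_def a01_def a10_def a11_def .
    qed
    have fin: "finite {c. x - c * y = 0}" if "x \<noteq> 0 \<or> y \<noteq> 0" for x y :: 'k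
    proof (cases "y = 0")
      case True
      with that show ?thesis
        by simp
    next
      case False
      then have "{c. x - c * y = 0} \<subseteq> {x / y}"
        by (auto simp: field_simps)
      then show ?thesis
        by (rule finite_subset) simp
    qed
    let ?x = "\<lambda>i. v0 i * a10 - v1 i * a00" and ?y = "\<lambda>i. v0 i * a11 - v1 i * a01"
    have xy: "?x i \<noteq> 0 \<or> ?y i \<noteq> 0" if "i < a" for i
    proof (rule ccontr)
      assume "\<not> ?thesis"
      then have eq: "v0 i * a10 = v1 i * a00" "v0 i * a11 = v1 i * a01"
        by simp_all
      have "v0 i * (a00 * a11 - a01 * a10) = a00 * (v0 i * a11) - a01 * (v0 i * a10)"
        by (simp add: algebra_simps)
      also have "\<dots> = 0"
        unfolding eq by (simp add: algebra_simps)
      finally have "v0 i = 0"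
        using det by simp
      then have "v1 i * a00 = 0" "v1 i * a01 = 0"
        using eq by simp_all
      then have "v1 i * (a00 * a11 - a01 * a10) = 0"
        by auto
      then show False
        using det v[OF that] \<open>v0 i = 0\<close> by simp
    qed
    \<comment> \<open>The basis vector \<open>(c, 1)\<close> of the right factor is still free; all
      but finitely many \<open>c\<close> keep the grid off infinity.\<close>
    let ?F = "(\<Union>j<a. {c. u0 j - c * u1 j = 0}) \<union> (\<Union>i<a. {c. ?x i - c * ?y i = 0})"
    have "finite ?F"
      using fin u xy by simp
    then obtain c where c: "c \<notin> ?F"
      using ex_new_if_finite[OF infinite_UNIV_char_0] by blast
    have cu: "u0 j - c * u1 j \<noteq> 0" if "j < a" for j
      using c that by blast
    have cv: "v0 i * (a10 - c * a11) - v1 i * (a00 - c * a01) \<noteq> 0" if "i < a" for i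
    proof -
      have "?x i - c * ?y i \<noteq> 0"
        using c that by blast
      then show ?thesis
        by (simp add: algebra_simps)
    qed
    \<comment> \<open>For a given \<open>c\<close>, the equation
      \<open>\<alpha> = q \<otimes> (1, 0) - p \<otimes> (c, 1)\<close> determines \<open>p\<close>
      and \<open>q\<close>, and their determinant is that of \<open>\<alpha>\<close>.\<close>
    let ?e00 = "ten (- a01) (- a11) 1 0" and ?e10 = "ten (a00 - c * a01) (a10 - c * a11) 1 0"
      and ?e01 = "ten (- a01) (- a11) c 1" and ?e11 = "ten (a00 - c * a01) (a10 - c * a11) c 1"
    have "\<exists>f00 f10 f01 f11 r s. grid_frame a ?e00 ?e10 ?e01 ?e11 f00 f10 f01 f11 r s \<and>
      (\<forall>i<a. \<forall>j<a. \<exists>k. k \<noteq> 0 \<and> grid_frame.pt ?e00 ?e10 ?e01 ?e11 (r i) (s j) = k *s ten (v0 i) (v1 i) (u0 j) (u1 j))"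
    proof (rule adapted_frame[OF a _ det])
      show "a00 * a11 - a01 * a10 = - a01 * (a10 - c * a11) - - a11 * (a00 - c * a01)"
        by (simp add: algebra_simps)
      show "(- a01 * v1 i - - a11 * v0 i) * (u0 j - c * u1 j) - u1 j * (v0 i * (a10 - c * a11) - v1 i * (a00 - c * a01)) \<noteq> 0"
        if "i < a" "j < a" for i j
        using tan[OF that] by (simp add: algebra_simps)
    qed (use cu cv vi uj in blast)+
    then obtain f00 f10 f01 f11 r s where frame: "grid_frame a ?e00 ?e10 ?e01 ?e11 f00 f10 f01 f11 r s"
      and pt: "\<And>i j. i < a \<Longrightarrow> j < a \<Longrightarrow> \<exists>k. k \<noteq> 0 \<and>
        grid_frame.pt ?e00 ?e10 ?e01 ?e11 (r i) (s j) = k *s ten (v0 i) (v1 i) (u0 j) (u1 j)"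
      by blast
    have "\<alpha> = ?e10 - ?e01"
      by (rule eqI) (simp_all only: vdot_diff_right vdot_ten a00_def a01_def a10_def a11_def, simp_all)
    moreover have "proj_point (ten (v0 i) (v1 i) (u0 j) (u1 j)) = proj_point (grid_frame.pt ?e00 ?e10 ?e01 ?e11 (r i) (s j))"
      if ij: "i < a" "j < a" for i j
    proof -
      obtain k where "k \<noteq> 0" "grid_frame.pt ?e00 ?e10 ?e01 ?e11 (r i) (s j) = k *s ten (v0 i) (v1 i) (u0 j) (u1 j)"
        using pt[OF ij] by blast
      then show ?thesis
        by (simp add: proj_point_scale)
    qed
    then have "X = {proj_point (grid_frame.pt ?e00 ?e10 ?e01 ?e11 (r i) (s j)) | i j. i < a \<and> j < a}"
      unfolding X by (intro Collect_cong) metis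
    ultimately show ?thesis
      using frame by blast
  qed
  ultimately show ?thesis
    by (intro exI[of _ "D * P"]) blast
qed

end

subsection \<open>Lines on a smooth quadric\<close>

definition gradient :: "'k::field poly4 \<Rightarrow> 'k ^ 4 \<Rightarrow> 'k ^ 4" where
  "gradient q w = (\<chi> i. poly_eval (partial_deriv i q) w)"

lemma quadratic_form_coefficients:
  assumes "q \<in> forms 2"
  obtains Q where "\<And>v. poly_eval q v = (\<Sum>i\<in>UNIV. \<Sum>j\<in>UNIV. Q i j * v $ i * v $ j)"
    and "\<And>v k. poly_eval (partial_deriv k q) v = (\<Sum>j\<in>UNIV. Q k j * v $ j) + (\<Sum>i\<in>UNIV. Q i k * v $ i)"
proof -
  have "q \<in> forms (Suc 1)"
    using assms by (simp add: numeral_2_eq_2)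
  then obtain g where g: "\<And>i. g i \<in> forms 1" "q = (\<Sum>i\<in>UNIV. var i * g i)"
    using forms_Suc_decompose by blast
  have "\<exists>Q. g i = (\<Sum>j\<in>UNIV. var j * cst (Q j))" for i
  proof -
    have "g i \<in> forms (Suc 0)"
      using g(1)[of i] by simp
    then obtain h where h: "\<And>j. h j \<in> forms 0" "g i = (\<Sum>j\<in>UNIV. var j * h j)"
      using forms_Suc_decompose by blast
    have "\<forall>j. \<exists>c. h j = cst c"
      using forms_0_cst[OF h(1)] by (rule allI)
    from choice[OF this] obtain c where "\<forall>j. h j = cst (c j)"
      by (rule exE)
    then have "g i = (\<Sum>j\<in>UNIV. var j * cst (c j))"
      unfolding h(2) by (simp only: )
    then show ?thesis
      by (rule exI[of _ c])
  qed
  then have "\<forall>i. \<exists>Q. g i = (\<Sum>j\<in>UNIV. var j * cst (Q j))"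
    by (rule allI)
  from choice[OF this] obtain Q where "\<forall>i. g i = (\<Sum>j\<in>UNIV. var j * cst (Q i j))"
    by (rule exE)
  then have Q: "g i = (\<Sum>j\<in>UNIV. var j * cst (Q i j))" for i
    by (rule spec)
  show ?thesis
  proof (rule that[of Q])
    show "poly_eval q v = (\<Sum>i\<in>UNIV. \<Sum>j\<in>UNIV. Q i j * v $ i * v $ j)" for v
      unfolding g(2) Q poly_eval_sum poly_eval_mult poly_eval_var poly_eval_cst sum_distrib_left
      by (simp only: mult_ac)
    have dg: "partial_deriv k (g i) = cst (Q i k)" for i k
    proof -
      have "partial_deriv k (var j * cst (Q i j)) = (if j = k then cst (Q i j) else 0)" for j
        by (simp add: partial_deriv_mult partial_deriv_var)
      then show ?thesis
        unfolding Q partial_deriv_sum by simp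
    qed
    have "partial_deriv k (var i * g i) = (if i = k then g i else 0) + var i * cst (Q i k)" for i k
      by (simp add: partial_deriv_mult partial_deriv_var dg)
    then have dq: "partial_deriv k q = g k + (\<Sum>i\<in>UNIV. var i * cst (Q i k))" for k
      unfolding g(2) partial_deriv_sum by (simp add: sum.distrib)
    show "poly_eval (partial_deriv k q) v = (\<Sum>j\<in>UNIV. Q k j * v $ j) + (\<Sum>i\<in>UNIV. Q i k * v $ i)" for v k
      unfolding dq Q poly_eval_add poly_eval_sum poly_eval_mult poly_eval_var poly_eval_cst
      by (simp only: mult.commute)
  qed
qed

text \<open>\<open>vdot (gradient q w) v\<close> is the polar form of \<open>q\<close>, which
  translates the Jacobian criterion into orthogonality.\<close>

lemma quadratic_form_polar:
  assumes "q \<in> forms 2"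
  shows "poly_eval q (v + w) = poly_eval q v + poly_eval q w + vdot (gradient q w) v"
    and "poly_eval q (c *s v) = c ^ 2 * poly_eval q v"
    and "vdot (gradient q w) v = vdot (gradient q v) w"
proof -
  obtain Q where Q: "\<And>v. poly_eval q v = (\<Sum>i\<in>UNIV. \<Sum>j\<in>UNIV. Q i j * v $ i * v $ j)"
    "\<And>v k. poly_eval (partial_deriv k q) v = (\<Sum>j\<in>UNIV. Q k j * v $ j) + (\<Sum>i\<in>UNIV. Q i k * v $ i)"
    by (rule quadratic_form_coefficients[OF assms]) blast
  have grad: "vdot (gradient q w) v = (\<Sum>i\<in>UNIV. \<Sum>j\<in>UNIV. Q i j * v $ i * w $ j)
      + (\<Sum>i\<in>UNIV. \<Sum>j\<in>UNIV. Q i j * w $ i * v $ j)" for v w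
  proof -
    have "vdot (gradient q w) v
        = (\<Sum>k\<in>UNIV. ((\<Sum>j\<in>UNIV. Q k j * w $ j) + (\<Sum>i\<in>UNIV. Q i k * w $ i)) * v $ k)"
      by (simp only: vdot_def gradient_def Q(2) vec_lambda_beta)
    also have "\<dots> = (\<Sum>k\<in>UNIV. \<Sum>j\<in>UNIV. Q k j * w $ j * v $ k) + (\<Sum>k\<in>UNIV. \<Sum>i\<in>UNIV. Q i k * w $ i * v $ k)"
      by (simp only: distrib_right sum.distrib sum_distrib_right)
    also have "(\<Sum>k\<in>UNIV. \<Sum>i\<in>UNIV. Q i k * w $ i * v $ k) = (\<Sum>i\<in>UNIV. \<Sum>k\<in>UNIV. Q i k * w $ i * v $ k)"
      by (rule sum.swap)
    also have "(\<Sum>k\<in>UNIV. \<Sum>j\<in>UNIV. Q k j * w $ j * v $ k) = (\<Sum>k\<in>UNIV. \<Sum>j\<in>UNIV. Q k j * v $ k * w $ j)"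
      by (intro sum.cong refl) (simp only: mult_ac)
    finally show ?thesis .
  qed
  have "Q i j * (v + w) $ i * (v + w) $ j = Q i j * v $ i * v $ j + Q i j * w $ i * w $ j
      + (Q i j * v $ i * w $ j + Q i j * w $ i * v $ j)" for i j
    by (simp add: algebra_simps)
  then show "poly_eval q (v + w) = poly_eval q v + poly_eval q w + vdot (gradient q w) v"
    unfolding Q(1) grad by (simp only: sum.distrib)
  have "Q i j * (c *s v) $ i * (c *s v) $ j = c ^ 2 * (Q i j * v $ i * v $ j)" for i j
    by (simp add: power2_eq_square mult_ac)
  then show "poly_eval q (c *s v) = c ^ 2 * poly_eval q v"
    unfolding Q(1) by (simp only: sum_distrib_left)
  show "vdot (gradient q w) v = vdot (gradient q v) w"
    unfolding grad by (rule add.commute)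
qed

lemma span_pair: "x \<in> vec.span {b1, b2} \<longleftrightarrow> (\<exists>y z. x = y *s b1 + z *s b2)"
proof -
  have "x \<in> vec.span {b1, b2} \<longleftrightarrow> (\<exists>y z. x - y *s b1 = z *s b2)"
    unfolding vec.span_breakdown_eq[of x b1] vec.span_singleton by auto
  also have "\<dots> \<longleftrightarrow> (\<exists>y z. x = y *s b1 + z *s b2)"
    by (simp only: diff_eq_eq add.commute)
  finally show ?thesis .
qed

lemma two_dim_basis:
  fixes W :: "('k::field ^ 4) set"
  assumes "vec.subspace W" and "vec.dim W = 2"
  obtains b1 b2 where "\<And>x. x \<in> W \<longleftrightarrow> (\<exists>y z. x = y *s b1 + z *s b2)"
    and "\<And>y z. y *s b1 + z *s b2 = 0 \<Longrightarrow> y = 0 \<and> z = 0"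
proof -
  obtain B where B: "B \<subseteq> W" "vec.independent B" "W \<subseteq> vec.span B" "card B = vec.dim W"
    using vec.basis_exists by blast
  then obtain b1 b2 where b: "B = {b1, b2}" "b1 \<noteq> b2"
    using assms(2) by (auto simp: card_2_iff)
  have span: "vec.span {b1, b2} = W"
    using B assms(1) unfolding b(1) by (intro vec.span_subspace) auto
  have "x \<in> W \<longleftrightarrow> (\<exists>y z. x = y *s b1 + z *s b2)" for x
    unfolding span[symmetric] by (rule span_pair)
  moreover have "y = 0 \<and> z = 0" if eq: "y *s b1 + z *s b2 = 0" for y z
  proof -
    have ind: "b1 \<notin> vec.span {b2}" "b2 \<noteq> 0"
      using B(2) b(2) unfolding b(1) by (auto simp: vec.independent_insert)
    have "y = 0"
    proof (rule ccontr)
      assume "y \<noteq> 0"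
      have "y *s b1 = (- z) *s b2"
        using eq by (simp add: add_eq_0_iff)
      then have "(1 / y) *s (y *s b1) = (1 / y) *s ((- z) *s b2)"
        by simp
      then have "b1 = (- z / y) *s b2"
        using \<open>y \<noteq> 0\<close> by simp
      then have "b1 \<in> vec.span {b2}"
        unfolding vec.span_singleton by (rule range_eqI)
      with ind(1) show False
        by simp
    qed
    moreover from this have "z = 0"
      using eq ind(2) by simp
    ultimately show ?thesis
      by simp
  qed
  ultimately show ?thesis
    by (rule that)
qed

definition line_of :: "('k::field ^ 4) set \<Rightarrow> ('k ^ 4) set set" where
  "line_of W = {p \<in> proj_space. p \<subseteq> W}"

lemma proj_point_in_line_of:
  assumes "vec.subspace W" and "v \<noteq> 0"
  shows "proj_point v \<in> line_of W \<longleftrightarrow> v \<in> W"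
proof -
  have "proj_point v \<subseteq> W \<longleftrightarrow> v \<in> W"
    unfolding proj_point_def using vec.span_minimal[of "{v}" W] vec.span_base[of v "{v}"] assms(1) by blast
  moreover have "proj_point v \<in> proj_space"
    unfolding proj_space_def using assms(2) by blast
  ultimately show ?thesis
    by (simp add: line_of_def)
qed

lemma line_on_quadric:
  assumes q: "q \<in> forms 2" and Q: "Q = {proj_point v | v. v \<noteq> 0 \<and> poly_eval q v = 0}"
    and L: "proj_line L" "L \<subseteq> Q"
  obtains W where "vec.subspace W" and "vec.dim W = 2" and "L = line_of W" and "\<And>w. w \<in> W \<Longrightarrow> poly_eval q w = 0"
proof -
  obtain W where W: "vec.subspace W" "vec.dim W = 2" "L = line_of W"
    using L(1) unfolding proj_line_def line_of_def by blast
  moreover have "poly_eval q w = 0" if "w \<in> W" for w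
  proof (cases "w = 0")
    case True
    then show ?thesis
      using quadratic_form_polar(2)[OF q, of 0 w] by simp
  next
    case False
    then have "proj_point w \<in> Q"
      using that L(2) proj_point_in_line_of[OF W(1) False] W(3) by blast
    then obtain v where v: "proj_point w = proj_point v" "poly_eval q v = 0"
      unfolding Q by blast
    then have "w \<in> vec.span {v}"
      using vec.span_base[of w "{w}"] by (simp add: proj_point_def)
    then obtain c where "w = c *s v"
      by (auto simp: vec.span_singleton)
    then show ?thesis
      using quadratic_form_polar(2)[OF q] v(2) by simp
  qed
  ultimately show ?thesis
    by (rule that)
qed

lemma complementary_planes:
  fixes W1 W2 :: "('k::field ^ 4) set"
  assumes "vec.subspace W1" "vec.dim W1 = 2" and "vec.subspace W2" "vec.dim W2 = 2" and "W1 \<inter> W2 = {0}"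
  shows "\<exists>x\<in>W1. \<exists>y\<in>W2. \<alpha> = x + y"
proof -
  let ?S = "{x + y | x y. x \<in> W1 \<and> y \<in> W2}"
  have "vec.dim ?S + vec.dim (W1 \<inter> W2) = 4"
    using vec.dim_sums_Int[OF assms(1,3)] assms(2,4) by simp
  then have "vec.dim ?S = 4"
    unfolding assms(5) by simp
  moreover have "vec.subspace ?S"
    by (rule vec.subspace_sums[OF assms(1,3)])
  ultimately have "?S = UNIV"
    by (intro vec.subspace_dim_equal) (simp_all add: card_cart_basis)
  then show ?thesis
    by blast
qed

text \<open>The polar form vanishes on each plane. A nonzero vector of \<open>W1\<close> orthogonal
  to \<open>W2\<close> would be orthogonal to the whole space and hence singular, so the planes are
  dual to each other. Dual bases, with one sign changed, turn \<open>q\<close> into the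
  determinant.\<close>

lemma tensor_frame_of_skew_lines:
  fixes q :: "'k::field_char_0 poly4"
  assumes q: "q \<in> forms 2" and smooth: "\<And>v. v \<noteq> 0 \<Longrightarrow> poly_eval q v = 0 \<Longrightarrow> gradient q v \<noteq> 0"
    and W1: "vec.subspace W1" "vec.dim W1 = 2" "\<And>w. w \<in> W1 \<Longrightarrow> poly_eval q w = 0"
    and W2: "vec.subspace W2" "vec.dim W2 = 2" "\<And>w. w \<in> W2 \<Longrightarrow> poly_eval q w = 0"
    and disj: "W1 \<inter> W2 = {0}"
  shows "\<exists>E00 E01 E10 E11 h00 h01 h10 h11. tensor_frame E00 E01 E10 E11 h00 h01 h10 h11 \<and>
    W1 = {y *s E00 + z *s E01 | y z. True} \<and>
    (\<forall>\<alpha>. poly_eval q \<alpha> = vdot h00 \<alpha> * vdot h11 \<alpha> - vdot h01 \<alpha> * vdot h10 \<alpha>)"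
proof -
  define B where "B x y = vdot (gradient q y) x" for x y
  have B_sym: "B x y = B y x" for x y
    unfolding B_def by (rule quadratic_form_polar(3)[OF q])
  have B_left: "B (x + x') y = B x y + B x' y" "B (c *s x) y = c * B x y" for x x' y c
    by (simp_all add: B_def vdot_simps)
  have B_right: "B x (y + y') = B x y + B x y'" "B x (c *s y) = c * B x y" for x y y' c
    using B_left B_sym by metis+
  have q_add: "poly_eval q (x + y) = poly_eval q x + poly_eval q y + B x y" for x y
    unfolding B_def by (rule quadratic_form_polar(1)[OF q])
  have iso: "B x y = 0" if "\<And>w. w \<in> W \<Longrightarrow> poly_eval q w = 0" "vec.subspace W" "x \<in> W" "y \<in> W" for W x y
    using q_add[of x y] that vec.subspace_add[OF that(2-4)] by simp
  obtain a1 a2 where a: "\<And>x. x \<in> W1 \<longleftrightarrow> (\<exists>y z. x = y *s a1 + z *s a2)"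
    "\<And>y z. y *s a1 + z *s a2 = 0 \<Longrightarrow> y = 0 \<and> z = 0"
    by (rule two_dim_basis[OF W1(1,2)]) blast
  obtain c1 c2 where c: "\<And>x. x \<in> W2 \<longleftrightarrow> (\<exists>y z. x = y *s c1 + z *s c2)"
    by (rule two_dim_basis[OF W2(1,2)]) blast
  have "a1 = 1 *s a1 + 0 *s a2" "a2 = 0 *s a1 + 1 *s a2" "c1 = 1 *s c1 + 0 *s c2" "c2 = 0 *s c1 + 1 *s c2"
    by simp_all
  then have mem: "a1 \<in> W1" "a2 \<in> W1" "c1 \<in> W2" "c2 \<in> W2"
    unfolding a(1) c by blast+
  define M00 M01 M10 M11 where "M00 = B a1 c1" and "M01 = B a1 c2" and "M10 = B a2 c1" and "M11 = B a2 c2"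
  define D where "D = M00 * M11 - M01 * M10"
  have D: "D \<noteq> 0"
  proof
    assume "D = 0"
    \<comment> \<open>A kernel vector of the singular 2 x 2 matrix of the pairing.\<close>
    have "\<exists>x y. (x \<noteq> 0 \<or> y \<noteq> 0) \<and> x * M00 + y * M10 = 0 \<and> x * M01 + y * M11 = 0"
    proof (cases "M00 = 0 \<and> M10 = 0")
      case False
      then show ?thesis
        using \<open>D = 0\<close> by (intro exI[of _ M10] exI[of _ "- M00"]) (auto simp: D_def mult_ac)
    next
      case True
      show ?thesis
      proof (cases "M01 = 0 \<and> M11 = 0")
        case False
        with True show ?thesis
          by (intro exI[of _ M11] exI[of _ "- M01"]) (auto simp: mult_ac)
      next
        case True': True
        with True show ?thesis
          by (intro exI[of _ 1] exI[of _ 0]) simp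
      qed
    qed
    then obtain x y where xy: "x \<noteq> 0 \<or> y \<noteq> 0" "x * M00 + y * M10 = 0" "x * M01 + y * M11 = 0"
      by blast
    define w where "w = x *s a1 + y *s a2"
    have w: "w \<noteq> 0" "w \<in> W1"
      using a(2)[of x y] xy(1) a(1) by (auto simp: w_def)
    have "B w c1 = 0" "B w c2 = 0"
      using xy(2,3) by (simp_all add: w_def B_left M00_def M01_def M10_def M11_def)
    then have "B w z = 0" if "z \<in> W2" for z
      using that c by (auto simp: B_right)
    moreover have "B w z = 0" if "z \<in> W1" for z
      using iso[OF W1(3,1) w(2) that] .
    ultimately have "B w \<alpha> = 0" for \<alpha>
      using complementary_planes[OF W1(1,2) W2(1,2) disj, of \<alpha>] by (auto simp: B_right)
    then have "vdot (gradient q w) \<alpha> = 0" for \<alpha>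
      using B_sym unfolding B_def by metis
    from this[of "axis _ 1"] have "gradient q w $ i = 0" for i
      by (simp add: vdot_def axis_def if_distrib cong: if_cong)
    then have "gradient q w = 0"
      by (simp add: vec_eq_iff)
    then show False
      using smooth[OF w(1) W1(3)[OF w(2)]] by simp
  qed
  \<comment> \<open>Cramer's rule for the values in \<open>BE\<close>; the value \<open>- 1\<close>
    there produces the minus sign of the determinant.\<close>
  define E10 where "E10 = (1 / D) *s (M01 *s c1 + (- M00) *s c2)"
  define E11 where "E11 = (1 / D) *s (M11 *s c1 + (- M10) *s c2)"
  have E_mem: "E10 \<in> W2" "E11 \<in> W2"
    unfolding E10_def E11_def using c by (intro vec.subspace_scale[OF W2(1)], blast)+
  have BE: "B a1 E11 = 1" "B a2 E11 = 0" "B a1 E10 = 0" "B a2 E10 = - 1"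
    using D unfolding E10_def E11_def B_right M00_def[symmetric] M01_def[symmetric] M10_def[symmetric] M11_def[symmetric]
    by (simp_all add: divide_simps) (simp_all add: D_def algebra_simps)
  have c_E: "c1 = M00 *s E11 + (- M10) *s E10" "c2 = M01 *s E11 + (- M11) *s E10"
  proof -
    have eq: "x *s E11 + (- y) *s E10 = ((x * M11 - y * M01) / D) *s c1 + ((y * M00 - x * M10) / D) *s c2" for x y
      by (simp add: E10_def E11_def vec_eq_iff diff_divide_distrib algebra_simps)
    have "(M00 * M11 - M10 * M01) / D = 1" "(M01 * M11 - M11 * M01) / D = 0" "(M10 * M00 - M00 * M10) / D = 0"
      "(M11 * M00 - M01 * M10) / D = 1"
      using D by (simp_all add: D_def mult_ac)
    then show "c1 = M00 *s E11 + (- M10) *s E10" "c2 = M01 *s E11 + (- M11) *s E10"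
      unfolding eq by simp_all
  qed
  have zero: "B a1 a1 = 0" "B a1 a2 = 0" "B a2 a1 = 0" "B a2 a2 = 0" "B E10 E10 = 0" "B E10 E11 = 0"
    "B E11 E10 = 0" "B E11 E11 = 0"
    using iso[OF W1(3,1)] iso[OF W2(3,1)] mem E_mem by blast+
  have BE': "B E11 a1 = 1" "B E11 a2 = 0" "B E10 a1 = 0" "B E10 a2 = - 1"
    using BE B_sym by metis+
  define h00 h01 h10 h11 where "h00 = gradient q E11" and "h01 = - gradient q E10" and "h10 = - gradient q a2"
    and "h11 = gradient q a1"
  have ev: "vdot h00 \<alpha> = B \<alpha> E11" "vdot h01 \<alpha> = - B \<alpha> E10" "vdot h10 \<alpha> = - B \<alpha> a2" "vdot h11 \<alpha> = B \<alpha> a1" for \<alpha>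
    by (simp_all add: h00_def h01_def h10_def h11_def B_def vdot_minus_left)
  have ex: "\<exists>x y z t. \<alpha> = x *s a1 + y *s a2 + z *s E10 + t *s E11" for \<alpha>
  proof -
    obtain w1 w2 where w: "w1 \<in> W1" "w2 \<in> W2" "\<alpha> = w1 + w2"
      using complementary_planes[OF W1(1,2) W2(1,2) disj, of \<alpha>] by blast
    obtain x y where xy: "w1 = x *s a1 + y *s a2"
      using w(1) a(1) by blast
    obtain z t where "w2 = z *s c1 + t *s c2"
      using w(2) c by blast
    then have "w2 = (- z * M10 - t * M11) *s E10 + (z * M00 + t * M01) *s E11"
      using c_E by (simp add: vec_eq_iff algebra_simps)
    then show ?thesis
      using w(3) xy by (metis add.assoc)
  qed
  have "tensor_frame a1 a2 E10 E11 h00 h01 h10 h11"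
  proof
    fix \<alpha>
    obtain x y z t where \<alpha>: "\<alpha> = x *s a1 + y *s a2 + z *s E10 + t *s E11"
      using ex by blast
    have "B \<alpha> E11 = x" "- B \<alpha> E10 = y" "- B \<alpha> a2 = z" "B \<alpha> a1 = t"
      unfolding \<alpha> B_left BE BE' zero by simp_all
    then show "\<alpha> = vdot h00 \<alpha> *s a1 + vdot h01 \<alpha> *s a2 + vdot h10 \<alpha> *s E10 + vdot h11 \<alpha> *s E11"
      unfolding ev using \<alpha> by simp
  qed (simp_all add: ev BE BE' zero)
  moreover have "W1 = {y *s a1 + z *s a2 | y z. True}"
    using a(1) by blast
  moreover have "poly_eval q \<alpha> = vdot h00 \<alpha> * vdot h11 \<alpha> - vdot h01 \<alpha> * vdot h10 \<alpha>" for \<alpha>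
  proof -
    obtain x y z t where \<alpha>: "\<alpha> = x *s a1 + y *s a2 + z *s E10 + t *s E11"
      using ex by blast
    have m1: "x *s a1 + y *s a2 \<in> W1"
      using a(1) by blast
    have m2: "z *s E10 + t *s E11 \<in> W2"
      using E_mem by (intro vec.subspace_add[OF W2(1)] vec.subspace_scale[OF W2(1)])
    have "poly_eval q ((x *s a1 + y *s a2) + (z *s E10 + t *s E11))
        = B (x *s a1 + y *s a2) (z *s E10 + t *s E11)"
      unfolding q_add[of "x *s a1 + y *s a2"] W1(3)[OF m1] W2(3)[OF m2] by simp
    also have "\<dots> = x * t - y * z"
      unfolding B_left B_right BE by (simp add: mult_ac)
    finally have "poly_eval q \<alpha> = x * t - y * z"
      unfolding \<alpha> by (simp only: add.assoc)
    moreover have "B \<alpha> E11 = x" "- B \<alpha> E10 = y" "- B \<alpha> a2 = z" "B \<alpha> a1 = t"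
      unfolding \<alpha> B_left BE BE' zero by simp_all
    ultimately show ?thesis
      unfolding ev by simp
  qed
  ultimately show ?thesis
    by blast
qed

lemma proportional_pairs:
  fixes v0 v1 w0 w1 :: "'k::field"
  assumes "v0 * w1 - v1 * w0 = 0" and "v0 \<noteq> 0 \<or> v1 \<noteq> 0" and "w0 \<noteq> 0 \<or> w1 \<noteq> 0"
  shows "\<exists>k. k \<noteq> 0 \<and> v0 = k * w0 \<and> v1 = k * w1"
proof (cases "w0 = 0")
  case True
  with assms show ?thesis
    by (intro exI[of _ "v1 / w1"]) auto
next
  case False
  have "v1 * w0 = v0 * w1"
    using assms(1) by simp
  then have v1: "v1 = (v0 / w0) * w1"
    using False by (simp add: divide_simps)
  moreover have "v0 \<noteq> 0"
    using assms(2) v1 by auto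
  ultimately show ?thesis
    using False by (intro exI[of _ "v0 / w0"]) simp
qed

section \<open>The two families of lines on the quadric of pure tensors\<close>

context tensor_frame
begin

definition T1 :: "'k \<Rightarrow> 'k \<Rightarrow> ('k ^ 4) set" where
  "T1 v0 v1 = {ten v0 v1 u0 u1 | u0 u1. True}"

definition T2 :: "'k \<Rightarrow> 'k \<Rightarrow> ('k ^ 4) set" where
  "T2 u0 u1 = {ten v0 v1 u0 u1 | v0 v1. True}"

lemma ten_eq_0_iff: "ten v0 v1 u0 u1 = 0 \<longleftrightarrow> (v0 = 0 \<and> v1 = 0) \<or> (u0 = 0 \<and> u1 = 0)"
proof
  assume eq: "ten v0 v1 u0 u1 = 0"
  have "vdot \<xi> 0 = 0" for \<xi> :: "'k ^ 4"
    by (simp add: vdot_def)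
  note vdot_ten[of v0 v1 u0 u1, unfolded eq this]
  then show "(v0 = 0 \<and> v1 = 0) \<or> (u0 = 0 \<and> u1 = 0)"
    by auto
qed (auto simp: ten_def)

lemma ten_scale: "ten (k * v0) (k * v1) u0 u1 = k *s ten v0 v1 u0 u1" "ten v0 v1 (k * u0) (k * u1) = k *s ten v0 v1 u0 u1"
  by (rule eqI; simp add: vdot_scale_right)+

lemma T1_span: "T1 v0 v1 = vec.span {ten v0 v1 1 0, ten v0 v1 0 1}"
proof (intro set_eqI iffI)
  have eq: "ten v0 v1 u0 u1 = u0 *s ten v0 v1 1 0 + u1 *s ten v0 v1 0 1" for u0 u1
    by (rule eqI) (simp_all add: vdot_simps)
  show "x \<in> vec.span {ten v0 v1 1 0, ten v0 v1 0 1}" if "x \<in> T1 v0 v1" for x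
    using that eq unfolding span_pair T1_def by blast
  show "x \<in> T1 v0 v1" if "x \<in> vec.span {ten v0 v1 1 0, ten v0 v1 0 1}" for x
    using that eq[symmetric] unfolding span_pair T1_def by auto
qed

lemma T2_span: "T2 u0 u1 = vec.span {ten 1 0 u0 u1, ten 0 1 u0 u1}"
proof (intro set_eqI iffI)
  have eq: "ten v0 v1 u0 u1 = v0 *s ten 1 0 u0 u1 + v1 *s ten 0 1 u0 u1" for v0 v1
    by (rule eqI) (simp_all add: vdot_simps)
  show "x \<in> vec.span {ten 1 0 u0 u1, ten 0 1 u0 u1}" if "x \<in> T2 u0 u1" for x
    using that eq unfolding span_pair T2_def by blast
  show "x \<in> T2 u0 u1" if "x \<in> vec.span {ten 1 0 u0 u1, ten 0 1 u0 u1}" for x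
    using that eq[symmetric] unfolding span_pair T2_def by auto
qed

lemma subspace_T: "vec.subspace (T1 v0 v1)" "vec.subspace (T2 u0 u1)"
  unfolding T1_span T2_span by (rule vec.subspace_span)+

lemma dim_T: "vec.dim (T1 v0 v1) \<le> 2" "vec.dim (T2 u0 u1) \<le> 2"
proof -
  have "vec.dim (vec.span {x, y}) \<le> 2" for x y :: "'k ^ 4"
    using vec.dim_le_card[of "vec.span {x, y}" "{x, y}"] card_insert_le_m1[of 2 "{y}" x] by simp
  then show "vec.dim (T1 v0 v1) \<le> 2" "vec.dim (T2 u0 u1) \<le> 2"
    unfolding T1_span T2_span by blast+
qed

lemma rank_one:
  assumes "det2 z = 0"
  shows "\<exists>v0 v1 u0 u1. z = ten v0 v1 u0 u1"
proof -
  define x00 x01 x10 x11 where "x00 = vdot h00 z" and "x01 = vdot h01 z" and "x10 = vdot h10 z" and "x11 = vdot h11 z"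
  have det: "x00 * x11 = x01 * x10"
    using assms by (simp add: det2_def x00_def x01_def x10_def x11_def)
  have z: "z = ten v0 v1 u0 u1" if "v0 * u0 = x00" "v0 * u1 = x01" "v1 * u0 = x10" "v1 * u1 = x11" for v0 v1 u0 u1
    using that by (intro eqI) (simp_all add: x00_def x01_def x10_def x11_def)
  consider "x00 \<noteq> 0" | "x00 = 0" "x01 \<noteq> 0" | "x00 = 0" "x01 = 0"
    by blast
  then show ?thesis
  proof cases
    case 1
    then have "z = ten 1 (x10 / x00) x00 x01"
      using det by (intro z) (simp_all add: divide_simps mult_ac)
    then show ?thesis
      by blast
  next
    case 2
    then have "z = ten 1 (x11 / x01) x00 x01"
      using det by (intro z) (simp_all add: divide_simps mult_ac)
    then show ?thesis
      by blast
  next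
    case 3
    then have "z = ten 0 1 x10 x11"
      by (intro z) simp_all
    then show ?thesis
      by blast
  qed
qed

text \<open>The basis vectors are pure tensors \<open>v \<otimes> u\<close> and
  \<open>w \<otimes> t\<close>, and the determinant of their sum is
  \<open>det(v, w) det(u, t)\<close>. As it vanishes, they share a factor up to a scalar.\<close>

lemma isotropic_plane:
  assumes W: "vec.subspace W" "vec.dim W = 2" and iso: "\<And>w. w \<in> W \<Longrightarrow> det2 w = 0"
  shows "(\<exists>v0 v1. (v0 \<noteq> 0 \<or> v1 \<noteq> 0) \<and> W = T1 v0 v1) \<or> (\<exists>u0 u1. (u0 \<noteq> 0 \<or> u1 \<noteq> 0) \<and> W = T2 u0 u1)"
proof -
  obtain b1 b2 where b: "\<And>x. x \<in> W \<longleftrightarrow> (\<exists>y z. x = y *s b1 + z *s b2)"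
    "\<And>y z. y *s b1 + z *s b2 = 0 \<Longrightarrow> y = 0 \<and> z = 0"
    by (rule two_dim_basis[OF W]) blast
  have mem: "b1 \<in> W" "b2 \<in> W" "b1 + b2 \<in> W"
  proof -
    have "b1 = 1 *s b1 + 0 *s b2" "b2 = 0 *s b1 + 1 *s b2" "b1 + b2 = 1 *s b1 + 1 *s b2"
      by simp_all
    then show "b1 \<in> W" "b2 \<in> W" "b1 + b2 \<in> W"
      unfolding b(1) by blast+
  qed
  have sub: "W \<subseteq> S" if "vec.subspace S" "b1 \<in> S" "b2 \<in> S" for S
  proof
    fix x assume "x \<in> W"
    then obtain y z where "x = y *s b1 + z *s b2"
      using b(1) by blast
    then show "x \<in> S"
      using that by (simp add: vec.subspace_add vec.subspace_scale)
  qed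
  have nz: "b1 \<noteq> 0" "b2 \<noteq> 0"
    using b(2)[of 1 0] b(2)[of 0 1] by auto
  obtain v0 v1 u0 u1 where 1: "b1 = ten v0 v1 u0 u1"
    using rank_one[OF iso[OF mem(1)]] by blast
  obtain w0 w1 t0 t1 where 2: "b2 = ten w0 w1 t0 t1"
    using rank_one[OF iso[OF mem(2)]] by blast
  have n: "v0 \<noteq> 0 \<or> v1 \<noteq> 0" "u0 \<noteq> 0 \<or> u1 \<noteq> 0" "w0 \<noteq> 0 \<or> w1 \<noteq> 0" "t0 \<noteq> 0 \<or> t1 \<noteq> 0"
    using nz unfolding 1 2 ten_eq_0_iff by blast+
  have "(v0 * w1 - v1 * w0) * (u0 * t1 - u1 * t0) = 0"
    using iso[OF mem(3)] unfolding det2_def 1 2 vdot_add_right vdot_ten by (simp add: algebra_simps)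
  then consider "w0 * v1 - w1 * v0 = 0" | "t0 * u1 - t1 * u0 = 0"
    by (auto simp: mult_ac)
  then show ?thesis
  proof cases
    case 1
    obtain k where "w0 = k * v0" "w1 = k * v1"
      using proportional_pairs[OF 1 n(3,1)] by blast
    then have "b2 = ten v0 v1 (k * t0) (k * t1)"
      by (simp only: \<open>b2 = _\<close> ten_scale)
    then have "b1 \<in> T1 v0 v1" "b2 \<in> T1 v0 v1"
      unfolding T1_def \<open>b1 = _\<close> by blast+
    then have "W \<subseteq> T1 v0 v1"
      by (rule sub[OF subspace_T(1)[of v0 v1]])
    then have "W = T1 v0 v1"
      using W dim_T(1)[of v0 v1] subspace_T(1)[of v0 v1] by (intro vec.subspace_dim_equal) simp_all
    with n(1) show ?thesis
      by blast
  next
    case 2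
    obtain k where "t0 = k * u0" "t1 = k * u1"
      using proportional_pairs[OF 2 n(4,2)] by blast
    then have "b2 = ten (k * w0) (k * w1) u0 u1"
      by (simp only: \<open>b2 = _\<close> ten_scale)
    then have "b1 \<in> T2 u0 u1" "b2 \<in> T2 u0 u1"
      unfolding T2_def \<open>b1 = _\<close> by blast+
    then have "W \<subseteq> T2 u0 u1"
      by (rule sub[OF subspace_T(2)[of u0 u1]])
    then have "W = T2 u0 u1"
      using W dim_T(2)[of u0 u1] subspace_T(2)[of u0 u1] by (intro vec.subspace_dim_equal) simp_all
    with n(2) show ?thesis
      by blast
  qed
qed

definition line1 :: "'k \<Rightarrow> 'k \<Rightarrow> ('k ^ 4) set set" where
  "line1 v0 v1 = line_of (T1 v0 v1)"

definition line2 :: "'k \<Rightarrow> 'k \<Rightarrow> ('k ^ 4) set set" where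
  "line2 u0 u1 = line_of (T2 u0 u1)"

lemma line1_scale: "k \<noteq> 0 \<Longrightarrow> line1 (k * v0) (k * v1) = line1 v0 v1"
proof -
  assume k: "k \<noteq> 0"
  have "ten (k * v0) (k * v1) u0 u1 = ten v0 v1 (k * u0) (k * u1)" for u0 u1
    by (simp only: ten_scale)
  moreover have "ten v0 v1 u0 u1 = ten (k * v0) (k * v1) (u0 / k) (u1 / k)" for u0 u1
    using k by (intro eqI) simp_all
  ultimately have "T1 (k * v0) (k * v1) = T1 v0 v1"
    unfolding T1_def by (metis (no_types, lifting))
  then show ?thesis
    by (simp add: line1_def)
qed

lemma line2_scale: "k \<noteq> 0 \<Longrightarrow> line2 (k * u0) (k * u1) = line2 u0 u1"
proof -
  assume k: "k \<noteq> 0"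
  have "ten v0 v1 (k * u0) (k * u1) = ten (k * v0) (k * v1) u0 u1" for v0 v1
    by (simp only: ten_scale)
  moreover have "ten v0 v1 u0 u1 = ten (v0 / k) (v1 / k) (k * u0) (k * u1)" for v0 v1
    using k by (intro eqI) simp_all
  ultimately have "T2 (k * u0) (k * u1) = T2 u0 u1"
    unfolding T2_def by (metis (no_types, lifting))
  then show ?thesis
    by (simp add: line2_def)
qed

lemma line1_cases:
  assumes "p \<in> line1 v0 v1"
  obtains u0 u1 where "p = proj_point (ten v0 v1 u0 u1)" and "u0 \<noteq> 0 \<or> u1 \<noteq> 0"
proof -
  from assms obtain z where z: "z \<noteq> 0" "p = proj_point z" "p \<subseteq> T1 v0 v1"
    unfolding line1_def line_of_def proj_space_def by blast
  then have "z \<in> T1 v0 v1"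
    using vec.span_base[of z "{z}"] by (auto simp: proj_point_def)
  then obtain u0 u1 where "z = ten v0 v1 u0 u1"
    unfolding T1_def by blast
  moreover from this have "u0 \<noteq> 0 \<or> u1 \<noteq> 0"
    using z(1) ten_eq_0_iff by blast
  ultimately show ?thesis
    using that z(2) by blast
qed

lemma mem_line1:
  assumes "v0 \<noteq> 0 \<or> v1 \<noteq> 0" and "u0 \<noteq> 0 \<or> u1 \<noteq> 0" and "w0 \<noteq> 0 \<or> w1 \<noteq> 0"
  shows "proj_point (ten v0 v1 u0 u1) \<in> line1 w0 w1 \<longleftrightarrow> v0 * w1 - v1 * w0 = 0"
proof -
  have "ten v0 v1 u0 u1 \<noteq> 0"
    using assms by (simp add: ten_eq_0_iff)
  then have "proj_point (ten v0 v1 u0 u1) \<in> line1 w0 w1 \<longleftrightarrow> ten v0 v1 u0 u1 \<in> T1 w0 w1"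
    unfolding line1_def by (rule proj_point_in_line_of[OF subspace_T(1)])
  also have "\<dots> \<longleftrightarrow> v0 * w1 - v1 * w0 = 0"
  proof
    assume "ten v0 v1 u0 u1 \<in> T1 w0 w1"
    then obtain t0 t1 where eq: "ten v0 v1 u0 u1 = ten w0 w1 t0 t1"
      unfolding T1_def by blast
    have e: "v0 * u0 = w0 * t0" "v1 * u0 = w1 * t0" "v0 * u1 = w0 * t1" "v1 * u1 = w1 * t1"
      using vdot_ten[of v0 v1 u0 u1, unfolded eq, unfolded vdot_ten] by simp_all
    have "u0 * (v0 * w1 - v1 * w0) = (v0 * u0) * w1 - (v1 * u0) * w0" "u1 * (v0 * w1 - v1 * w0) = (v0 * u1) * w1 - (v1 * u1) * w0"
      by (simp_all add: algebra_simps)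
    then have "u0 * (v0 * w1 - v1 * w0) = 0" "u1 * (v0 * w1 - v1 * w0) = 0"
      unfolding e by simp_all
    then show "v0 * w1 - v1 * w0 = 0"
      using assms(2) by auto
  next
    assume "v0 * w1 - v1 * w0 = 0"
    then obtain k where "v0 = k * w0" "v1 = k * w1"
      using proportional_pairs assms(1,3) by blast
    then have "ten v0 v1 u0 u1 = ten w0 w1 (k * u0) (k * u1)"
      by (simp only: ten_scale)
    then show "ten v0 v1 u0 u1 \<in> T1 w0 w1"
      unfolding T1_def by blast
  qed
  finally show ?thesis .
qed

lemma mem_line2:
  assumes "v0 \<noteq> 0 \<or> v1 \<noteq> 0" and "u0 \<noteq> 0 \<or> u1 \<noteq> 0" and "t0 \<noteq> 0 \<or> t1 \<noteq> 0"
  shows "proj_point (ten v0 v1 u0 u1) \<in> line2 t0 t1 \<longleftrightarrow> u0 * t1 - u1 * t0 = 0"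
proof -
  have "ten v0 v1 u0 u1 \<noteq> 0"
    using assms by (simp add: ten_eq_0_iff)
  then have "proj_point (ten v0 v1 u0 u1) \<in> line2 t0 t1 \<longleftrightarrow> ten v0 v1 u0 u1 \<in> T2 t0 t1"
    unfolding line2_def by (rule proj_point_in_line_of[OF subspace_T(2)])
  also have "\<dots> \<longleftrightarrow> u0 * t1 - u1 * t0 = 0"
  proof
    assume "ten v0 v1 u0 u1 \<in> T2 t0 t1"
    then obtain w0 w1 where eq: "ten v0 v1 u0 u1 = ten w0 w1 t0 t1"
      unfolding T2_def by blast
    have e: "v0 * u0 = w0 * t0" "v1 * u0 = w1 * t0" "v0 * u1 = w0 * t1" "v1 * u1 = w1 * t1"
      using vdot_ten[of v0 v1 u0 u1, unfolded eq, unfolded vdot_ten] by simp_all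
    have "v0 * (u0 * t1 - u1 * t0) = (v0 * u0) * t1 - (v0 * u1) * t0" "v1 * (u0 * t1 - u1 * t0) = (v1 * u0) * t1 - (v1 * u1) * t0"
      by (simp_all add: algebra_simps)
    then have "v0 * (u0 * t1 - u1 * t0) = 0" "v1 * (u0 * t1 - u1 * t0) = 0"
      unfolding e by simp_all
    then show "u0 * t1 - u1 * t0 = 0"
      using assms(1) by auto
  next
    assume "u0 * t1 - u1 * t0 = 0"
    then obtain k where "u0 = k * t0" "u1 = k * t1"
      using proportional_pairs assms(2,3) by blast
    then have "ten v0 v1 u0 u1 = ten (k * v0) (k * v1) t0 t1"
      by (simp only: ten_scale)
    then show "ten v0 v1 u0 u1 \<in> T2 t0 t1"
      unfolding T2_def by blast
  qed
  finally show ?thesis .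
qed

definition ty1 :: "('k ^ 4) set set \<Rightarrow> bool" where
  "ty1 L \<longleftrightarrow> (\<exists>v0 v1. (v0 \<noteq> 0 \<or> v1 \<noteq> 0) \<and> L = line1 v0 v1)"

definition ty2 :: "('k ^ 4) set set \<Rightarrow> bool" where
  "ty2 L \<longleftrightarrow> (\<exists>u0 u1. (u0 \<noteq> 0 \<or> u1 \<noteq> 0) \<and> L = line2 u0 u1)"

lemma ty1_ty2_meet:
  assumes "ty1 L" and "ty2 M"
  shows "\<exists>p. p \<in> L \<and> p \<in> M"
proof -
  obtain v0 v1 u0 u1 where v: "v0 \<noteq> 0 \<or> v1 \<noteq> 0" "L = line1 v0 v1" and u: "u0 \<noteq> 0 \<or> u1 \<noteq> 0" "M = line2 u0 u1"
    using assms unfolding ty1_def ty2_def by blast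
  have "proj_point (ten v0 v1 u0 u1) \<in> L" "proj_point (ten v0 v1 u0 u1) \<in> M"
    unfolding v(2) u(2) mem_line1[OF v(1) u(1) v(1)] mem_line2[OF v(1) u(1) u(1)] by (simp_all add: mult.commute)
  then show ?thesis
    by blast
qed

lemma ty1_nonempty: "ty1 L \<Longrightarrow> \<exists>p. p \<in> L"
  using ty1_ty2_meet[of L "line2 1 0"] unfolding ty2_def by (metis zero_neq_one)

lemma ty1_eqI:
  assumes "ty1 L" "ty1 M" "p \<in> L" "p \<in> M"
  shows "L = M"
proof -
  obtain v0 v1 w0 w1 where v: "v0 \<noteq> 0 \<or> v1 \<noteq> 0" "L = line1 v0 v1" and w: "w0 \<noteq> 0 \<or> w1 \<noteq> 0" "M = line1 w0 w1"
    using assms(1,2) unfolding ty1_def by blast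
  obtain u0 u1 where u: "p = proj_point (ten v0 v1 u0 u1)" "u0 \<noteq> 0 \<or> u1 \<noteq> 0"
    using line1_cases assms(3) unfolding v(2) by blast
  have "v0 * w1 - v1 * w0 = 0"
    using assms(4) unfolding u(1) w(2) mem_line1[OF v(1) u(2) w(1)] .
  then obtain k where k: "k \<noteq> 0" "v0 = k * w0" "v1 = k * w1"
    using proportional_pairs[OF _ v(1) w(1)] by blast
  show ?thesis
    unfolding v(2) w(2) k(2,3) by (rule line1_scale[OF k(1)])
qed

lemma line1_inter_line2:
  assumes v: "v0 \<noteq> 0 \<or> v1 \<noteq> 0" and u: "u0 \<noteq> 0 \<or> u1 \<noteq> 0"
  shows "p \<in> line1 v0 v1 \<and> p \<in> line2 u0 u1 \<longleftrightarrow> p = proj_point (ten v0 v1 u0 u1)"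
proof
  assume p: "p \<in> line1 v0 v1 \<and> p \<in> line2 u0 u1"
  then obtain t0 t1 where t: "p = proj_point (ten v0 v1 t0 t1)" "t0 \<noteq> 0 \<or> t1 \<noteq> 0"
    using line1_cases by blast
  have "t0 * u1 - t1 * u0 = 0"
    using p unfolding t(1) mem_line2[OF v t(2) u] by blast
  then obtain k where "k \<noteq> 0" "t0 = k * u0" "t1 = k * u1"
    using proportional_pairs[OF _ t(2) u] by blast
  then show "p = proj_point (ten v0 v1 u0 u1)"
    by (simp add: t(1) ten_scale proj_point_scale)
next
  assume "p = proj_point (ten v0 v1 u0 u1)"
  then show "p \<in> line1 v0 v1 \<and> p \<in> line2 u0 u1"
    using mem_line1[OF v u v] mem_line2[OF v u u] by (simp add: mult.commute)
qed

text \<open>Abstract rulings might mix the two families. But lines of different families meet and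
  distinct lines of one ruling do not, so a ruling stays in one family. Two rulings in the same
  family would coincide, as only one line of that family passes through a point.\<close>

lemma opposite_rulings:
  assumes R1: "ruling Q R1" and R2: "ruling Q R2" and neq: "R1 \<noteq> R2"
    and types: "\<And>L. proj_line L \<Longrightarrow> L \<subseteq> Q \<Longrightarrow> ty1 L \<or> ty2 L"
    and L1: "L1 \<in> R1" "ty1 L1"
  shows "(\<forall>L\<in>R1. ty1 L) \<and> (\<forall>L\<in>R2. ty2 L)"
proof -
  have r1: "\<forall>L\<in>R1. proj_line L \<and> L \<subseteq> Q" and e1: "\<forall>p\<in>Q. \<exists>!L. L \<in> R1 \<and> p \<in> L"
    using R1 unfolding ruling_def by (rule conjunct1, rule conjunct2)
  have r2: "\<forall>L\<in>R2. proj_line L \<and> L \<subseteq> Q" and e2: "\<forall>p\<in>Q. \<exists>!L. L \<in> R2 \<and> p \<in> L"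
    using R2 unfolding ruling_def by (rule conjunct1, rule conjunct2)
  have t1: "ty1 L \<or> ty2 L" and q1: "p \<in> L \<Longrightarrow> p \<in> Q" if "L \<in> R1" for L p
    using types bspec[OF r1 that] by (simp, meson subsetD)
  have t2: "ty1 L \<or> ty2 L" and q2: "p \<in> L \<Longrightarrow> p \<in> Q" if "L \<in> R2" for L p
    using types bspec[OF r2 that] by (simp, meson subsetD)
  have uniq1: "L = M" if "L \<in> R1" "M \<in> R1" "p \<in> L" "p \<in> M" for L M p
    using bspec[OF e1 q1[OF that(1,3)]] that by blast
  have uniq2: "L = M" if "L \<in> R2" "M \<in> R2" "p \<in> L" "p \<in> M" for L M p
    using bspec[OF e2 q2[OF that(1,3)]] that by blast
  have all1: "ty1 L" if LR: "L \<in> R1" for L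
  proof (rule ccontr)
    assume "\<not> ty1 L"
    then obtain p where "p \<in> L1" "p \<in> L"
      using t1[OF LR] ty1_ty2_meet[OF L1(2), of L] by blast
    with uniq1[OF L1(1) LR] L1(2) \<open>\<not> ty1 L\<close> show False
      by blast
  qed
  have "ty2 L" if L: "L \<in> R2" for L
  proof (rule ccontr)
    assume "\<not> ty2 L"
    then have L': "ty1 L"
      using t2[OF L] by simp
    have all2: "ty1 M" if MR: "M \<in> R2" for M
    proof (rule ccontr)
      assume "\<not> ty1 M"
      then obtain p where "p \<in> L" "p \<in> M"
        using t2[OF MR] ty1_ty2_meet[OF L', of M] by blast
      with uniq2[OF L MR] L' \<open>\<not> ty1 M\<close> show False
        by blast
    qed
    have "N \<in> R2" if N: "N \<in> R1" for N
    proof -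
      obtain p where p: "p \<in> N"
        using ty1_nonempty[OF all1[OF N]] by (rule exE)
      obtain M where M: "M \<in> R2" "p \<in> M"
        using ex1_implies_ex[OF bspec[OF e2 q1[OF N p]]] by blast
      then show ?thesis
        using ty1_eqI[OF all1[OF N] all2[OF M(1)] p M(2)] by simp
    qed
    moreover have "N \<in> R1" if N: "N \<in> R2" for N
    proof -
      obtain p where p: "p \<in> N"
        using ty1_nonempty[OF all2[OF N]] by (rule exE)
      obtain M where M: "M \<in> R1" "p \<in> M"
        using ex1_implies_ex[OF bspec[OF e1 q2[OF N p]]] by blast
      then show ?thesis
        using ty1_eqI[OF all2[OF N] all1[OF M(1)] p M(2)] by simp
    qed
    ultimately show False
      using neq by blast
  qed
  with all1 show ?thesis
    by simp
qed

lemma grid_general_frame: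
  assumes a: "2 \<le> a" and A: "finite A" "card A = a" "\<And>L. L \<in> A \<Longrightarrow> ty1 L"
    and B: "finite B" "card B = a" "\<And>M. M \<in> B \<Longrightarrow> ty2 M"
    and X: "X = {p. \<exists>L\<in>A. \<exists>M\<in>B. p \<in> L \<and> p \<in> M}"
  shows "\<exists>G. (\<exists>\<alpha>. poly_eval G \<alpha> \<noteq> 0) \<and> (\<forall>\<alpha>. poly_eval G \<alpha> \<noteq> 0 \<longrightarrow> adapted_frame_at a X \<alpha>)"
proof -
  obtain h where h: "bij_betw h {0..<a} A"
    using ex_bij_betw_nat_finite[OF A(1)] A(2) by blast
  obtain h' where h': "bij_betw h' {0..<a} B"
    using ex_bij_betw_nat_finite[OF B(1)] B(2) by blast
  have "\<forall>i\<in>{0..<a}. \<exists>v. (fst v \<noteq> 0 \<or> snd v \<noteq> 0) \<and> h i = line1 (fst v) (snd v)"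
  proof
    fix i assume "i \<in> {0..<a}"
    then have "ty1 (h i)"
      using A(3) bij_betwE[OF h] by blast
    then obtain v0 v1 where "v0 \<noteq> 0 \<or> v1 \<noteq> 0" "h i = line1 v0 v1"
      unfolding ty1_def by blast
    then show "\<exists>v. (fst v \<noteq> 0 \<or> snd v \<noteq> 0) \<and> h i = line1 (fst v) (snd v)"
      by (intro exI[of _ "(v0, v1)"]) simp
  qed
  from bchoice[OF this] obtain v where v: "\<forall>i\<in>{0..<a}. (fst (v i) \<noteq> 0 \<or> snd (v i) \<noteq> 0) \<and> h i = line1 (fst (v i)) (snd (v i))"
    by (rule exE)
  have "\<forall>i\<in>{0..<a}. \<exists>u. (fst u \<noteq> 0 \<or> snd u \<noteq> 0) \<and> h' i = line2 (fst u) (snd u)"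
  proof
    fix i assume "i \<in> {0..<a}"
    then have "ty2 (h' i)"
      using B(3) bij_betwE[OF h'] by blast
    then obtain u0 u1 where "u0 \<noteq> 0 \<or> u1 \<noteq> 0" "h' i = line2 u0 u1"
      unfolding ty2_def by blast
    then show "\<exists>u. (fst u \<noteq> 0 \<or> snd u \<noteq> 0) \<and> h' i = line2 (fst u) (snd u)"
      by (intro exI[of _ "(u0, u1)"]) simp
  qed
  from bchoice[OF this] obtain u where u: "\<forall>i\<in>{0..<a}. (fst (u i) \<noteq> 0 \<or> snd (u i) \<noteq> 0) \<and> h' i = line2 (fst (u i)) (snd (u i))"
    by (rule exE)
  show ?thesis
  proof (rule general_adapted_frame[OF a, where ?v0.0 = "\<lambda>i. fst (v i)" and ?v1.0 = "\<lambda>i. snd (v i)"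
        and ?u0.0 = "\<lambda>i. fst (u i)" and ?u1.0 = "\<lambda>i. snd (u i)"])
    show "fst (v i) \<noteq> 0 \<or> snd (v i) \<noteq> 0" if "i < a" for i
      using v that by simp
    show "fst (u i) \<noteq> 0 \<or> snd (u i) \<noteq> 0" if "i < a" for i
      using u that by simp
    show "fst (v i) * snd (v k) - snd (v i) * fst (v k) \<noteq> 0" if ik: "i < a" "k < a" "i \<noteq> k" for i k
    proof
      assume "fst (v i) * snd (v k) - snd (v i) * fst (v k) = 0"
      then obtain c where "c \<noteq> 0" "fst (v i) = c * fst (v k)" "snd (v i) = c * snd (v k)"
        using proportional_pairs[of "fst (v i)" "snd (v k)"] v ik by (metis atLeast0LessThan lessThan_iff)
      then have "h i = h k"
        using v ik line1_scale by simp
      then show False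
        using ik inj_on_eq_iff[OF bij_betw_imp_inj_on[OF h], of i k] by simp
    qed
    show "fst (u i) * snd (u k) - snd (u i) * fst (u k) \<noteq> 0" if ik: "i < a" "k < a" "i \<noteq> k" for i k
    proof
      assume "fst (u i) * snd (u k) - snd (u i) * fst (u k) = 0"
      then obtain c where "c \<noteq> 0" "fst (u i) = c * fst (u k)" "snd (u i) = c * snd (u k)"
        using proportional_pairs[of "fst (u i)" "snd (u k)"] u ik by (metis atLeast0LessThan lessThan_iff)
      then have "h' i = h' k"
        using u ik line2_scale by simp
      then show False
        using ik inj_on_eq_iff[OF bij_betw_imp_inj_on[OF h'], of i k] by simp
    qed
    have AB: "A = h ` {0..<a}" "B = h' ` {0..<a}"
      using bij_betw_imp_surj_on[OF h] bij_betw_imp_surj_on[OF h'] by simp_all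
    have "p \<in> X \<longleftrightarrow> (\<exists>i\<in>{0..<a}. \<exists>j\<in>{0..<a}. p \<in> h i \<and> p \<in> h' j)" for p
      unfolding X AB by simp
    also have "\<dots> p \<longleftrightarrow> (\<exists>i\<in>{0..<a}. \<exists>j\<in>{0..<a}. p = proj_point (ten (fst (v i)) (snd (v i)) (fst (u j)) (snd (u j))))" for p
      using u v by (intro bex_cong refl) (simp add: line1_inter_line2)
    finally have "p \<in> X \<longleftrightarrow> (\<exists>i j. p = proj_point (ten (fst (v i)) (snd (v i)) (fst (u j)) (snd (u j))) \<and> i < a \<and> j < a)" for p
      by (simp add: Bex_def) blast
    then show "X = {proj_point (ten (fst (v i)) (snd (v i)) (fst (u j)) (snd (u j))) | i j. i < a \<and> j < a}"
      by (simp only: set_eq_iff mem_Collect_eq simp_thms)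
  qed
qed

end

subsection \<open>The weak Lefschetz property\<close>

text \<open>Two lines of one ruling are skew and so provide tensor coordinates for the
  quadric.\<close>

lemma grid_adapted:
  fixes X :: "('k::field_char_0 ^ 4) set set"
  assumes a: "2 \<le> a" and grid: "is_grid a a X"
  shows "\<exists>G. (\<exists>\<alpha>. poly_eval G \<alpha> \<noteq> 0) \<and> (\<forall>\<alpha>. poly_eval G \<alpha> \<noteq> 0 \<longrightarrow> adapted_frame_at a X \<alpha>)"
proof -
  obtain Q R1 R2 A B where Q: "smooth_quadric Q" and R1: "ruling Q R1" and R2: "ruling Q R2" and neq: "R1 \<noteq> R2"
    and A: "A \<subseteq> R1" "finite A" "card A = a" and B: "B \<subseteq> R2" "finite B" "card B = a"
    and X: "X = {p. \<exists>L\<in>A. \<exists>M\<in>B. p \<in> L \<and> p \<in> M}"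
    using grid unfolding is_grid_def by (elim exE conjE) (rule that)
  obtain q where q: "q \<in> forms 2" and smooth: "\<forall>v. v \<noteq> 0 \<and> poly_eval q v = 0 \<longrightarrow> (\<exists>i. poly_eval (partial_deriv i q) v \<noteq> 0)"
    and Q_def: "Q = {proj_point v | v. v \<noteq> 0 \<and> poly_eval q v = 0}"
    using Q unfolding smooth_quadric_def by (elim bexE conjE) (rule that)
  have grad: "gradient q v \<noteq> 0" if "v \<noteq> 0" "poly_eval q v = 0" for v
  proof
    assume "gradient q v = 0"
    then have "gradient q v $ i = 0" for i
      by simp
    then have "poly_eval (partial_deriv i q) v = 0" for i
      by (simp only: gradient_def vec_lambda_beta)
    with smooth[rule_format, OF conjI[OF that]] show False
      by simp
  qed
  obtain L1 L2 where L: "L1 \<in> A" "L2 \<in> A" "L1 \<noteq> L2"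
  proof -
    have "1 < card A"
      using a A(3) by simp
    then show ?thesis
      using that card_le_Suc0_iff_eq[OF A(2)] unfolding One_nat_def not_le[symmetric] by blast
  qed
  have line: "proj_line L \<and> L \<subseteq> Q" if "L \<in> R1" for L
    using that R1 unfolding ruling_def by blast
  have L': "L1 \<in> R1" "L2 \<in> R1"
    using L A(1) by blast+
  obtain W1 where W1: "vec.subspace W1" "vec.dim W1 = 2" "L1 = line_of W1" "\<And>w. w \<in> W1 \<Longrightarrow> poly_eval q w = 0"
    by (rule line_on_quadric[OF q Q_def conjunct1[OF line[OF L'(1)]] conjunct2[OF line[OF L'(1)]]]) blast
  obtain W2 where W2: "vec.subspace W2" "vec.dim W2 = 2" "L2 = line_of W2" "\<And>w. w \<in> W2 \<Longrightarrow> poly_eval q w = 0"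
    by (rule line_on_quadric[OF q Q_def conjunct1[OF line[OF L'(2)]] conjunct2[OF line[OF L'(2)]]]) blast
  have disj: "W1 \<inter> W2 = {0}"
  proof -
    have "w = 0" if "w \<in> W1" "w \<in> W2" for w
    proof (rule ccontr)
      assume "w \<noteq> 0"
      then have p: "proj_point w \<in> L1" "proj_point w \<in> L2"
        using that proj_point_in_line_of[OF W1(1)] proj_point_in_line_of[OF W2(1)] W1(3) W2(3) by simp_all
      then have "proj_point w \<in> Q"
        using line[OF L'(1)] by blast
      then have "\<exists>!L. L \<in> R1 \<and> proj_point w \<in> L"
        using R1 unfolding ruling_def by blast
      with p L' L(3) show False
        by blast
    qed
    then show ?thesis
      using vec.subspace_0[OF W1(1)] vec.subspace_0[OF W2(1)] by blast
  qed
  have "\<exists>E00 E01 E10 E11 h00 h01 h10 h11. tensor_frame E00 E01 E10 E11 h00 h01 h10 h11 \<and>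
    W1 = {y *s E00 + z *s E01 | y z. True} \<and>
    (\<forall>\<alpha>. poly_eval q \<alpha> = vdot h00 \<alpha> * vdot h11 \<alpha> - vdot h01 \<alpha> * vdot h10 \<alpha>)"
    by (rule tensor_frame_of_skew_lines[OF q _ W1(1,2,4) W2(1,2,4) disj]) (rule grad)
  then obtain E00 E01 E10 E11 h00 h01 h10 h11 where frame: "tensor_frame E00 E01 E10 E11 h00 h01 h10 h11"
    and W1_eq: "W1 = {y *s E00 + z *s E01 | y z. True}"
    and q_eq: "\<forall>\<alpha>. poly_eval q \<alpha> = vdot h00 \<alpha> * vdot h11 \<alpha> - vdot h01 \<alpha> * vdot h10 \<alpha>"
    by (elim exE conjE) (rule that)
  interpret tensor_frame E00 E01 E10 E11 h00 h01 h10 h11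
    by (rule frame)
  have types: "ty1 L \<or> ty2 L" if LQ: "proj_line L" "L \<subseteq> Q" for L
  proof -
    obtain W where W: "vec.subspace W" "vec.dim W = 2" "L = line_of W" "\<And>w. w \<in> W \<Longrightarrow> poly_eval q w = 0"
      by (rule line_on_quadric[OF q Q_def LQ]) blast
    have "det2 w = 0" if "w \<in> W" for w
      using W(4)[OF that] unfolding det2_def q_eq[rule_format] .
    from isotropic_plane[OF W(1,2) this] show ?thesis
      unfolding ty1_def ty2_def line1_def line2_def W(3) by blast
  qed
  \<comment> \<open>The first line consists of tensors with left factor \<open>(1, 0)\<close>; this
    decides the family of \<open>R1\<close>.\<close>
  have "W1 = T1 1 0"
    unfolding W1_eq T1_def ten_def by simp
  then have "ty1 L1"
    unfolding ty1_def line1_def W1(3) by (intro exI[of _ 1] exI[of _ 0]) simp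
  from opposite_rulings[OF R1 R2 neq types L'(1) this]
  have ty: "\<forall>L\<in>R1. ty1 L" "\<forall>L\<in>R2. ty2 L"
    by simp_all
  show ?thesis
    using ty A(1) B(1) by (intro grid_general_frame[OF a A(2,3) _ B(2,3) _ X]) blast+
qed

theorem theoremA:
  fixes X :: "('k::field_char_0 ^ 4) set set" and a d :: nat
  assumes "a \<ge> 3" and "is_grid a a X" and "d \<ge> 1"
  shows "weak_lefschetz (power_ideal d X) \<longleftrightarrow> d \<le> a - 1 \<or> (a - 1) dvd d"
proof -
  have a: "2 \<le> a"
    using assms(1) by simp
  obtain G where G: "\<exists>\<alpha>. poly_eval G \<alpha> \<noteq> 0" and frames: "\<forall>\<alpha>. poly_eval G \<alpha> \<noteq> 0 \<longrightarrow> adapted_frame_at a X \<alpha>"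
    using grid_adapted[OF a assms(2)] by (elim exE conjE) (rule that, rule exI)
  let ?I = "power_ideal d X"
  define P where "P l \<longleftrightarrow> (\<forall>t. inj_on (quot_mult ?I l) (quot_component ?I t) \<or>
       quot_mult ?I l ` quot_component ?I t = quot_component ?I (Suc t))" for l
  have good: "\<alpha> \<noteq> 0 \<and> artinian_quotient ?I \<and> (P (linear_form \<alpha>) \<longleftrightarrow> d \<le> a - 1 \<or> (a - 1) dvd d)"
    if nz: "poly_eval G \<alpha> \<noteq> 0" for \<alpha>
  proof -
    obtain e00 e10 e01 e11 f00 f10 f01 f11 r s where frame: "grid_frame a e00 e10 e01 e11 f00 f10 f01 f11 r s"
      and \<alpha>: "\<alpha> = e10 - e01"
      and X: "X = {proj_point (grid_frame.pt e00 e10 e01 e11 (r i) (s j)) | i j. i < a \<and> j < a}"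
      using frames[rule_format, OF nz] by (elim exE conjE) (rule that)
    interpret grid_frame a e00 e10 e01 e11 f00 f10 f01 f11 r s
      by (rule frame)
    have I: "?I = grid_ideal d"
      by (rule power_ideal_eq_grid_ideal[OF X])
    have "vdot f10 \<alpha> = 1"
      by (simp add: \<alpha> vdot_diff_right)
    then have "\<alpha> \<noteq> 0"
      by (auto simp: vdot_def)
    moreover have "linear_form \<alpha> = ell"
      by (simp only: \<alpha> ell_def)
    ultimately show ?thesis
      using maximal_rank_iff[OF assms(3)] artinian_grid_ideal unfolding P_def I by simp
  qed
  show ?thesis
  proof
    assume "weak_lefschetz ?I"
    then have "general_linear_form P"
      unfolding weak_lefschetz_def P_def[abs_def] by (rule conjunct2)
    then obtain U where U: "zariski_closed (- U)" "U \<noteq> {}" "\<forall>\<alpha>\<in>U. \<alpha> \<noteq> 0 \<longrightarrow> P (linear_form \<alpha>)"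
      unfolding general_linear_form_def by (elim exE conjE) (rule that)
    obtain S where S: "- U = {v. \<forall>F\<in>S. poly_eval F v = 0}"
      using U(1) unfolding zariski_closed_def by blast
    \<comment> \<open>Two nonempty Zariski open sets meet, so \<open>U\<close> contains a vector to
      which \<open>good\<close> applies.\<close>
    obtain v F where "F \<in> S" "poly_eval F v \<noteq> 0"
      using U(2) S by blast
    then obtain w where w: "poly_eval F w \<noteq> 0" "poly_eval G w \<noteq> 0"
      using exists_common_nonzero G by blast
    then have "w \<in> U"
      using S \<open>F \<in> S\<close> by blast
    then show "d \<le> a - 1 \<or> (a - 1) dvd d"
      using U(3) good[OF w(2)] by blast
  next
    assume R: "d \<le> a - 1 \<or> (a - 1) dvd d"
    let ?U = "{\<alpha>. poly_eval G \<alpha> \<noteq> 0}"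
    have "- ?U = {v. \<forall>F\<in>{G}. poly_eval F v = 0}"
      by auto
    then have "zariski_closed (- ?U)"
      unfolding zariski_closed_def by blast
    moreover have "?U \<noteq> {}"
      using G by blast
    moreover have "\<forall>\<alpha>\<in>?U. \<alpha> \<noteq> 0 \<longrightarrow> P (linear_form \<alpha>)"
      using good R by blast
    ultimately have "general_linear_form P"
      unfolding general_linear_form_def by blast
    moreover have "artinian_quotient ?I"
      using G good by blast
    ultimately show "weak_lefschetz ?I"
      unfolding weak_lefschetz_def P_def[abs_def] by (intro conjI)
  qed
qed

end
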